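(* Let $X$ be a $\sigma$-compact locally compact Hausdorff space, $\kappa$ a perfect kernel on $X$ satisfying the first and the second maximum principles, $A\subset X$ a set such that $\mathcal E^+(A)$ is closed in the strong topology on $\mathcal E^+$, and $f=-U^\zeta$, where $\zeta\in\mathcal E^+$ and $\zeta(X)\leqslant1$. Assume $-\infty<w_f(A)<\infty$ and that either ${\rm cap}_*(A)<\infty$ or $\zeta^A(X)=1$, where $\zeta^A$ is the inner balayage of $\zeta$ onto $A$. Let $\lambda_{A,f}$ be the (existing and unique) measure in $\breve{\mathcal E}^+_f(A)$ with $I_f(\lambda_{A,f})=w_f(A)$, and put $$\eta_{A,f}:=\frac{1-\zeta^A(X)}{{\rm cap}_*(A)},\qquad \Lambda_{A,f}:=\bigl\{\mu\in\mathcal E^+:\ U_f^\mu\geqslant\eta_{A,f}\text{ n.e. on }A\bigr\}.$$ Then $\lambda_{A,f}$ is a measure of minimum total mass in the class $\Lambda_{A,f}$, i.e. $\lambda_{A,f}\in\Lambda_{A,f}$ and $$\lambda_{A,f}(X)=\min_{\mu\in\Lambda_{A,f}}\mu(X)\quad(=1).$$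
   Context: Measures: $\mathfrak M$ is the space of real-valued (signed) Radon measures on $X$ with the vague (weak$^*$) topology of pointwise convergence on continuous functions of compact support; $\mathfrak M^+$ is the cone of positive ones. A measure $\mu\in\mathfrak M^+$ is concentrated on $A\subset X$ if $X\setminus A$ is locally $\mu$-negligible. $S(\mu)$ is the support of $\mu$. $X$ is $\sigma$-compact if it is a countable union of compact sets. $\Phi(Y)$ is the set of lower semicontinuous functions $g:Y\to(-\infty,\infty]$ which are $\geqslant0$ unless the topological space $Y$ is compact. A kernel is a symmetric function $\kappa\in\Phi(X\times X)$. For $\mu\in\mathfrak M$, $U^\mu(x)=\int\kappa(x,y)\,d\mu(y)$ is the potential, $I(\mu,\nu)=\int\kappa\,d(\mu\otimes\nu)$ the mutual energy, $I(\mu)=I(\mu,\mu)$ the energy, whenever well defined. Energy principle: $I(\mu)\geqslant0$ for all $\mu\in\mathfrak M$ for which $I(\mu)$ is well defined, and $I(\mu)=0$ only for $\mu=0$. Then $\mathcal E=\{\mu\in\mathfrak M: I(\mu)\text{ well defined},\ I(\mu)<\infty\}$ is a pre-Hilbert space with inner product $I(\mu,\nu)$ and norm $\|\mu\|=\sqrt{I(\mu)}$; the norm topology is called strong. $\mathcal E^+=\mathcal E\cap\mathfrak M^+$. The kernel is perfect if it satisfies the energy principle, $\mathcal E^+$ is strongly complete, and the strong topology on $\mathcal E^+$ is finer than the vague topology. First (Frostman's) maximum principle: for any $\mu\in\mathcal E^+$ with $U^\mu\leqslant1$ on $S(\mu)$, $U^\mu\leqslant1$ on $X$. Second maximum (domination)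 principle: for any $\mu,\nu\in\mathcal E^+$ with $U^\mu\leqslant U^\nu$ $\mu$-a.e., $U^\mu\leqslant U^\nu$ on $X$. $\mathcal E^+(A)$ is the set of $\mu\in\mathcal E^+$ concentrated on $A$; $\breve{\mathcal E}^+(A)=\{\mu\in\mathcal E^+(A):\mu(X)=1\}$. ${\rm cap}_*(A)=1/w(A)$ with $w(A)=\inf_{\mu\in\breve{\mathcal E}^+(A)}I(\mu)$ is the inner capacity (conventions: $\inf\varnothing=+\infty$, $1/(+\infty)=0$, $1/0=+\infty$; so $\eta_{A,f}=0$ if ${\rm cap}_*(A)=\infty$). "N.e. on $A$" means: except on a subset of $A$ of inner capacity zero. For $\mu\in\mathcal E^+$, let $\Gamma_{A,\mu}=\{\nu\in\mathcal E^+:U^\nu\geqslant U^\mu\text{ n.e. on }A\}$, and let $\mathcal E'(A)$ be the closure of $\mathcal E^+(A)$ in the strong topology on $\mathcal E^+$. The inner balayage $\mu^A$ of $\mu$ onto $A$ is the measure in $\Gamma_{A,\mu}\cap\mathcal E'(A)$ which is (as is known) the unique solution to each of the problems: minimize $\|\nu\|$ over $\nu\in\Gamma_{A,\mu}$; minimize $U^\nu$ (pointwise on $X$) over $\nu\in\Gamma_{A,\mu}$; minimize $\|\mu-\nu\|$ over $\nu\in\mathcal E'(A)$. $\breve{\mathcal E}^+_f(A)$ is the set of $\mu\in\breve{\mathcal E}^+(A)$ for which $f$ is $\mu$-integrable; $I_f(\mu)=I(\mu)+2\int f\,d\mu$; $w_f(A)=\inf_{\mu\in\breve{\mathcal E}^+_f(A)}I_f(\mu)$;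 $U_f^\mu=U^\mu+f$ (well defined n.e. on $X$). *)

theory Defs
  imports "HOL-Analysis.Analysis"
begin

section \<open>Radon measures\<close>

definition sigma_compact :: "'a::topological_space itself \<Rightarrow> bool" where
  "sigma_compact _ \<longleftrightarrow>
     (\<exists>K :: nat \<Rightarrow> 'a set. (\<forall>n. compact (K n)) \<and> (\<Union>n. K n) = UNIV)"

definition Cc :: "('a::topological_space \<Rightarrow> real) set" where
  "Cc = {\<phi>. continuous_on UNIV \<phi> \<and> compact (closure {x. \<phi> x \<noteq> 0})}"

text \<open>
  On a \<open>\<sigma>\<close>-compact locally compact Hausdorff space the positive Radon measures (positive linear
  functionals on \<open>Cc\<close>) are represented by the Borel measures that are finite on compact sets and
  inner regular with respect to compact sets.
\<close>
definition radon :: "'a::topological_space measure set" where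
  "radon = {\<mu>. sets \<mu> = sets borel \<and>
     (\<forall>K. compact K \<longrightarrow> emeasure \<mu> K < \<infinity>) \<and>
     (\<forall>B\<in>sets borel. emeasure \<mu> B = (SUP K\<in>{K. compact K \<and> K \<subseteq> B \<and> K \<in> sets borel}. emeasure \<mu> K))}"

text \<open>
  A real-valued (signed) Radon measure \<open>\<mu>\<close> need not be a set function, since \<open>\<mu>\<^sup>+(X)\<close> and
  \<open>\<mu>\<^sup>-(X)\<close> may both be infinite. It is represented by its Jordan decomposition
  \<open>(\<mu>\<^sup>+, \<mu>\<^sup>-)\<close>, a pair of mutually singular positive Radon measures.
\<close>
definition signed_radon :: "('a::topological_space measure \<times> 'a measure) set" where
  "signed_radon = {(\<mu>p, \<mu>n). \<mu>p \<in> radon \<and> \<mu>n \<in> radon \<and>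
     (\<exists>S\<in>sets borel. emeasure \<mu>p S = 0 \<and> emeasure \<mu>n (- S) = 0)}"

definition support :: "'a::topological_space measure \<Rightarrow> 'a set" where
  "support \<mu> = {x. \<forall>V. open V \<and> x \<in> V \<longrightarrow> emeasure \<mu> V > 0}"

text \<open>The complement of \<open>A\<close> is locally negligible; \<open>A\<close> need not be measurable.\<close>
definition concentrated_on :: "'a::topological_space measure \<Rightarrow> 'a set \<Rightarrow> bool" where
  "concentrated_on \<mu> A \<longleftrightarrow> (\<forall>K. compact K \<longrightarrow> (\<exists>N\<in>null_sets \<mu>. (- A) \<inter> K \<subseteq> N))"

definition vague_topology :: "'a::topological_space measure topology" where
  "vague_topology = topology_generated_by
     {{\<mu>\<in>radon. integral\<^sup>L \<mu> \<phi> \<in> V} | \<phi> V. \<phi> \<in> Cc \<and> open V}"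

text \<open>The Lebesgue integral of an extended real function; meant for functions for which the
  positive and the negative part do not both have infinite integral.\<close>
definition ext_integral :: "'a measure \<Rightarrow> ('a \<Rightarrow> ereal) \<Rightarrow> ereal" where
  "ext_integral \<mu> g =
     enn2ereal (\<integral>\<^sup>+x. e2ennreal (g x) \<partial>\<mu>) - enn2ereal (\<integral>\<^sup>+x. e2ennreal (- g x) \<partial>\<mu>)"

definition ext_integrable :: "'a measure \<Rightarrow> ('a \<Rightarrow> ereal) \<Rightarrow> bool" where
  "ext_integrable \<mu> g \<longleftrightarrow> g \<in> borel_measurable \<mu> \<and> (\<integral>\<^sup>+x. e2ennreal \<bar>g x\<bar> \<partial>\<mu>) < \<infinity>"


section \<open>Kernels, potentials and energies\<close>

text \<open>The class \<open>\<Phi>(Y)\<close>.\<close>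
definition Phi :: "('a::topological_space \<Rightarrow> ereal) set" where
  "Phi = {g. (\<forall>c. open {y. c < g y}) \<and> (\<forall>y. g y \<noteq> -\<infinity>) \<and>
     (\<not> compact (UNIV :: 'a set) \<longrightarrow> (\<forall>y. 0 \<le> g y))}"

definition kernel :: "('a::topological_space \<times> 'a \<Rightarrow> ereal) \<Rightarrow> bool" where
  "kernel \<kappa> \<longleftrightarrow> \<kappa> \<in> Phi \<and> (\<forall>x y. \<kappa> (x, y) = \<kappa> (y, x))"

definition potential :: "('a::topological_space \<times> 'a \<Rightarrow> ereal) \<Rightarrow> 'a measure \<Rightarrow> 'a \<Rightarrow> ereal" where
  "potential \<kappa> \<mu> x = ext_integral \<mu> (\<lambda>y. \<kappa> (x, y))"

text \<open>
  \<open>I(\<mu>,\<nu>) = \<integral>\<kappa> d(\<mu>\<otimes>\<nu>)\<close> for positive Radon measures, where \<open>\<mu>\<otimes>\<nu>\<close> is the Radon product.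
  If \<open>X\<close> is not second countable, the product \<open>\<sigma>\<close>-algebra underlying \<^term>\<open>\<mu> \<Otimes>\<^sub>M \<nu>\<close> can be
  strictly smaller than the Borel \<open>\<sigma>\<close>-algebra of \<open>X \<times> X\<close>, and \<open>\<kappa>\<close> need not be measurable for it.
  The functions in \<open>Cc\<close> are measurable, however, and \<^term>\<open>\<mu> \<Otimes>\<^sub>M \<nu>\<close> restricted to them is the
  Radon product, seen as a linear functional. The integral of a function in \<open>\<Phi>\<close> with respect to a
  Radon measure is, as in Bourbaki, the supremum of the integrals of its minorants in \<open>Cc\<close>.
\<close>
definition mutual_energy ::
  "('a::topological_space \<times> 'a \<Rightarrow> ereal) \<Rightarrow> 'a measure \<Rightarrow> 'a measure \<Rightarrow> ereal" where
  "mutual_energy \<kappa> \<mu> \<nu> =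
     (SUP \<phi>\<in>{\<phi>\<in>Cc. \<forall>z. ereal (\<phi> z) \<le> \<kappa> z}. ereal (integral\<^sup>L (\<mu> \<Otimes>\<^sub>M \<nu>) \<phi>))"

abbreviation energy :: "('a::topological_space \<times> 'a \<Rightarrow> ereal) \<Rightarrow> 'a measure \<Rightarrow> ereal" where
  "energy \<kappa> \<mu> \<equiv> mutual_energy \<kappa> \<mu> \<mu>"

text \<open>
  The energy of the signed measure \<open>\<mu> - \<nu>\<close>. If \<open>(\<mu>, \<nu>)\<close> is a Jordan decomposition, then the two
  terms of the difference are the integrals of \<open>\<kappa>\<close> with respect to the positive and the negative
  part of \<open>(\<mu> - \<nu>) \<otimes> (\<mu> - \<nu>)\<close>, and the energy is well defined iff they are not both infinite.
\<close>
definition diff_energy_defined ::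
  "('a::topological_space \<times> 'a \<Rightarrow> ereal) \<Rightarrow> 'a measure \<Rightarrow> 'a measure \<Rightarrow> bool" where
  "diff_energy_defined \<kappa> \<mu> \<nu> \<longleftrightarrow>
     \<not> (energy \<kappa> \<mu> + energy \<kappa> \<nu> = \<infinity> \<and> 2 * mutual_energy \<kappa> \<mu> \<nu> = \<infinity>)"

definition diff_energy ::
  "('a::topological_space \<times> 'a \<Rightarrow> ereal) \<Rightarrow> 'a measure \<Rightarrow> 'a measure \<Rightarrow> ereal" where
  "diff_energy \<kappa> \<mu> \<nu> = (energy \<kappa> \<mu> + energy \<kappa> \<nu>) - 2 * mutual_energy \<kappa> \<mu> \<nu>"

definition energy_principle :: "('a::topological_space \<times> 'a \<Rightarrow> ereal) \<Rightarrow> bool" where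
  "energy_principle \<kappa> \<longleftrightarrow>
     (\<forall>(\<mu>p, \<mu>n)\<in>signed_radon. diff_energy_defined \<kappa> \<mu>p \<mu>n \<longrightarrow>
        0 \<le> diff_energy \<kappa> \<mu>p \<mu>n \<and>
        (diff_energy \<kappa> \<mu>p \<mu>n = 0 \<longrightarrow> emeasure \<mu>p UNIV = 0 \<and> emeasure \<mu>n UNIV = 0))"

definition Eplus :: "('a::topological_space \<times> 'a \<Rightarrow> ereal) \<Rightarrow> 'a measure set" where
  "Eplus \<kappa> = {\<mu>\<in>radon. energy \<kappa> \<mu> < \<infinity>}"

definition energy_norm :: "('a::topological_space \<times> 'a \<Rightarrow> ereal) \<Rightarrow> 'a measure \<Rightarrow> real" where
  "energy_norm \<kappa> \<mu> = sqrt (real_of_ereal (energy \<kappa> \<mu>))"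

text \<open>
  \<open>\<parallel>\<mu> - \<nu>\<parallel>\<close> for \<open>\<mu>, \<nu> \<in> \<E>\<^sup>+\<close>, with \<open>\<parallel>\<mu> - \<nu>\<parallel>\<^sup>2\<close> expanded by bilinearity of the inner product.
  The value 0 outside \<open>\<E>\<^sup>+\<close> is needed for the library's locale \<open>Metric_space\<close>, which asks for
  a distance that is nonnegative and symmetric on the whole type.
\<close>
definition energy_dist ::
  "('a::topological_space \<times> 'a \<Rightarrow> ereal) \<Rightarrow> 'a measure \<Rightarrow> 'a measure \<Rightarrow> real" where
  "energy_dist \<kappa> \<mu> \<nu> =
     (if \<mu> \<in> Eplus \<kappa> \<and> \<nu> \<in> Eplus \<kappa> then sqrt (real_of_ereal (diff_energy \<kappa> \<mu> \<nu>)) else 0)"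

definition strong_topology ::
  "('a::topological_space \<times> 'a \<Rightarrow> ereal) \<Rightarrow> 'a measure topology" where
  "strong_topology \<kappa> = Metric_space.mtopology (Eplus \<kappa>) (energy_dist \<kappa>)"

definition perfect_kernel :: "('a::topological_space \<times> 'a \<Rightarrow> ereal) \<Rightarrow> bool" where
  "perfect_kernel \<kappa> \<longleftrightarrow> kernel \<kappa> \<and> energy_principle \<kappa> \<and>
     Metric_space.mcomplete (Eplus \<kappa>) (energy_dist \<kappa>) \<and>
     (\<forall>S. openin (subtopology vague_topology (Eplus \<kappa>)) S \<longrightarrow> openin (strong_topology \<kappa>) S)"

definition first_maximum_principle :: "('a::topological_space \<times> 'a \<Rightarrow> ereal) \<Rightarrow> bool" where
  "first_maximum_principle \<kappa> \<longleftrightarrow>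
     (\<forall>\<mu>\<in>Eplus \<kappa>. (\<forall>x\<in>support \<mu>. potential \<kappa> \<mu> x \<le> 1) \<longrightarrow> (\<forall>x. potential \<kappa> \<mu> x \<le> 1))"

definition second_maximum_principle :: "('a::topological_space \<times> 'a \<Rightarrow> ereal) \<Rightarrow> bool" where
  "second_maximum_principle \<kappa> \<longleftrightarrow>
     (\<forall>\<mu>\<in>Eplus \<kappa>. \<forall>\<nu>\<in>Eplus \<kappa>. (AE x in \<mu>. potential \<kappa> \<mu> x \<le> potential \<kappa> \<nu> x) \<longrightarrow>
        (\<forall>x. potential \<kappa> \<mu> x \<le> potential \<kappa> \<nu> x))"


section \<open>Inner capacity and inner balayage\<close>

definition Eplus_on :: "('a::topological_space \<times> 'a \<Rightarrow> ereal) \<Rightarrow> 'a set \<Rightarrow> 'a measure set" where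
  "Eplus_on \<kappa> A = {\<mu>\<in>Eplus \<kappa>. concentrated_on \<mu> A}"

definition Eplus_unit_on ::
  "('a::topological_space \<times> 'a \<Rightarrow> ereal) \<Rightarrow> 'a set \<Rightarrow> 'a measure set" where
  "Eplus_unit_on \<kappa> A = {\<mu>\<in>Eplus_on \<kappa> A. emeasure \<mu> UNIV = 1}"

text \<open>The type \<^typ>\<open>ereal\<close> has \<open>Inf {} = \<infinity>\<close>, \<open>1 / \<infinity> = 0\<close> and \<open>1 / 0 = \<infinity>\<close>.\<close>
definition inner_cap :: "('a::topological_space \<times> 'a \<Rightarrow> ereal) \<Rightarrow> 'a set \<Rightarrow> ereal" where
  "inner_cap \<kappa> A = 1 / (INF \<mu>\<in>Eplus_unit_on \<kappa> A. energy \<kappa> \<mu>)"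

definition nearly_everywhere ::
  "('a::topological_space \<times> 'a \<Rightarrow> ereal) \<Rightarrow> 'a set \<Rightarrow> ('a \<Rightarrow> bool) \<Rightarrow> bool" where
  "nearly_everywhere \<kappa> A P \<longleftrightarrow> inner_cap \<kappa> {x\<in>A. \<not> P x} = 0"

definition Gamma_class ::
  "('a::topological_space \<times> 'a \<Rightarrow> ereal) \<Rightarrow> 'a set \<Rightarrow> 'a measure \<Rightarrow> 'a measure set" where
  "Gamma_class \<kappa> A \<mu> =
     {\<nu>\<in>Eplus \<kappa>. nearly_everywhere \<kappa> A (\<lambda>x. potential \<kappa> \<nu> x \<ge> potential \<kappa> \<mu> x)}"

definition Eprime :: "('a::topological_space \<times> 'a \<Rightarrow> ereal) \<Rightarrow> 'a set \<Rightarrow> 'a measure set" where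
  "Eprime \<kappa> A = strong_topology \<kappa> closure_of Eplus_on \<kappa> A"

definition is_inner_balayage ::
  "('a::topological_space \<times> 'a \<Rightarrow> ereal) \<Rightarrow> 'a set \<Rightarrow> 'a measure \<Rightarrow> 'a measure \<Rightarrow> bool" where
  "is_inner_balayage \<kappa> A \<mu> \<mu>A \<longleftrightarrow>
     \<mu>A \<in> Gamma_class \<kappa> A \<mu> \<inter> Eprime \<kappa> A \<and>
     (\<forall>\<nu>\<in>Gamma_class \<kappa> A \<mu>. energy_norm \<kappa> \<mu>A \<le> energy_norm \<kappa> \<nu>) \<and>
     (\<forall>\<nu>\<in>Gamma_class \<kappa> A \<mu>. \<forall>x. potential \<kappa> \<mu>A x \<le> potential \<kappa> \<nu> x) \<and>
     (\<forall>\<nu>\<in>Eprime \<kappa> A. energy_dist \<kappa> \<mu> \<mu>A \<le> energy_dist \<kappa> \<mu> \<nu>)"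


section \<open>The Gauss variational problem with external field\<close>

definition Eplus_field_on ::
  "('a::topological_space \<times> 'a \<Rightarrow> ereal) \<Rightarrow> ('a \<Rightarrow> ereal) \<Rightarrow> 'a set \<Rightarrow> 'a measure set" where
  "Eplus_field_on \<kappa> f A = {\<mu>\<in>Eplus_unit_on \<kappa> A. ext_integrable \<mu> f}"

definition field_energy ::
  "('a::topological_space \<times> 'a \<Rightarrow> ereal) \<Rightarrow> ('a \<Rightarrow> ereal) \<Rightarrow> 'a measure \<Rightarrow> ereal" where
  "field_energy \<kappa> f \<mu> = energy \<kappa> \<mu> + 2 * ext_integral \<mu> f"

definition w_field ::
  "('a::topological_space \<times> 'a \<Rightarrow> ereal) \<Rightarrow> ('a \<Rightarrow> ereal) \<Rightarrow> 'a set \<Rightarrow> ereal" where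
  "w_field \<kappa> f A = (INF \<mu>\<in>Eplus_field_on \<kappa> f A. field_energy \<kappa> f \<mu>)"

definition is_field_minimizer ::
  "('a::topological_space \<times> 'a \<Rightarrow> ereal) \<Rightarrow> ('a \<Rightarrow> ereal) \<Rightarrow> 'a set \<Rightarrow> 'a measure \<Rightarrow> bool" where
  "is_field_minimizer \<kappa> f A lam \<longleftrightarrow>
     lam \<in> Eplus_field_on \<kappa> f A \<and> field_energy \<kappa> f lam = w_field \<kappa> f A"

text \<open>\<open>U\<^sub>f\<^sup>\<mu> = U\<^sup>\<mu> + f\<close>. In \<^typ>\<open>ereal\<close> the sum \<open>\<infinity> + (-\<infinity>)\<close> is \<open>\<infinity>\<close>, so the points where
  \<open>U\<^sub>f\<^sup>\<mu>\<close> is undefined have to be excluded explicitly.\<close>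
definition weighted_potential ::
  "('a::topological_space \<times> 'a \<Rightarrow> ereal) \<Rightarrow> ('a \<Rightarrow> ereal) \<Rightarrow> 'a measure \<Rightarrow> 'a \<Rightarrow> ereal" where
  "weighted_potential \<kappa> f \<mu> x = potential \<kappa> \<mu> x + f x"

definition weighted_potential_defined ::
  "('a::topological_space \<times> 'a \<Rightarrow> ereal) \<Rightarrow> ('a \<Rightarrow> ereal) \<Rightarrow> 'a measure \<Rightarrow> 'a \<Rightarrow> bool" where
  "weighted_potential_defined \<kappa> f \<mu> x \<longleftrightarrow>
     \<not> (potential \<kappa> \<mu> x = \<infinity> \<and> f x = -\<infinity>) \<and> \<not> (potential \<kappa> \<mu> x = -\<infinity> \<and> f x = \<infinity>)"

definition Lambda_class ::
  "('a::topological_space \<times> 'a \<Rightarrow> ereal) \<Rightarrow> ('a \<Rightarrow> ereal) \<Rightarrow> 'a set \<Rightarrow> ereal \<Rightarrow> 'a measure set" where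
  "Lambda_class \<kappa> f A \<eta> =
     {\<mu>\<in>Eplus \<kappa>. nearly_everywhere \<kappa> A
        (\<lambda>x. weighted_potential_defined \<kappa> f \<mu> x \<and> weighted_potential \<kappa> f \<mu> x \<ge> \<eta>)}"

end

theory Submission
  imports Defs
begin

text \<open>
  Let \<open>\<gamma>\<close> be the equilibrium measure of \<open>A\<close>, with \<open>U\<^sup>\<gamma> = 1\<close> n.e. on \<open>A\<close> and \<open>\<gamma>(X) = cap\<^sub>*(A)\<close>. The measure
  \<open>\<lambda> = \<zeta>\<^sup>A + \<eta> \<gamma>\<close> is a unit measure concentrated on \<open>A\<close> (strong closedness of \<open>\<E>\<^sup>+(A)\<close> is used
  both for \<open>\<zeta>\<^sup>A\<close> and for \<open>\<gamma>\<close>) and \<open>U\<^sup>\<lambda> = U\<^sup>\<zeta> + \<eta>\<close> n.e. on \<open>A\<close>. Hence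
  \<open>I\<^sub>f(\<nu>) - I\<^sub>f(\<lambda>) = \<parallel>\<nu> - \<lambda>\<parallel>\<^sup>2\<close> for every competitor \<open>\<nu>\<close>, so \<open>\<lambda>\<close> is the minimizer. If
  \<open>U\<^sup>\<mu> - U\<^sup>\<zeta> \<ge> \<eta>\<close> n.e. on \<open>A\<close>, then \<open>U\<^sup>\<lambda> \<le> U\<^sup>\<mu>\<close> \<open>\<lambda>\<close>-a.e., hence everywhere by the domination principle, and
  integrating against the equilibrium measures of compact sets, whose potentials are at most 1 by
  Frostman's principle, gives \<open>\<lambda>(X) \<le> \<mu>(X)\<close>.

  \<open>X\<close> need not be second countable, so Fubini's theorem for the lower semicontinuous kernel has to
  be derived from the \<open>\<tau>\<close>-smoothness of Radon measures.
\<close>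


section \<open>Functions of compact support\<close>

text \<open>The constant \<eta> is forced by the masses: \<zeta>^A + \<eta> \<gamma> has mass
  \<zeta>^A(X) + \<eta> cap(A), which has to be 1. If the capacity is infinite, then \<zeta>^A(X) =
  1 by hypothesis, so \<eta> = 0 and \<zeta>^A alone is the minimizer, without any equilibrium
  measure. Exceptional sets need not be measurable, so statements n.e. on A are tested by unit
  measures of finite energy: a set has inner capacity zero iff none of them is concentrated on it,
  and a Borel set charged by a measure of finite energy carries one. What is used of \<lambda> then
  shrinks to the identity I(\<lambda>, \<nu>) = I(\<zeta>, \<nu>) + \<eta> for unit competitors
  \<nu> on A. Uniqueness, membership in the class and minimality of the mass all follow from it. The
  inner product has to be earned as well. The energy principle speaks of mutually singular pairs, so
  two positive measures are first freed of their common part, and finiteness of mutual energies is a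
  consequence of the principle.\<close>

lemma CcI:
  fixes \<phi> :: "'a::t2_space \<Rightarrow> real"
  assumes "continuous_on UNIV \<phi>" "compact L" "{x. \<phi> x \<noteq> 0} \<subseteq> L"
  shows "\<phi> \<in> Cc"
proof -
  have "closure {x. \<phi> x \<noteq> 0} \<subseteq> L"
    by (intro closure_minimal assms compact_imp_closed)
  then have "compact (closure {x. \<phi> x \<noteq> 0})"
    using assms(2) by (metis closed_closure compact_Int_closed inf.absorb_iff2)
  then show ?thesis using assms(1) by (simp add: Cc_def)
qed

text \<open>Complete regularity separates \<open>K\<close> from closed sets but gives no compact
  support. Letting the function vanish off \<open>U \<inter> W\<close>, where \<open>U\<close> lies
  in a compact \<open>L\<close>, supplies it.\<close>

lemma LCH_Urysohn:
  fixes K W :: "'b::t2_space set"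
  assumes lc: "locally_compact_space (euclidean :: 'b topology)"
    and K: "compact K" and W: "open W" "K \<subseteq> W"
  obtains \<phi> where "\<phi> \<in> Cc" "\<And>x. 0 \<le> \<phi> x" "\<And>x. \<phi> x \<le> 1"
    "\<And>x. x \<in> K \<Longrightarrow> \<phi> x = 1" "\<And>x. x \<notin> W \<Longrightarrow> \<phi> x = 0"
proof -
  have H: "Hausdorff_space (euclidean :: 'b topology)"
    unfolding Hausdorff_space_def disjnt_def open_openin[symmetric] using hausdorff by meson
  obtain U L where UL: "open U" "compact L" "closed L" "K \<subseteq> U" "U \<subseteq> L"
    using locally_compact_space_compact_closed_compact[of "euclidean :: 'b topology"] H lc K
    by (auto simp: closed_closedin[symmetric])
  have cr: "completely_regular_space (euclidean :: 'b topology)"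
    using locally_compact_regular_imp_completely_regular_space lc H by blast
  have cl: "closedin euclidean (- (U \<inter> W))"
    using UL W by (simp only: closed_closedin[symmetric] closed_def double_complement open_Int)
  have dj: "disjnt K (- (U \<inter> W))"
    using UL W by (auto simp: disjnt_def)
  obtain f where
    f: "continuous_map euclidean (top_of_set {0..1::real}) f" "f ` (- (U \<inter> W)) \<subseteq> {0}" "f ` K \<subseteq> {1}"
    by (rule Urysohn_completely_regular_compact_closed[OF zero_le_one cr K[folded compactin_euclidean_iff] cl dj])
  have r: "f x \<in> {0..1}" for x
    using f(1) by (auto simp: continuous_map_in_subtopology Pi_iff)
  have c: "continuous_on UNIV f"
    using f(1) by (simp add: continuous_map_in_subtopology)
  have "{x. f x \<noteq> 0} \<subseteq> L"
    using f(2) UL by auto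
  with c UL(2) have "f \<in> Cc" by (rule CcI)
  show thesis
    by (rule that[OF \<open>f \<in> Cc\<close>]) (use r f in \<open>auto simp: image_subset_iff\<close>)
qed

lemma locally_compact_prod:
  assumes "locally_compact_space (euclidean :: 'a::t2_space topology)"
  shows "locally_compact_space (euclidean :: ('a \<times> 'a) topology)"
proof -
  have "locally_compact_space (prod_topology (euclidean :: 'a topology) (euclidean :: 'a topology))"
    using assms by (subst locally_compact_space_prod_topology) blast
  then show ?thesis by simp
qed


section \<open>Radon measures\<close>

lemma radonD:
  assumes "\<mu> \<in> radon"
  shows radon_sets: "sets \<mu> = sets borel"
    and radon_compact: "compact K \<Longrightarrow> emeasure \<mu> K < \<infinity>"
    and radon_space: "space \<mu> = UNIV"
  using assms sets_eq_imp_space_eq[of \<mu> borel] by (auto simp: radon_def)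

lemma compact_borel [simp]: "compact (K :: 'a::t2_space set) \<Longrightarrow> K \<in> sets borel"
  by (simp add: compact_imp_closed)

lemma emeasure_Diff_compact:
  fixes K B :: "'a::t2_space set"
  assumes "sets \<sigma> = sets borel" "B \<in> sets borel" "compact K" "K \<subseteq> B"
  shows "emeasure \<sigma> B = emeasure \<sigma> K + emeasure \<sigma> (B - K)"
proof -
  have "K \<union> (B - K) = B" using assms(4) by blast
  then show ?thesis
    using plus_emeasure[of K \<sigma> "B - K"] assms(1,2) compact_borel[OF assms(3)] by (simp add: sets.Diff)
qed

lemma radon_inner:
  fixes B :: "'a::t2_space set"
  assumes "\<mu> \<in> radon" "B \<in> sets borel"
  shows "emeasure \<mu> B = (SUP K\<in>{K. compact K \<and> K \<subseteq> B}. emeasure \<mu> K)"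
proof -
  have "{K. compact K \<and> K \<subseteq> B \<and> K \<in> sets borel} = {K. compact K \<and> K \<subseteq> B}"
    by auto
  then show ?thesis using assms by (auto simp: radon_def)
qed

lemma radon_inner_pos:
  fixes B :: "'a::t2_space set"
  assumes "\<mu> \<in> radon" "B \<in> sets borel" "emeasure \<mu> B > 0"
  obtains K where "compact K" "K \<subseteq> B" "emeasure \<mu> K > 0"
  using assms(3) unfolding radon_inner[OF assms(1,2)] by (auto simp: less_SUP_iff)

lemma sigma_compact_incseq:
  assumes "sigma_compact TYPE('a::t2_space)"
  obtains K :: "nat \<Rightarrow> 'a::t2_space set" where "\<And>n. compact (K n)" "incseq K" "(\<Union>n. K n) = UNIV"
proof -
  obtain L :: "nat \<Rightarrow> 'a set" where L: "\<And>n. compact (L n)" "(\<Union>n. L n) = UNIV"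
    using assms by (auto simp: sigma_compact_def)
  show thesis
  proof
    show "compact (\<Union>i\<le>n. L i)" for n using L by (intro compact_UN) auto
    show "incseq (\<lambda>n. \<Union>i\<le>n. L i)" by (intro monoI UN_mono) auto
    show "(\<Union>n. \<Union>i\<le>n. L i) = UNIV" using L(2) by (fastforce simp: set_eq_iff)
  qed
qed

text \<open>By \<sigma>-compactness a Borel set is the increasing union of its parts in compact
  sets, so inner regularity only needs checking on those. There the measure is finite, and
  approximation up to \<open>e\<close> is enough.\<close>

lemma radonI:
  fixes \<sigma> :: "'a::t2_space measure"
  assumes sc: "sigma_compact TYPE('a)"
    and sets: "sets \<sigma> = sets borel"
    and fin: "\<And>K. compact K \<Longrightarrow> emeasure \<sigma> K < \<infinity>"
    and inner: "\<And>B L e. B \<in> sets borel \<Longrightarrow> compact L \<Longrightarrow> B \<subseteq> L \<Longrightarrow> e > 0 \<Longrightarrow>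
       \<exists>K. compact K \<and> K \<subseteq> B \<and> emeasure \<sigma> B \<le> emeasure \<sigma> K + ennreal e"
  shows "\<sigma> \<in> radon"
proof -
  obtain K :: "nat \<Rightarrow> 'a set" where K: "\<And>n. compact (K n)" "incseq K" "(\<Union>n. K n) = UNIV"
    using sigma_compact_incseq[OF sc] by blast
  have "emeasure \<sigma> B = (SUP K\<in>{K. compact K \<and> K \<subseteq> B \<and> K \<in> sets borel}. emeasure \<sigma> K)" (is "_ = ?S")
    if B: "B \<in> sets borel" for B
  proof (rule antisym)
    show "?S \<le> emeasure \<sigma> B"
      using B sets by (intro SUP_least emeasure_mono) auto
    have "incseq (\<lambda>n. B \<inter> K n)" using K(2) by (auto simp: mono_def)
    then have "emeasure \<sigma> (\<Union>n. B \<inter> K n) = (SUP n. emeasure \<sigma> (B \<inter> K n))"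
      using B K sets by (intro SUP_emeasure_incseq[symmetric]) auto
    moreover have "(\<Union>n. B \<inter> K n) = B" using K(3) by blast
    ultimately have eq: "emeasure \<sigma> B = (SUP n. emeasure \<sigma> (B \<inter> K n))" by simp
    show "emeasure \<sigma> B \<le> ?S"
      unfolding eq
    proof (rule SUP_least)
      fix n
      have "emeasure \<sigma> (B \<inter> K n) \<le> ?S + ennreal e" if e: "e > 0" for e
      proof -
        have "\<exists>C. compact C \<and> C \<subseteq> B \<inter> K n \<and> emeasure \<sigma> (B \<inter> K n) \<le> emeasure \<sigma> C + ennreal e"
          by (rule inner[OF sets.Int[OF B compact_borel[OF K(1)[of n]]] K(1)[of n] Int_lower2 e])
        then obtain C where C: "compact C" "C \<subseteq> B \<inter> K n" "emeasure \<sigma> (B \<inter> K n) \<le> emeasure \<sigma> C + ennreal e"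
          by auto
        have "emeasure \<sigma> C \<le> ?S" using C by (intro SUP_upper) auto
        then show ?thesis using order_trans[OF C(3) add_right_mono] by simp
      qed
      then show "emeasure \<sigma> (B \<inter> K n) \<le> ?S" by (rule ennreal_le_epsilon)
    qed
  qed
  then show ?thesis using sets fin by (auto simp: radon_def)
qed

text \<open>Inner regularity is restated as smallness of \<open>B - K\<close> because, for sets of
  finite measure, this form passes directly to sums, multiples and smaller measures.\<close>

lemma radon_approx:
  fixes B :: "'a::t2_space set"
  assumes \<mu>: "\<mu> \<in> radon" and B: "B \<in> sets borel" "emeasure \<mu> B < \<infinity>" and e: "e > (0::real)"
  obtains K where "compact K" "K \<subseteq> B" "emeasure \<mu> (B - K) \<le> ennreal e"
proof (cases "emeasure \<mu> B = 0")
  case True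
  then show thesis by (intro that[of "{}"]) auto
next
  case False
  then have "emeasure \<mu> B - ennreal e < emeasure \<mu> B"
    using B e by (cases "emeasure \<mu> B") (auto simp: ennreal_minus ennreal_lessI)
  then have "emeasure \<mu> B - ennreal e < (SUP K\<in>{K. compact K \<and> K \<subseteq> B}. emeasure \<mu> K)"
    using radon_inner[OF \<mu> B(1)] by simp
  then obtain K where K: "compact K" "K \<subseteq> B" "emeasure \<mu> B - ennreal e < emeasure \<mu> K"
    by (auto simp: less_SUP_iff)
  have "emeasure \<mu> (B - K) = emeasure \<mu> B - emeasure \<mu> K"
    using K B radon_sets[OF \<mu>] radon_compact[OF \<mu> K(1)] by (intro emeasure_Diff) auto
  also have "\<dots> \<le> ennreal e"
    using K(3) B(2) radon_compact[OF \<mu> K(1)] e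
    by (cases "emeasure \<mu> B"; cases "emeasure \<mu> K")
       (auto simp: ennreal_minus ennreal_le_iff ennreal_less_iff not_le dest!: ennreal_less_iff[THEN iffD1, rotated])
  finally show thesis using K that by blast
qed

lemma radon_sigma_finite:
  fixes \<mu> :: "'a::t2_space measure"
  assumes "sigma_compact TYPE('a)" "\<mu> \<in> radon"
  shows "sigma_finite_measure \<mu>"
proof -
  obtain K :: "nat \<Rightarrow> 'a set" where K: "\<And>n. compact (K n)" "incseq K" "(\<Union>n. K n) = UNIV"
    using sigma_compact_incseq[OF assms(1)] by blast
  show ?thesis
  proof
    show "\<exists>A. countable A \<and> A \<subseteq> sets \<mu> \<and> \<Union>A = space \<mu> \<and> (\<forall>a\<in>A. emeasure \<mu> a \<noteq> \<infinity>)"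
      using K radonD[OF assms(2)] by (intro exI[of _ "range K"]) (auto simp: less_top[symmetric])
  qed
qed

text \<open>A Radon measure inherits inner regularity downwards because the part of a relatively compact
  set missed by a compact subset is small already for the larger measure.\<close>
lemma radon_dominated:
  fixes \<mu> \<sigma> :: "'a::t2_space measure"
  assumes sc: "sigma_compact TYPE('a)" and \<mu>: "\<mu> \<in> radon" and sets: "sets \<sigma> = sets borel"
    and le: "\<And>B. B \<in> sets borel \<Longrightarrow> emeasure \<sigma> B \<le> emeasure \<mu> B"
  shows "\<sigma> \<in> radon"
proof (rule radonI[OF sc sets])
  show "emeasure \<sigma> K < \<infinity>" if "compact K" for K
    using le[of K] radon_compact[OF \<mu> that] that by (auto intro: le_less_trans)
  fix B L :: "'a set" and e :: real
  assume B: "B \<in> sets borel" "compact L" "B \<subseteq> L" "e > 0"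
  have "emeasure \<mu> B \<le> emeasure \<mu> L" using B radon_sets[OF \<mu>] by (intro emeasure_mono) auto
  then have "emeasure \<mu> B < \<infinity>" using radon_compact[OF \<mu> B(2)] by (auto intro: le_less_trans)
  then obtain K where K: "compact K" "K \<subseteq> B" "emeasure \<mu> (B - K) \<le> ennreal e"
    using radon_approx[OF \<mu> B(1) _ B(4)] by blast
  have "emeasure \<sigma> B = emeasure \<sigma> K + emeasure \<sigma> (B - K)"
    using emeasure_Diff_compact[OF sets B(1) K(1,2)] .
  also have "\<dots> \<le> emeasure \<sigma> K + ennreal e"
    using order_trans[OF le[of "B - K"] K(3)] K(1) B(1) by (intro add_left_mono) (simp add: sets.Diff)
  finally show "\<exists>K. compact K \<and> K \<subseteq> B \<and> emeasure \<sigma> B \<le> emeasure \<sigma> K + ennreal e"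
    using K by blast
qed

lemma radon_density_indicator:
  fixes \<mu> :: "'a::t2_space measure"
  assumes sc: "sigma_compact TYPE('a)" and \<mu>: "\<mu> \<in> radon" and S: "S \<in> sets borel"
  shows "density \<mu> (indicator S) \<in> radon"
proof (rule radon_dominated[OF sc \<mu>])
  show "sets (density \<mu> (indicator S)) = sets borel" using radon_sets[OF \<mu>] by simp
  show "emeasure (density \<mu> (indicator S)) B \<le> emeasure \<mu> B" if "B \<in> sets borel" for B
  proof -
    have "emeasure (density \<mu> (indicator S)) B = (\<integral>\<^sup>+x. indicator S x * indicator B x \<partial>\<mu>)"
      using S that radon_sets[OF \<mu>] by (intro emeasure_density) auto
    also have "\<dots> \<le> (\<integral>\<^sup>+x. indicator B x \<partial>\<mu>)"
      by (intro nn_integral_mono) (auto split: split_indicator)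
    also have "\<dots> = emeasure \<mu> B" using that radon_sets[OF \<mu>] by simp
    finally show ?thesis .
  qed
qed

section \<open>Multiples and sums of Radon measures\<close>

lemma radon_scale:
  fixes \<mu> :: "'a::t2_space measure"
  assumes sc: "sigma_compact TYPE('a)" and \<mu>: "\<mu> \<in> radon" and a: "0 \<le> a"
  shows "scale_measure (ennreal a) \<mu> \<in> radon"
proof (rule radonI[OF sc])
  show "sets (scale_measure (ennreal a) \<mu>) = sets borel" using radon_sets[OF \<mu>] by simp
  show "emeasure (scale_measure (ennreal a) \<mu>) K < \<infinity>" if "compact K" for K
    using radon_compact[OF \<mu> that] by (simp add: ennreal_mult_less_top)
  fix B L :: "'a set" and e :: real
  assume B: "B \<in> sets borel" "compact L" "B \<subseteq> L" "e > 0"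
  have "emeasure \<mu> B \<le> emeasure \<mu> L" using B radon_sets[OF \<mu>] by (intro emeasure_mono) auto
  then have "emeasure \<mu> B < \<infinity>" using radon_compact[OF \<mu> B(2)] by (auto intro: le_less_trans)
  \<comment> \<open>The denominator \<open>a + 1\<close> covers \<open>a = 0\<close> and still gives
    \<open>a * (e / (a + 1)) \<le> e\<close>.\<close>
  moreover have "e / (a + 1) > 0" using a B by simp
  ultimately obtain K where K: "compact K" "K \<subseteq> B" "emeasure \<mu> (B - K) \<le> ennreal (e / (a + 1))"
    using radon_approx[OF \<mu> B(1)] by blast
  have "emeasure \<mu> B = emeasure \<mu> K + emeasure \<mu> (B - K)"
    using emeasure_Diff_compact[OF radon_sets[OF \<mu>] B(1) K(1,2)] .
  also have "\<dots> \<le> emeasure \<mu> K + ennreal (e / (a + 1))"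
    using K by (intro add_left_mono)
  finally have "ennreal a * emeasure \<mu> B \<le> ennreal a * (emeasure \<mu> K + ennreal (e / (a + 1)))"
    by (rule mult_left_mono) simp
  also have "\<dots> = ennreal a * emeasure \<mu> K + ennreal (a * (e / (a + 1)))"
    using a B by (simp add: distrib_left ennreal_mult[symmetric])
  also have "\<dots> \<le> ennreal a * emeasure \<mu> K + ennreal e"
    using a B by (intro add_left_mono ennreal_leI) (simp add: field_simps)
  finally show "\<exists>K. compact K \<and> K \<subseteq> B \<and> emeasure (scale_measure (ennreal a) \<mu>) B
      \<le> emeasure (scale_measure (ennreal a) \<mu>) K + ennreal e"
    using K by auto
qed

definition measure_add :: "'a measure \<Rightarrow> 'a measure \<Rightarrow> 'a measure" where
  "measure_add \<mu> \<nu> = measure_of (space \<mu>) (sets \<mu>) (\<lambda>B. emeasure \<mu> B + emeasure \<nu> B)"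

lemma sets_measure_add [simp]: "sets (measure_add \<mu> \<nu>) = sets \<mu>"
  by (simp add: measure_add_def)

lemma emeasure_measure_add:
  assumes "sets \<nu> = sets \<mu>" "B \<in> sets \<mu>"
  shows "emeasure (measure_add \<mu> \<nu>) B = emeasure \<mu> B + emeasure \<nu> B"
  unfolding measure_add_def
proof (rule emeasure_measure_of_sigma)
  show "sigma_algebra (space \<mu>) (sets \<mu>)" ..
  show "positive (sets \<mu>) (\<lambda>B. emeasure \<mu> B + emeasure \<nu> B)" by (simp add: positive_def)
  show "countably_additive (sets \<mu>) (\<lambda>B. emeasure \<mu> B + emeasure \<nu> B)"
    using assms(1)
    by (auto simp: countably_additive_def suminf_add[symmetric] suminf_emeasure)
qed (rule assms)

lemma nn_integral_measure_add:
  fixes \<mu> \<nu> :: "'a measure"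
  assumes s: "sets \<nu> = sets \<mu>" and f: "f \<in> borel_measurable \<mu>"
  shows "(\<integral>\<^sup>+x. f x \<partial>measure_add \<mu> \<nu>) = (\<integral>\<^sup>+x. f x \<partial>\<mu>) + (\<integral>\<^sup>+x. f x \<partial>\<nu>)"
proof -
  have sp: "space \<nu> = space \<mu>" "space (measure_add \<mu> \<nu>) = space \<mu>"
    using sets_eq_imp_space_eq[OF s] by (simp_all add: measure_add_def space_measure_of_conv)
  have m: "g \<in> borel_measurable (measure_add \<mu> \<nu>)" "g \<in> borel_measurable \<nu>"
    if "g \<in> borel_measurable \<mu>" for g :: "_ \<Rightarrow> ennreal"
    using that s by (simp_all cong: measurable_cong_sets)
  show ?thesis
    using f
  proof induct
    case (cong f g)
    have "integral\<^sup>N N f = integral\<^sup>N N g" if "space N = space \<mu>" for N :: "'a measure"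
      using cong(3) that by (intro nn_integral_cong) simp
    then show ?case using cong sp by simp
  next
    case (set A)
    then show ?case using s by (simp add: emeasure_measure_add)
  next
    case (mult u c)
    then show ?case by (simp add: nn_integral_cmult m distrib_left)
  next
    case (add u v)
    then show ?case by (simp add: nn_integral_add m ac_simps)
  next
    case (seq U)
    have inc: "incseq (\<lambda>i. nn_integral N (U i))" for N
      using \<open>incseq U\<close> by (intro monoI nn_integral_mono) (simp add: incseq_def le_fun_def)
    have sup: "integral\<^sup>N N (SUP i. U i) = (SUP i. integral\<^sup>N N (U i))" if "\<And>i. U i \<in> borel_measurable N" for N
      unfolding SUP_apply by (rule nn_integral_monotone_convergence_SUP[OF \<open>incseq U\<close> that])
    have Um: "U i \<in> borel_measurable \<mu>" for i by fact
    have "integral\<^sup>N (measure_add \<mu> \<nu>) (SUP i. U i) = (SUP i. integral\<^sup>N \<mu> (U i) + integral\<^sup>N \<nu> (U i))"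
      using seq by (subst sup) (simp_all add: m)
    also have "\<dots> = (SUP i. integral\<^sup>N \<mu> (U i)) + (SUP i. integral\<^sup>N \<nu> (U i))"
      by (rule ennreal_SUP_add[OF inc inc])
    also have "\<dots> = integral\<^sup>N \<mu> (SUP i. U i) + integral\<^sup>N \<nu> (SUP i. U i)"
      by (simp only: sup[OF Um] sup[OF m(2)[OF Um]])
    finally show ?case .
  qed
qed

lemma radon_add:
  fixes \<mu> \<nu> :: "'a::t2_space measure"
  assumes sc: "sigma_compact TYPE('a)" and \<mu>: "\<mu> \<in> radon" and \<nu>: "\<nu> \<in> radon"
  shows "measure_add \<mu> \<nu> \<in> radon"
proof (rule radonI[OF sc])
  have s: "sets \<nu> = sets \<mu>" "sets \<mu> = sets borel" using radon_sets \<mu> \<nu> by auto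
  show "sets (measure_add \<mu> \<nu>) = sets borel" using s by simp
  have em: "emeasure (measure_add \<mu> \<nu>) B = emeasure \<mu> B + emeasure \<nu> B" if "B \<in> sets borel" for B
    using emeasure_measure_add[OF s(1)] that s by simp
  show "emeasure (measure_add \<mu> \<nu>) K < \<infinity>" if "compact K" for K
    using that radon_compact[OF \<mu> that] radon_compact[OF \<nu> that] by (simp add: em)
  fix B L :: "'a set" and e :: real
  assume B: "B \<in> sets borel" "compact L" "B \<subseteq> L" "e > 0"
  have "\<exists>K. compact K \<and> K \<subseteq> B \<and> emeasure \<rho> (B - K) \<le> ennreal (e / 2)" if \<rho>: "\<rho> \<in> radon" for \<rho>
  proof -
    have "emeasure \<rho> B \<le> emeasure \<rho> L" using B radon_sets[OF \<rho>] by (intro emeasure_mono) auto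
    then have "emeasure \<rho> B < \<infinity>" using radon_compact[OF \<rho> B(2)] by (auto intro: le_less_trans)
    then show ?thesis using radon_approx[OF \<rho> B(1), of "e/2"] B by (metis half_gt_zero)
  qed
  then obtain K1 K2 where K: "compact K1" "K1 \<subseteq> B" "emeasure \<mu> (B - K1) \<le> ennreal (e/2)"
     "compact K2" "K2 \<subseteq> B" "emeasure \<nu> (B - K2) \<le> ennreal (e/2)" using \<mu> \<nu> by meson
  define K where "K = K1 \<union> K2"
  have KB: "compact K" "K \<subseteq> B" using K by (auto simp: K_def)
  have "emeasure \<mu> (B - K) \<le> emeasure \<mu> (B - K1)" "emeasure \<nu> (B - K) \<le> emeasure \<nu> (B - K2)"
    using K B s by (auto intro!: emeasure_mono simp: K_def)
  then have "emeasure \<mu> (B - K) + emeasure \<nu> (B - K) \<le> ennreal (e/2) + ennreal (e/2)"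
    using K by (meson add_mono order_trans)
  also have "\<dots> = ennreal e" using B by (simp flip: ennreal_plus)
  finally have 1: "emeasure (measure_add \<mu> \<nu>) (B - K) \<le> ennreal e"
    using KB(1) B(1) by (simp add: em sets.Diff)
  have "emeasure (measure_add \<mu> \<nu>) B = emeasure (measure_add \<mu> \<nu>) K + emeasure (measure_add \<mu> \<nu>) (B - K)"
    using emeasure_Diff_compact[OF _ B(1) KB] s by simp
  then show "\<exists>K. compact K \<and> K \<subseteq> B \<and> emeasure (measure_add \<mu> \<nu>) B \<le> emeasure (measure_add \<mu> \<nu>) K + ennreal e"
    using 1 KB by (auto intro!: exI[of _ K] add_left_mono)
qed

lemma radon_null: "null_measure (borel :: 'a::t2_space measure) \<in> radon"
proof -
  have "(SUP K\<in>{K. compact K \<and> K \<subseteq> B \<and> K \<in> sets borel}. emeasure (null_measure borel) K) = 0" for B :: "'a set"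
    by (intro SUP_eq_const) auto
  then show ?thesis by (simp add: radon_def)
qed

lemma AE_scale_measure:
  assumes "AE x in \<mu>. P x"
  shows "AE x in scale_measure a \<mu>. P x"
proof -
  obtain N where N: "{x\<in>space \<mu>. \<not> P x} \<subseteq> N" "emeasure \<mu> N = 0" "N \<in> sets \<mu>"
    using assms by (rule AE_E)
  then show ?thesis
    by (intro AE_I[of _ _ N]) (simp_all add: space_scale_measure)
qed

lemma AE_measure_add:
  assumes s: "sets \<nu> = sets \<mu>" and \<mu>: "AE x in \<mu>. P x" and \<nu>: "AE x in \<nu>. P x"
  shows "AE x in measure_add \<mu> \<nu>. P x"
proof -
  obtain M where M: "{x\<in>space \<mu>. \<not> P x} \<subseteq> M" "emeasure \<mu> M = 0" "M \<in> sets \<mu>"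
    using \<mu> by (rule AE_E)
  obtain N where N: "{x\<in>space \<nu>. \<not> P x} \<subseteq> N" "emeasure \<nu> N = 0" "N \<in> sets \<nu>"
    using \<nu> by (rule AE_E)
  have "emeasure \<mu> (M \<inter> N) \<le> emeasure \<mu> M" "emeasure \<nu> (M \<inter> N) \<le> emeasure \<nu> N"
    using M(3) N(3) s by (auto intro!: emeasure_mono)
  then have "emeasure (measure_add \<mu> \<nu>) (M \<inter> N) = 0"
    using M N s by (subst emeasure_measure_add) auto
  moreover have "{x\<in>space (measure_add \<mu> \<nu>). \<not> P x} \<subseteq> M \<inter> N"
    using M(1) N(1) sets_eq_imp_space_eq[OF s] by (auto simp: measure_add_def space_measure_of_conv)
  ultimately show ?thesis
    using M(3) N(3) s by (intro AE_I[of _ _ "M \<inter> N"]) auto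
qed

section \<open>Jordan decomposition of the difference of two Radon measures\<close>

lemma ennreal_diff_plus_min: "a - b + min a b = (a::ennreal)"
proof (cases "b \<le> a")
  case False
  then have *: "a < b" by simp
  have "a - b = 0"
    by (rule diff_eq_0_ennreal[OF less_le_trans[OF * top_greatest] less_imp_le[OF *]])
  then show ?thesis using less_imp_le[OF *] by (simp add: min_def)
qed (simp add: min_def diff_add_cancel_ennreal)

text \<open>With densities \<open>f\<close>, \<open>g\<close> relative to \<mu> + \<nu>, the common
  part \<rho> has density \<open>min f g\<close>, and \<sigma>, \<tau> have the truncated
  differences as densities. All three are dominated by \<mu> or \<nu>, hence Radon. The energy
  principle applies to the singular pair (\<sigma>, \<tau>), while \<rho> cancels in the
  difference.\<close>

lemma Jordan_decomposition:
  fixes \<mu> \<nu> :: "'a::t2_space measure"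
  assumes sc: "sigma_compact TYPE('a)" and \<mu>: "\<mu> \<in> radon" and \<nu>: "\<nu> \<in> radon"
  obtains \<sigma> \<tau> \<rho> where "\<sigma> \<in> radon" "\<tau> \<in> radon" "\<rho> \<in> radon" "(\<sigma>, \<tau>) \<in> signed_radon"
    "\<mu> = measure_add \<sigma> \<rho>" "\<nu> = measure_add \<tau> \<rho>"
proof -
  define M where "M = measure_add \<mu> \<nu>"
  have M: "M \<in> radon" unfolding M_def by (rule radon_add[OF sc \<mu> \<nu>])
  have s: "sets M = sets borel" "sets \<mu> = sets borel" "sets \<nu> = sets borel"
    using radon_sets M \<mu> \<nu> by auto
  interpret M: sigma_finite_measure M using radon_sigma_finite[OF sc M] .
  have em: "emeasure M B = emeasure \<mu> B + emeasure \<nu> B" if "B \<in> sets borel" for B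
    unfolding M_def using that s by (intro emeasure_measure_add) auto
  have "absolutely_continuous M \<mu>" "absolutely_continuous M \<nu>"
    unfolding absolutely_continuous_def null_sets_def using em s by auto
  then obtain f g where fm: "f \<in> borel_measurable M" and gm: "g \<in> borel_measurable M"
    and f: "density M f = \<mu>" and g: "density M g = \<nu>"
    using M.Radon_Nikodym s by metis
  note [measurable] = fm gm
  \<comment> \<open>In \<open>ennreal\<close>, \<infinity> - \<infinity> = \<infinity>, so
    \<open>f x - g x\<close> vanishes for \<open>f x \<le> g x\<close> only where \<open>f x\<close>
    is finite.\<close>
  have ffin: "AE x in M. f x \<noteq> \<infinity>"
    using M.sigma_finite_iff_density_finite[OF fm] radon_sigma_finite[OF sc \<mu>] f by simp
  define \<sigma> \<tau> \<rho> where "\<sigma> = density M (\<lambda>x. f x - g x)" and "\<tau> = density M (\<lambda>x. g x - f x)"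
    and "\<rho> = density M (\<lambda>x. min (f x) (g x))"
  have emd: "emeasure (density M h) B = (\<integral>\<^sup>+x. h x * indicator B x \<partial>M)"
    if "h \<in> borel_measurable M" "B \<in> sets borel" for h B
    using that s by (intro emeasure_density) auto
  have emf: "emeasure \<mu> B = (\<integral>\<^sup>+x. f x * indicator B x \<partial>M)" "emeasure \<nu> B = (\<integral>\<^sup>+x. g x * indicator B x \<partial>M)"
    if "B \<in> sets borel" for B
    using emd[OF fm that] emd[OF gm that] f g by auto
  have r: "density M h \<in> radon" if h: "h \<in> borel_measurable M" "(\<forall>x. h x \<le> f x) \<or> (\<forall>x. h x \<le> g x)" for h
    using h(2)
  proof
    assume le: "\<forall>x. h x \<le> f x"
    show ?thesis
    proof (rule radon_dominated[OF sc \<mu>])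
      show "emeasure (density M h) B \<le> emeasure \<mu> B" if "B \<in> sets borel" for B
        unfolding emd[OF h(1) that] emf[OF that] by (intro nn_integral_mono mult_right_mono le[rule_format]) simp
    qed (simp add: s)
  next
    assume le: "\<forall>x. h x \<le> g x"
    show ?thesis
    proof (rule radon_dominated[OF sc \<nu>])
      show "emeasure (density M h) B \<le> emeasure \<nu> B" if "B \<in> sets borel" for B
        unfolding emd[OF h(1) that] emf[OF that] by (intro nn_integral_mono mult_right_mono le[rule_format]) simp
    qed (simp add: s)
  qed
  have rad: "\<sigma> \<in> radon" "\<tau> \<in> radon" "\<rho> \<in> radon"
    unfolding \<sigma>_def \<tau>_def \<rho>_def by (intro r; simp add: diff_le_self_ennreal)+
  define S where "S = {x\<in>space M. f x \<le> g x}"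
  have S: "S \<in> sets borel" unfolding S_def s(1)[symmetric] by measurable
  have "emeasure \<sigma> S = (\<integral>\<^sup>+x. 0 \<partial>M)"
    unfolding \<sigma>_def emd[OF borel_measurable_minus_ennreal[OF fm gm] S]
  proof (rule nn_integral_cong_AE)
    show "AE x in M. (f x - g x) * indicator S x = 0"
      using ffin by eventually_elim (auto simp: S_def diff_eq_0_iff_ennreal less_top split: split_indicator)
  qed
  moreover have "emeasure \<tau> (- S) = (\<integral>\<^sup>+x. 0 \<partial>M)"
  proof -
    have "- S \<in> sets borel" using S by (rule borel_comp)
    moreover have z: "(g x - f x) * indicator (- S) x = 0" for x
    proof (cases "f x \<le> g x")
      case False
      then have *: "g x < f x" by simp
      have "g x - f x = 0"
        by (rule diff_eq_0_ennreal[OF less_le_trans[OF * top_greatest] less_imp_le[OF *]])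
      then show ?thesis by simp
    qed (simp add: S_def radon_space[OF M])
    ultimately show ?thesis
      unfolding \<tau>_def by (subst emd) (simp_all only: z borel_measurable_minus_ennreal fm gm)
  qed
  ultimately have "(\<sigma>, \<tau>) \<in> signed_radon"
    using rad S by (auto simp: signed_radon_def)
  moreover have "\<mu> = measure_add \<sigma> \<rho>"
  proof (rule measure_eqI)
    fix B assume "B \<in> sets \<mu>"
    then have B: "B \<in> sets borel" using s by simp
    have "emeasure (measure_add \<sigma> \<rho>) B = emeasure \<sigma> B + emeasure \<rho> B"
      using B rad radon_sets by (intro emeasure_measure_add) auto
    also have "\<dots> = (\<integral>\<^sup>+x. (f x - g x) * indicator B x + min (f x) (g x) * indicator B x \<partial>M)"
      unfolding \<sigma>_def \<rho>_def using B s by (simp add: emd nn_integral_add)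
    also have "\<dots> = emeasure \<mu> B"
      unfolding emf[OF B] by (intro nn_integral_cong) (simp add: distrib_right[symmetric] ennreal_diff_plus_min)
    finally show "emeasure \<mu> B = emeasure (measure_add \<sigma> \<rho>) B" by simp
  qed (use rad radon_sets s in auto)
  moreover have "\<nu> = measure_add \<tau> \<rho>"
  proof (rule measure_eqI)
    fix B assume "B \<in> sets \<nu>"
    then have B: "B \<in> sets borel" using s by simp
    have "emeasure (measure_add \<tau> \<rho>) B = emeasure \<tau> B + emeasure \<rho> B"
      using B rad radon_sets by (intro emeasure_measure_add) auto
    also have "\<dots> = (\<integral>\<^sup>+x. (g x - f x) * indicator B x + min (f x) (g x) * indicator B x \<partial>M)"
      unfolding \<tau>_def \<rho>_def using B s by (simp add: emd nn_integral_add)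
    also have "\<dots> = emeasure \<nu> B"
      unfolding emf[OF B] min.commute[of "f _"]
      by (intro nn_integral_cong) (simp add: distrib_right[symmetric] ennreal_diff_plus_min)
    finally show "emeasure \<nu> B = emeasure (measure_add \<tau> \<rho>) B" by simp
  qed (use rad radon_sets s in auto)
  ultimately show thesis using rad by (intro that)
qed

text \<open>Countably many compact sets cover the space, so local negligibility is the same as
  negligibility.\<close>

lemma concentrated_on_iff_AE:
  fixes \<mu> :: "'a::t2_space measure"
  assumes sc: "sigma_compact TYPE('a)" and \<mu>: "\<mu> \<in> radon"
  shows "concentrated_on \<mu> A \<longleftrightarrow> (AE x in \<mu>. x \<in> A)"
proof
  assume conc: "concentrated_on \<mu> A"
  obtain K :: "nat \<Rightarrow> 'a set" where K: "\<And>n. compact (K n)" "incseq K" "(\<Union>n. K n) = UNIV"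
    using sigma_compact_incseq[OF sc] by blast
  have "\<forall>n. \<exists>N\<in>null_sets \<mu>. (- A) \<inter> K n \<subseteq> N"
    using conc K(1) by (simp add: concentrated_on_def)
  then obtain N where N: "\<And>n. N n \<in> null_sets \<mu>" "\<And>n. (- A) \<inter> K n \<subseteq> N n" by metis
  show "AE x in \<mu>. x \<in> A"
  proof (rule AE_I')
    show "(\<Union>n. N n) \<in> null_sets \<mu>" using N(1) by auto
    show "{x\<in>space \<mu>. x \<notin> A} \<subseteq> (\<Union>n. N n)"
    proof
      fix x assume x: "x \<in> {x\<in>space \<mu>. x \<notin> A}"
      obtain n where "x \<in> K n" using K(3) by blast
      then show "x \<in> (\<Union>n. N n)" using N(2)[of n] x by blast
    qed
  qed
next
  assume "AE x in \<mu>. x \<in> A"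
  then obtain N where N: "{x\<in>space \<mu>. x \<notin> A} \<subseteq> N" "N \<in> null_sets \<mu>"
    by (auto elim!: AE_E intro: null_setsI)
  then have "- A \<subseteq> N" using radon_space[OF \<mu>] by auto
  then show "concentrated_on \<mu> A" using N(2) unfolding concentrated_on_def by blast
qed

section \<open>Monotone convergence for directed families (\<tau>-smoothness)\<close>

lemma SUP_sum_directed_ennreal:
  fixes f :: "'b \<Rightarrow> 'i \<Rightarrow> ennreal"
  assumes "finite C" "I \<noteq> {}"
    and dir: "\<And>i j. i \<in> I \<Longrightarrow> j \<in> I \<Longrightarrow> \<exists>k\<in>I. \<forall>c\<in>C. f c i \<le> f c k \<and> f c j \<le> f c k"
  shows "(SUP i\<in>I. \<Sum>c\<in>C. f c i) = (\<Sum>c\<in>C. SUP i\<in>I. f c i)"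
  using assms
proof (induct C)
  case (insert x F)
  have "(SUP i\<in>I. f x i + (\<Sum>c\<in>F. f c i)) = (SUP i\<in>I. f x i) + (SUP i\<in>I. \<Sum>c\<in>F. f c i)"
  proof (rule SUP_add_directed_ennreal)
    fix i j assume "i \<in> I" "j \<in> I"
    then obtain k where "k \<in> I" "\<forall>c\<in>insert x F. f c i \<le> f c k \<and> f c j \<le> f c k"
      using insert(5) by blast
    then show "\<exists>k\<in>I. f x i + (\<Sum>c\<in>F. f c j) \<le> f x k + (\<Sum>c\<in>F. f c k)"
      by (intro bexI[of _ k] add_mono sum_mono) auto
  qed
  moreover have "(SUP i\<in>I. \<Sum>c\<in>F. f c i) = (\<Sum>c\<in>F. SUP i\<in>I. f c i)"
    using insert(5) by (intro insert(3)[OF insert(4)]) (meson insertCI)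
  ultimately show ?case using insert by simp
qed simp

lemma lsc_borel:
  fixes f :: "'a::topological_space \<Rightarrow> 'b::{linorder_topology, second_countable_topology}"
  assumes "\<And>c. open {x. c < f x}"
  shows "f \<in> borel_measurable borel"
  using assms by (intro borel_measurableI_greater) simp

text \<open>The family may be uncountable, so monotone convergence does not apply. Inner regularity
  replaces it: a compact set covered by the open sets \<open>{x. c < F g x}\<close> is covered by
  finitely many of them, hence by a single one because the family is directed. With this continuity
  of the measure, the usual argument with simple functions goes through.\<close>

proposition radon_nn_integral_SUP_directed:
  fixes \<nu> :: "'a::t2_space measure" and F :: "'i \<Rightarrow> 'a \<Rightarrow> ennreal"
  assumes \<nu>: "\<nu> \<in> radon" and ne: "G \<noteq> {}"
    and lsc: "\<And>g c. g \<in> G \<Longrightarrow> open {x. c < F g x}"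
    and dir: "\<And>g h. g \<in> G \<Longrightarrow> h \<in> G \<Longrightarrow> \<exists>k\<in>G. \<forall>x. F g x \<le> F k x \<and> F h x \<le> F k x"
  shows "(\<integral>\<^sup>+x. (SUP g\<in>G. F g x) \<partial>\<nu>) = (SUP g\<in>G. \<integral>\<^sup>+x. F g x \<partial>\<nu>)"
proof (rule antisym)
  have [simp]: "space \<nu> = UNIV" using radon_space[OF \<nu>] .
  have sets: "sets \<nu> = sets borel" using radon_sets[OF \<nu>] .
  have op: "{x. c < F g x} \<in> sets \<nu>" if "g \<in> G" for g c
    using lsc[OF that] by (simp add: sets)
  have finsub: "\<exists>g\<in>G. C \<subseteq> {x. c < F g x}"
    if C: "compact C" "C \<subseteq> (\<Union>g\<in>G. {x. c < F g x})" for C c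
  proof -
    obtain H where H: "H \<subseteq> G" "finite H" "C \<subseteq> (\<Union>g\<in>H. {x. c < F g x})"
      using compactE_image[OF C(1), of G "\<lambda>g. {x. c < F g x}"] C(2) lsc by metis
    have "\<exists>k\<in>G. \<forall>g\<in>H. \<forall>x. F g x \<le> F k x"
      using H(2,1)
    proof induct
      case empty then show ?case using ne by blast
    next
      case (insert h H)
      then obtain k where "k \<in> G" "\<forall>g\<in>H. \<forall>x. F g x \<le> F k x" by auto
      moreover obtain l where "l \<in> G" "\<forall>x. F k x \<le> F l x \<and> F h x \<le> F l x"
        using dir[of k h] insert(4) calculation by auto
      ultimately show ?case by (metis insertE order_trans)
    qed
    then obtain k where k: "k \<in> G" "\<And>g x. g \<in> H \<Longrightarrow> F g x \<le> F k x" by blast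
    have "c < F k x" if "x \<in> C" for x
      using H(3) k(2) that by (blast intro: less_le_trans)
    then show ?thesis using k(1) by blast
  qed
  have inner: "emeasure \<nu> B = (SUP g\<in>G. emeasure \<nu> (B \<inter> {x. c < F g x}))"
    if B: "B \<in> sets \<nu>" "B \<subseteq> (\<Union>g\<in>G. {x. c < F g x})" for B c
  proof (rule antisym)
    show "emeasure \<nu> B \<le> (SUP g\<in>G. emeasure \<nu> (B \<inter> {x. c < F g x}))"
      using B(1) unfolding sets
    proof (subst radon_inner[OF \<nu>], simp, intro SUP_least)
      fix C assume C: "C \<in> {C. compact C \<and> C \<subseteq> B}"
      then obtain g where g: "g \<in> G" "C \<subseteq> {x. c < F g x}"
        using finsub[of C c] B(2) by blast
      then have "emeasure \<nu> C \<le> emeasure \<nu> (B \<inter> {x. c < F g x})"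
        using C B op by (intro emeasure_mono) auto
      then show "emeasure \<nu> C \<le> (SUP g\<in>G. emeasure \<nu> (B \<inter> {x. c < F g x}))"
        using g(1) by (meson SUP_upper2)
    qed
    show "(SUP g\<in>G. emeasure \<nu> (B \<inter> {x. c < F g x})) \<le> emeasure \<nu> B"
      using B by (intro SUP_least emeasure_mono) auto
  qed
  show "(\<integral>\<^sup>+x. (SUP g\<in>G. F g x) \<partial>\<nu>) \<le> (SUP g\<in>G. \<integral>\<^sup>+x. F g x \<partial>\<nu>)"
    unfolding nn_integral_def_finite[of _ "\<lambda>x. SUP g\<in>G. F g x"]
  proof (safe intro!: SUP_least)
    fix u assume sf[simp]: "simple_function \<nu> u" and
      u: "u \<le> (\<lambda>x. SUP g\<in>G. F g x)" and u_range: "\<forall>x. u x < top"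
    note sf[THEN borel_measurable_simple_function, measurable]
    show "integral\<^sup>S \<nu> u \<le> (SUP g\<in>G. \<integral>\<^sup>+x. F g x \<partial>\<nu>)"
    \<comment> \<open>Shrinking \<open>u\<close> by a factor \<open>a < 1\<close> makes it strictly
      smaller than the supremum wherever \<open>a * u x\<close> is nonzero, so each such level set
      is covered by sets \<open>{x. c < F g x}\<close>.\<close>
    proof (rule ennreal_approx_unit)
      fix a :: ennreal assume "a < 1"
      let ?au = "\<lambda>x. a * u x"
      let ?B = "\<lambda>c g. {x\<in>space \<nu>. ?au x = c \<and> c < F g x}"
      have Bm: "?B c g \<in> sets \<nu>" if "g \<in> G" for c g
      proof -
        have "?B c g = {x\<in>space \<nu>. ?au x = c} \<inter> {x. c < F g x}" by auto
        also have "\<dots> \<in> sets \<nu>" using op[OF that] by measurable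
        finally show ?thesis .
      qed
      have "integral\<^sup>S \<nu> ?au = (\<Sum>c\<in>?au`space \<nu>. c * (SUP g\<in>G. emeasure \<nu> (?B c g)))"
        unfolding simple_integral_def
      proof (intro sum.cong ennreal_mult_left_cong refl)
        fix c assume "c \<in> ?au ` space \<nu>" "c \<noteq> 0"
        { fix x' assume x': "x' \<in> space \<nu>" "?au x' = c"
          with \<open>c \<noteq> 0\<close> u_range have "?au x' < 1 * u x'"
            by (intro ennreal_mult_strict_right_mono \<open>a < 1\<close>) (auto simp: less_le)
          also have "\<dots> \<le> (SUP g\<in>G. F g x')"
            using u by (auto simp: le_fun_def)
          finally have "\<exists>g\<in>G. ?au x' < F g x'"
            by (auto simp: less_SUP_iff) }
        then have "?au -` {c} \<inter> space \<nu> \<subseteq> (\<Union>g\<in>G. {x. c < F g x})"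
          by auto
        moreover have "?au -` {c} \<inter> space \<nu> \<in> sets \<nu>" by (rule measurable_sets[of _ _ borel]) measurable
        ultimately have "emeasure \<nu> (?au -` {c} \<inter> space \<nu>) =
            (SUP g\<in>G. emeasure \<nu> ((?au -` {c} \<inter> space \<nu>) \<inter> {x. c < F g x}))"
          by (rule inner[rotated])
        moreover have "(?au -` {c} \<inter> space \<nu>) \<inter> {x. c < F g x} = ?B c g" for g by auto
        ultimately show "emeasure \<nu> (?au -` {c} \<inter> space \<nu>) = (SUP g\<in>G. emeasure \<nu> (?B c g))"
          by simp
      qed
      also have "\<dots> = (SUP g\<in>G. \<Sum>c\<in>?au`space \<nu>. c * emeasure \<nu> (?B c g))"
        unfolding SUP_mult_left_ennreal
      proof (intro SUP_sum_directed_ennreal[symmetric] ne)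
        show "finite (?au ` space \<nu>)"
          using simple_functionD(1)[of \<nu> ?au] by simp
        fix g h assume gh: "g \<in> G" "h \<in> G"
        then obtain k where k: "k \<in> G" "\<forall>x. F g x \<le> F k x \<and> F h x \<le> F k x" using dir by blast
        show "\<exists>k\<in>G. \<forall>c\<in>?au ` space \<nu>. c * emeasure \<nu> (?B c g) \<le> c * emeasure \<nu> (?B c k)
             \<and> c * emeasure \<nu> (?B c h) \<le> c * emeasure \<nu> (?B c k)"
          using k gh Bm
          by (intro bexI[of _ k] ballI conjI mult_left_mono emeasure_mono) (auto intro: less_le_trans)
      qed
      also have "\<dots> \<le> (SUP g\<in>G. integral\<^sup>N \<nu> (F g))"
      proof (rule SUP_mono)
        fix g assume g: "g \<in> G"
        have [measurable]: "F g \<in> borel_measurable \<nu>"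
          using lsc_borel[OF lsc[OF g]] sets by (simp cong: measurable_cong_sets)
        have [measurable]: "{x. a * u x < F g x} \<in> sets \<nu>"
        proof -
          have "{x\<in>space \<nu>. a * u x < F g x} \<in> sets \<nu>" by measurable
          then show ?thesis by simp
        qed
        have "(\<Sum>c\<in>?au`space \<nu>. c * emeasure \<nu> (?B c g)) =
          (\<integral>\<^sup>Sx. (a * u x) * indicator {x\<in>space \<nu>. a * u x < F g x} x \<partial>\<nu>)"
          by (subst simple_integral_indicator)
             (auto intro!: sum.cong ennreal_mult_left_cong arg_cong2[where f=emeasure])
        also have "\<dots> = (\<integral>\<^sup>+x. (a * u x) * indicator {x\<in>space \<nu>. a * u x < F g x} x \<partial>\<nu>)"
          by (rule nn_integral_eq_simple_integral[symmetric]) simp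
        also have "\<dots> \<le> (\<integral>\<^sup>+x. F g x \<partial>\<nu>)"
          by (intro nn_integral_mono) (auto split: split_indicator)
        finally show "\<exists>k\<in>G. (\<Sum>c\<in>?au`space \<nu>. c * emeasure \<nu> (?B c g)) \<le> (\<integral>\<^sup>+x. F k x \<partial>\<nu>)"
          using g by blast
      qed
      finally show "a * integral\<^sup>S \<nu> u \<le> (SUP g\<in>G. integral\<^sup>N \<nu> (F g))"
        by simp
    qed
  qed
qed (auto intro!: SUP_least nn_integral_mono SUP_upper)


section \<open>Lower semicontinuous kernels and Fubini's theorem\<close>

text \<open>An open set of the product may fail to be in the product \<sigma>-algebra, but a finite
  union of open rectangles is in it, and compactness of \<open>L\<close> yields such a
  union.\<close>

lemma compact_open_measurable_between:
  fixes L :: "('a::topological_space \<times> 'b::topological_space) set"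
  assumes L: "compact L" and W: "open W" "L \<subseteq> W"
  obtains F where "F \<in> sets (borel \<Otimes>\<^sub>M borel)" "L \<subseteq> F" "F \<subseteq> W"
proof -
  define \<C> where "\<C> = {S \<times> T |S T. open S \<and> open T \<and> S \<times> T \<subseteq> W}"
  have 1: "\<forall>C\<in>\<C>. open C" by (auto simp: \<C>_def intro: open_Times)
  have 2: "L \<subseteq> \<Union>\<C>"
  proof
    fix z assume "z \<in> L"
    then have "z \<in> W" using W by blast
    then obtain S T where "open S" "open T" "z \<in> S \<times> T" "S \<times> T \<subseteq> W"
      by (rule open_prod_elim[OF W(1)])
    then show "z \<in> \<Union>\<C>" unfolding \<C>_def by blast
  qed
  obtain \<D> where \<D>: "\<D> \<subseteq> \<C>" "finite \<D>" "L \<subseteq> \<Union>\<D>"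
    using compactE[OF L 2] 1 by blast
  have "\<Union>\<D> \<in> sets (borel \<Otimes>\<^sub>M borel)"
  proof (rule sets.finite_Union)
    show "\<D> \<subseteq> sets (borel \<Otimes>\<^sub>M borel)"
    proof
      fix C assume "C \<in> \<D>"
      then obtain S T where "C = S \<times> T" "open S" "open T" using \<D>(1) unfolding \<C>_def by blast
      then show "C \<in> sets (borel \<Otimes>\<^sub>M borel)" by (simp add: pair_measureI)
    qed
  qed (rule \<D>)
  moreover have "\<Union>\<D> \<subseteq> W" using \<D>(1) unfolding \<C>_def by blast
  ultimately show thesis by (intro that[of "\<Union>\<D>"] \<D>(3))
qed

lemma CcE:
  assumes "\<phi> \<in> Cc"
  obtains L where "continuous_on UNIV \<phi>" "compact L" "{x. \<phi> x \<noteq> 0} \<subseteq> L"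
  using assms that[OF _ _ closure_subset] by (simp add: Cc_def)

lemma Cc_bounded:
  fixes \<phi> :: "'a::t2_space \<Rightarrow> real"
  assumes "\<phi> \<in> Cc"
  obtains M where "\<And>x. \<bar>\<phi> x\<bar> \<le> M"
proof -
  obtain L where L: "continuous_on UNIV \<phi>" "compact L" "{x. \<phi> x \<noteq> 0} \<subseteq> L" using CcE[OF assms] .
  have "bounded (\<phi> ` L)"
    by (intro compact_imp_bounded compact_continuous_image L(2) continuous_on_subset[OF L(1)]) simp
  then obtain M where M: "\<And>x. x \<in> L \<Longrightarrow> \<bar>\<phi> x\<bar> \<le> M" by (auto simp: bounded_iff)
  have "\<bar>\<phi> x\<bar> \<le> max M 0" for x using M[of x] L(3) by (cases "\<phi> x = 0") auto
  then show thesis by (rule that)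
qed

lemma Cc_max:
  fixes \<phi> \<psi> :: "'a::t2_space \<Rightarrow> real"
  assumes "\<phi> \<in> Cc" "\<psi> \<in> Cc"
  shows "(\<lambda>x. max (\<phi> x) (\<psi> x)) \<in> Cc"
proof -
  obtain L M where "continuous_on UNIV \<phi>" "compact L" "{x. \<phi> x \<noteq> 0} \<subseteq> L"
    "continuous_on UNIV \<psi>" "compact M" "{x. \<psi> x \<noteq> 0} \<subseteq> M"
    by (rule CcE[OF assms(1)], rule CcE[OF assms(2)]) (rule that)
  then show ?thesis
    by (intro CcI[of _ "L \<union> M"] continuous_on_max compact_Un) (auto simp: max_def split: if_splits)
qed

lemma Cc_add:
  fixes \<phi> \<psi> :: "'a::t2_space \<Rightarrow> real"
  assumes "\<phi> \<in> Cc" "\<psi> \<in> Cc"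
  shows "(\<lambda>x. \<phi> x + \<psi> x) \<in> Cc"
proof -
  obtain L M where "continuous_on UNIV \<phi>" "compact L" "{x. \<phi> x \<noteq> 0} \<subseteq> L"
    "continuous_on UNIV \<psi>" "compact M" "{x. \<psi> x \<noteq> 0} \<subseteq> M"
    by (rule CcE[OF assms(1)], rule CcE[OF assms(2)]) (rule that)
  then show ?thesis
    by (intro CcI[of _ "L \<union> M"] continuous_on_add compact_Un) fastforce+
qed

lemma Cc_swap:
  fixes \<phi> :: "'a::t2_space \<times> 'a \<Rightarrow> real"
  assumes "\<phi> \<in> Cc"
  shows "(\<lambda>(x, y). \<phi> (y, x)) \<in> Cc"
proof -
  obtain L where L: "continuous_on UNIV \<phi>" "compact L" "{x. \<phi> x \<noteq> 0} \<subseteq> L" using CcE[OF assms] .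
  have c: "continuous_on UNIV (prod.swap :: 'a \<times> 'a \<Rightarrow> _)"
    unfolding prod.swap_def by (intro continuous_intros)
  have eq: "(\<lambda>(x, y). \<phi> (y, x)) = \<phi> \<circ> prod.swap" by auto
  have "continuous_on UNIV (\<phi> \<circ> prod.swap)"
    by (rule continuous_on_compose[OF c continuous_on_subset[OF L(1)]]) simp
  moreover have "compact (prod.swap ` L)"
    by (intro compact_continuous_image L(2) continuous_on_subset[OF c]) simp
  moreover have "{x. (\<phi> \<circ> prod.swap) x \<noteq> 0} \<subseteq> prod.swap ` L"
    using L(3) by (force simp: image_iff)
  ultimately show ?thesis unfolding eq by (rule CcI)
qed

text \<open>For \<open>c > 0\<close> the level set \<open>{z. c \<le> \<psi> z}\<close> is compact.
  It is the intersection of product-measurable sets squeezed between it and the open sets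
  \<open>{z. c - inverse (real (Suc n)) < \<psi> z}\<close>. Levels \<open>a \<le> 0\<close> of
  \<phi> are reduced to positive levels of -\<phi> by taking complements.\<close>

lemma Cc_borel_measurable_pair:
  fixes \<phi> :: "'a::t2_space \<times> 'a \<Rightarrow> real"
  assumes "\<phi> \<in> Cc"
  shows "\<phi> \<in> borel_measurable (borel \<Otimes>\<^sub>M borel)"
proof -
  have pos: "{z. c \<le> \<psi> z} \<in> sets (borel \<Otimes>\<^sub>M borel)" if \<psi>: "\<psi> \<in> Cc" and c: "c > 0"
    for c and \<psi> :: "'a \<times> 'a \<Rightarrow> real"
  proof -
    obtain L where L: "continuous_on UNIV \<psi>" "compact L" "{x. \<psi> x \<noteq> 0} \<subseteq> L" using CcE[OF \<psi>] .
    have "closed {z. c \<le> \<psi> z}" using L(1) by (intro closed_Collect_le continuous_on_const)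
    then have "compact (L \<inter> {z. c \<le> \<psi> z})" using L(2) by (rule compact_Int_closed[rotated])
    moreover have "L \<inter> {z. c \<le> \<psi> z} = {z. c \<le> \<psi> z}" using L(3) c by auto
    ultimately have cp: "compact {z. c \<le> \<psi> z}" by simp
    have "\<exists>F. F \<in> sets (borel \<Otimes>\<^sub>M borel) \<and> {z. c \<le> \<psi> z} \<subseteq> F \<and> F \<subseteq> {z. c - inverse (real (Suc n)) < \<psi> z}" for n
    proof -
      have "open {z. c - inverse (real (Suc n)) < \<psi> z}"
        using L(1) by (intro open_Collect_less continuous_on_const)
      moreover have "{z. c \<le> \<psi> z} \<subseteq> {z. c - inverse (real (Suc n)) < \<psi> z}"
        using less_le_trans[of "c - inverse (real (Suc n))" c] by auto
      ultimately show ?thesis by (rule compact_open_measurable_between[OF cp]) blast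
    qed
    then obtain F where F: "\<And>n. F n \<in> sets (borel \<Otimes>\<^sub>M borel)" "\<And>n. {z. c \<le> \<psi> z} \<subseteq> F n"
       "\<And>n. F n \<subseteq> {z. c - inverse (real (Suc n)) < \<psi> z}" by metis
    have "(\<Inter>n. F n) \<subseteq> {z. c \<le> \<psi> z}"
    proof
      fix z assume "z \<in> (\<Inter>n. F n)"
      then have "c - \<psi> z < inverse (real (Suc n))" for n using F(3)[of n] by force
      then have "c - \<psi> z \<le> 0"
        by (meson reals_Archimedean not_le less_asym)
      then show "z \<in> {z. c \<le> \<psi> z}" by simp
    qed
    then have "{z. c \<le> \<psi> z} = (\<Inter>n. F n)" using F(2) by blast
    then show ?thesis using F(1) by auto
  qed
  have neg: "(\<lambda>z. - \<phi> z) \<in> Cc"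
  proof -
    obtain L where "continuous_on UNIV \<phi>" "compact L" "{x. \<phi> x \<noteq> 0} \<subseteq> L" using CcE[OF assms] .
    then show ?thesis by (intro CcI[of _ L] continuous_on_minus) auto
  qed
  have "{z. a \<le> \<phi> z} \<in> sets (borel \<Otimes>\<^sub>M borel)" for a
  proof (cases "a > 0")
    case False
    have *: "(\<Union>n. {z. - a + inverse (real (Suc n)) \<le> - \<phi> z}) = - {z. a \<le> \<phi> z}"
    proof (intro equalityI subsetI)
      fix z assume "z \<in> - {z. a \<le> \<phi> z}"
      then have "a - \<phi> z > 0" by simp
      then obtain n where "inverse (real (Suc n)) < a - \<phi> z" using reals_Archimedean by blast
      then show "z \<in> (\<Union>n. {z. - a + inverse (real (Suc n)) \<le> - \<phi> z})" by (auto intro!: exI[of _ n])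
    next
      fix z assume "z \<in> (\<Union>n. {z. - a + inverse (real (Suc n)) \<le> - \<phi> z})"
      then obtain n where "- a + inverse (real (Suc n)) \<le> - \<phi> z" by auto
      moreover have "inverse (real (Suc n)) > 0" by simp
      ultimately show "z \<in> - {z. a \<le> \<phi> z}" unfolding Compl_iff mem_Collect_eq by linarith
    qed
    have "(\<Union>n. {z. - a + inverse (real (Suc n)) \<le> - \<phi> z}) \<in> sets (borel \<Otimes>\<^sub>M borel)"
      by (intro sets.countable_UN image_subsetI pos[OF neg]) (rule add_nonneg_pos, use False in simp_all)
    then have "space (borel \<Otimes>\<^sub>M borel) - (- {z. a \<le> \<phi> z}) \<in> sets (borel \<Otimes>\<^sub>M (borel :: 'a measure))"
      unfolding * by (rule sets.compl_sets)
    then show ?thesis by (simp add: space_pair_measure)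
  qed (rule pos[OF assms])
  then show ?thesis by (simp add: borel_measurable_iff_ge space_pair_measure)
qed

section \<open>Integrals of functions of compact support\<close>

lemma Cc_integrable:
  fixes \<phi> :: "'a::t2_space \<Rightarrow> real"
  assumes \<phi>: "\<phi> \<in> Cc" and \<mu>: "\<mu> \<in> radon"
  shows "integrable \<mu> \<phi>"
proof -
  obtain L where L: "continuous_on UNIV \<phi>" "compact L" "{x. \<phi> x \<noteq> 0} \<subseteq> L" using CcE[OF \<phi>] .
  obtain M where M: "\<And>x. \<bar>\<phi> x\<bar> \<le> M" using Cc_bounded[OF \<phi>] by blast
  have "\<phi> \<in> borel_measurable \<mu>"
    using borel_measurable_continuous_onI[OF L(1)] radon_sets[OF \<mu>] by (simp cong: measurable_cong_sets)
  then show ?thesis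
    using L M radon_sets[OF \<mu>] radon_compact[OF \<mu> L(2)]
    by (intro integrableI_bounded_set[where A = L and B = M]) auto
qed

lemma Cc_integrable_pair:
  fixes \<phi> :: "'a::t2_space \<times> 'a \<Rightarrow> real"
  assumes sc: "sigma_compact TYPE('a)" and \<phi>: "\<phi> \<in> Cc" and \<mu>: "\<mu> \<in> radon" and \<nu>: "\<nu> \<in> radon"
  shows "integrable (\<mu> \<Otimes>\<^sub>M \<nu>) \<phi>"
proof -
  interpret N: sigma_finite_measure \<nu> using radon_sigma_finite[OF sc \<nu>] .
  obtain L where L: "continuous_on UNIV \<phi>" "compact L" "{x. \<phi> x \<noteq> 0} \<subseteq> L" using CcE[OF \<phi>] .
  obtain M where M: "\<And>x. \<bar>\<phi> x\<bar> \<le> M" using Cc_bounded[OF \<phi>] by blast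
  have K: "compact (fst ` L)" "compact (snd ` L)"
    using L(2) by (auto intro!: compact_continuous_image continuous_intros)
  have s: "sets (\<mu> \<Otimes>\<^sub>M \<nu>) = sets (borel \<Otimes>\<^sub>M borel)"
    using \<mu> \<nu> by (intro sets_pair_measure_cong radon_sets)
  have b: "fst ` L \<in> sets \<mu>" "snd ` L \<in> sets \<nu>" using K radon_sets[OF \<mu>] radon_sets[OF \<nu>] by auto
  have "emeasure (\<mu> \<Otimes>\<^sub>M \<nu>) (fst ` L \<times> snd ` L) < \<infinity>"
    using N.emeasure_pair_measure_Times[OF b] radon_compact[OF \<mu> K(1)] radon_compact[OF \<nu> K(2)]
    by (simp add: ennreal_mult_less_top)
  moreover have "\<phi> \<in> borel_measurable (\<mu> \<Otimes>\<^sub>M \<nu>)"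
    using Cc_borel_measurable_pair[OF \<phi>] s by (simp cong: measurable_cong_sets)
  moreover have "\<phi> z = 0" if "z \<notin> fst ` L \<times> snd ` L" for z
    using that L(3) by (cases z) force
  ultimately show ?thesis
    using M b by (intro integrableI_bounded_set[where A = "fst ` L \<times> snd ` L" and B = M]) auto
qed

lemma Cc_Fubini:
  fixes \<phi> :: "'a::t2_space \<times> 'a \<Rightarrow> real"
  assumes sc: "sigma_compact TYPE('a)" and \<phi>: "\<phi> \<in> Cc" "\<And>z. 0 \<le> \<phi> z"
    and \<mu>: "\<mu> \<in> radon" and \<nu>: "\<nu> \<in> radon"
  shows "ennreal (integral\<^sup>L (\<mu> \<Otimes>\<^sub>M \<nu>) \<phi>) = (\<integral>\<^sup>+x. (\<integral>\<^sup>+y. ennreal (\<phi> (x, y)) \<partial>\<nu>) \<partial>\<mu>)"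
    and "ennreal (integral\<^sup>L (\<mu> \<Otimes>\<^sub>M \<nu>) \<phi>) = (\<integral>\<^sup>+y. (\<integral>\<^sup>+x. ennreal (\<phi> (x, y)) \<partial>\<mu>) \<partial>\<nu>)"
proof -
  interpret N: sigma_finite_measure \<nu> using radon_sigma_finite[OF sc \<nu>] .
  interpret M: sigma_finite_measure \<mu> using radon_sigma_finite[OF sc \<mu>] .
  interpret P: pair_sigma_finite \<mu> \<nu> ..
  have i: "integrable (\<mu> \<Otimes>\<^sub>M \<nu>) \<phi>" using Cc_integrable_pair[OF sc \<phi>(1) \<mu> \<nu>] .
  then have m: "(\<lambda>z. ennreal (\<phi> z)) \<in> borel_measurable (\<mu> \<Otimes>\<^sub>M \<nu>)" by measurable
  have "ennreal (integral\<^sup>L (\<mu> \<Otimes>\<^sub>M \<nu>) \<phi>) = (\<integral>\<^sup>+z. ennreal (\<phi> z) \<partial>(\<mu> \<Otimes>\<^sub>M \<nu>))"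
    using nn_integral_eq_integral[OF i] \<phi>(2) by simp
  then show "ennreal (integral\<^sup>L (\<mu> \<Otimes>\<^sub>M \<nu>) \<phi>) = (\<integral>\<^sup>+x. (\<integral>\<^sup>+y. ennreal (\<phi> (x, y)) \<partial>\<nu>) \<partial>\<mu>)"
    and "ennreal (integral\<^sup>L (\<mu> \<Otimes>\<^sub>M \<nu>) \<phi>) = (\<integral>\<^sup>+y. (\<integral>\<^sup>+x. ennreal (\<phi> (x, y)) \<partial>\<mu>) \<partial>\<nu>)"
    using N.nn_integral_fst[OF m] P.nn_integral_snd[OF m]
    by simp_all
qed

lemma ennreal_continuous_lsc:
  fixes \<phi> :: "'a::topological_space \<Rightarrow> real"
  assumes "continuous_on UNIV \<phi>"
  shows "open {x. c < ennreal (\<phi> x)}"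
  using assms by (intro open_Collect_less continuous_on_const continuous_on_ennreal)

text \<open>Only \<open>y\<close> in the compact projection \<open>K\<close> of the support matters,
  and on \<open>K\<close> the sections at \<open>x\<close> and \<open>x0\<close> are uniformly close
  when \<open>x\<close> is near \<open>x0\<close>.\<close>

lemma Cc_partial_integral_lsc:
  fixes \<phi> :: "'a::t2_space \<times> 'a \<Rightarrow> real"
  assumes \<phi>: "\<phi> \<in> Cc" "\<And>z. 0 \<le> \<phi> z" and \<nu>: "\<nu> \<in> radon"
  shows "open {x. c < (\<integral>\<^sup>+y. ennreal (\<phi> (x, y)) \<partial>\<nu>)}"
proof (subst open_subopen, safe)
  obtain L where L: "continuous_on UNIV \<phi>" "compact L" "{x. \<phi> x \<noteq> 0} \<subseteq> L" using CcE[OF \<phi>(1)] .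
  define K where "K = snd ` L"
  have K: "compact K" "K \<in> sets \<nu>"
    using L(2) radon_sets[OF \<nu>] by (auto simp: K_def intro!: compact_continuous_image continuous_intros compact_borel)
  have meas: "(\<lambda>y. ennreal (\<phi> (x, y))) \<in> borel_measurable \<nu>" for x
  proof -
    have "continuous_on UNIV (\<lambda>y. \<phi> (x, y))"
      by (intro continuous_on_compose2[OF L(1)] continuous_intros) auto
    then show ?thesis
      using borel_measurable_continuous_onI radon_sets[OF \<nu>]
      by (intro measurable_compose[OF _ measurable_ennreal]) (simp cong: measurable_cong_sets)
  qed
  fix x0 assume x0: "c < (\<integral>\<^sup>+y. ennreal (\<phi> (x0, y)) \<partial>\<nu>)"
  then obtain d where d: "c < d" "d < (\<integral>\<^sup>+y. ennreal (\<phi> (x0, y)) \<partial>\<nu>)" using dense by blast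
  \<comment> \<open>The integral at \<open>x0\<close> exceeds \<open>d\<close>, so a loss of at most
    \<delta> still keeps it above \<open>c\<close>. The case \<open>d = \<infinity>\<close> leaves
    any finite room.\<close>
  obtain \<delta> where \<delta>: "\<delta> > 0" "c + ennreal \<delta> \<le> d"
  proof (cases d)
    case (real r)
    then obtain s where s: "c = ennreal s" "0 \<le> s" "s < r" using d(1) by (cases c) (auto simp: ennreal_less_iff)
    show thesis using s real by (intro that[of "r - s"]) (auto simp flip: ennreal_plus)
  next
    case top
    then show thesis using that[of 1] by simp
  qed
  \<comment> \<open>A uniform error \<open>e\<close> on \<open>K\<close> costs at most
    \<open>e * measure \<nu> K \<le> \<delta>\<close> in the integral; the summand 1 covers
    \<open>measure \<nu> K = 0\<close>.\<close>
  define e where "e = \<delta> / (measure \<nu> K + 1)"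
  have "measure \<nu> K + 1 > 0" using measure_nonneg[of \<nu> K] by linarith
  then have e: "e > 0" "e * measure \<nu> K \<le> \<delta>"
    using \<delta>(1) by (auto simp add: e_def pos_divide_le_eq algebra_simps)
  obtain W where W: "x0 \<in> W" "open W" "\<forall>x\<in>W \<inter> UNIV. \<forall>y\<in>K. dist (\<phi> (x, y)) (\<phi> (x0, y)) \<le> e"
    by (rule continuous_on_prod_compactE[OF continuous_on_subset[OF L(1) subset_UNIV] K(1) UNIV_I e(1)])
  have "c < (\<integral>\<^sup>+y. ennreal (\<phi> (x, y)) \<partial>\<nu>)" if x: "x \<in> W" for x
  proof (rule ccontr)
    assume n: "\<not> c < (\<integral>\<^sup>+y. ennreal (\<phi> (x, y)) \<partial>\<nu>)"
    have le: "ennreal (\<phi> (x0, y)) \<le> ennreal (\<phi> (x, y)) + ennreal e * indicator K y" for y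
    proof (cases "y \<in> K")
      case True
      then have "\<phi> (x0, y) \<le> \<phi> (x, y) + e" using W(3) x by (force simp: dist_real_def)
      then show ?thesis using True \<phi>(2) e by (simp flip: ennreal_plus)
    next
      case False
      then have "\<phi> (x0, y) = 0" using L(3) unfolding K_def by force
      then show ?thesis by simp
    qed
    have "(\<integral>\<^sup>+y. ennreal (\<phi> (x0, y)) \<partial>\<nu>) \<le> (\<integral>\<^sup>+y. ennreal (\<phi> (x, y)) + ennreal e * indicator K y \<partial>\<nu>)"
      by (intro nn_integral_mono le)
    also have "\<dots> = (\<integral>\<^sup>+y. ennreal (\<phi> (x, y)) \<partial>\<nu>) + ennreal e * emeasure \<nu> K"
      using meas K by (simp add: nn_integral_add nn_integral_cmult)
    also have "ennreal e * emeasure \<nu> K = ennreal (e * measure \<nu> K)"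
      using radon_compact[OF \<nu> K(1)] e by (simp add: emeasure_eq_ennreal_measure ennreal_mult less_top)
    also have "(\<integral>\<^sup>+y. ennreal (\<phi> (x, y)) \<partial>\<nu>) + ennreal (e * measure \<nu> K) \<le> c + ennreal \<delta>"
      using n e by (intro add_mono ennreal_leI) auto
    finally show False using \<delta>(2) d(2) by simp
  qed
  then show "\<exists>T. open T \<and> x0 \<in> T \<and> T \<subseteq> {x. c < (\<integral>\<^sup>+y. ennreal (\<phi> (x, y)) \<partial>\<nu>)}"
    using W by blast
qed

text \<open>Unlike the minorants in \<open>mutual_energy\<close>, these are nonnegative, so that
  their integrals can be taken in \<open>ennreal\<close>.\<close>

definition Cc_minorants :: "('a::topological_space \<Rightarrow> ennreal) \<Rightarrow> ('a \<Rightarrow> real) set" where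
  "Cc_minorants k = {\<phi>\<in>Cc. \<forall>z. 0 \<le> \<phi> z \<and> ennreal (\<phi> z) \<le> k z}"

lemma Cc_minorants_ne: "Cc_minorants (k :: 'a::t2_space \<Rightarrow> ennreal) \<noteq> {}"
proof -
  have "(\<lambda>x::'a. 0::real) \<in> Cc" by (rule CcI[of _ "{}"]) auto
  then have "(\<lambda>x. 0) \<in> Cc_minorants k" by (simp add: Cc_minorants_def)
  then show ?thesis by blast
qed

lemma Cc_minorants_directed:
  fixes k :: "'a::t2_space \<Rightarrow> ennreal"
  assumes "\<phi> \<in> Cc_minorants k" "\<psi> \<in> Cc_minorants k"
  shows "\<exists>\<xi>\<in>Cc_minorants k. \<forall>z. \<phi> z \<le> \<xi> z \<and> \<psi> z \<le> \<xi> z"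
  using assms Cc_max[of \<phi> \<psi>]
  by (intro bexI[of _ "\<lambda>x. max (\<phi> x) (\<psi> x)"]) (auto simp: Cc_minorants_def max_def)

text \<open>For a finite \<open>c < k z\<close>, multiply by \<open>c\<close> a bump function that
  equals 1 at \<open>z\<close> and vanishes off the open set where \<open>k\<close> exceeds
  \<open>c\<close>. This is a minorant with value \<open>c\<close> at \<open>z\<close>.\<close>

lemma lsc_eq_SUP_Cc_minorants:
  fixes k :: "'a::t2_space \<Rightarrow> ennreal"
  assumes lc: "locally_compact_space (euclidean :: 'a topology)"
    and lsc: "\<And>c. open {z. c < k z}"
  shows "k z = (SUP \<phi>\<in>Cc_minorants k. ennreal (\<phi> z))"
proof (rule antisym)
  show "(SUP \<phi>\<in>Cc_minorants k. ennreal (\<phi> z)) \<le> k z"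
    by (intro SUP_least) (auto simp: Cc_minorants_def)
  show "k z \<le> (SUP \<phi>\<in>Cc_minorants k. ennreal (\<phi> z))"
  proof (rule dense_le)
    fix c assume c: "c < k z"
    then obtain r where r: "c = ennreal r" "0 \<le> r" by (cases c) auto
    obtain \<phi> where \<phi>: "\<phi> \<in> Cc" "\<And>x. 0 \<le> \<phi> x" "\<And>x. \<phi> x \<le> 1" "\<And>x. x \<in> {z} \<Longrightarrow> \<phi> x = 1"
       "\<And>x. x \<notin> {z. c < k z} \<Longrightarrow> \<phi> x = 0"
      using c by - (rule LCH_Urysohn[OF lc compact_sing[of z] lsc[of c]], simp, blast)
    obtain L where "continuous_on UNIV \<phi>" "compact L" "{x. \<phi> x \<noteq> 0} \<subseteq> L" using CcE[OF \<phi>(1)] .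
    then have "(\<lambda>x. r * \<phi> x) \<in> Cc" by (intro CcI[of _ L] continuous_intros) auto
    moreover have "ennreal (r * \<phi> x) \<le> k x" for x
    proof (cases "c < k x")
      case True
      have "r * \<phi> x \<le> r" using \<phi>(3)[of x] r(2) by (simp add: mult_left_le)
      then have "ennreal (r * \<phi> x) \<le> c" using r(1) by (simp add: ennreal_leI)
      then show ?thesis using True by simp
    qed (use \<phi>(5) in simp)
    ultimately have "(\<lambda>x. r * \<phi> x) \<in> Cc_minorants k"
      using r \<phi>(2) by (simp add: Cc_minorants_def)
    moreover have "c = ennreal (r * \<phi> z)" using r \<phi>(4) by simp
    ultimately show "c \<le> (SUP \<phi>\<in>Cc_minorants k. ennreal (\<phi> z))"
      by (auto intro: SUP_upper2)
  qed
qed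

text \<open>Fubini's theorem is available for the minorants in \<open>Cc\<close>, which are
  measurable for the product \<sigma>-algebra. They form a directed family with supremum
  \<open>k\<close>, so applying \<tau>-smoothness first to the inner and then to the outer integral
  expresses both iterated integrals as the same supremum. The semicontinuity of the inner integrals
  is what permits the second application.\<close>

lemma
  fixes k :: "'a::t2_space \<times> 'a \<Rightarrow> ennreal"
  assumes lc: "locally_compact_space (euclidean :: 'a topology)"
    and sc: "sigma_compact TYPE('a)"
    and lsc: "\<And>c. open {z. c < k z}"
    and \<mu>: "\<mu> \<in> radon" and \<nu>: "\<nu> \<in> radon"
  shows lsc_kernel_integral: "open {x. c < (\<integral>\<^sup>+y. k (x, y) \<partial>\<nu>)}"
    and lsc_kernel_SUP: "(\<integral>\<^sup>+x. (\<integral>\<^sup>+y. k (x, y) \<partial>\<nu>) \<partial>\<mu>) =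
      (SUP \<phi>\<in>Cc_minorants k. ennreal (integral\<^sup>L (\<mu> \<Otimes>\<^sub>M \<nu>) \<phi>))"
    and lsc_kernel_Fubini: "(\<integral>\<^sup>+x. (\<integral>\<^sup>+y. k (x, y) \<partial>\<nu>) \<partial>\<mu>) = (\<integral>\<^sup>+y. (\<integral>\<^sup>+x. k (x, y) \<partial>\<mu>) \<partial>\<nu>)"
proof -
  let ?P = "Cc_minorants k"
  have P: "\<phi> \<in> Cc" "0 \<le> \<phi> z" "continuous_on UNIV \<phi>" if "\<phi> \<in> ?P" for \<phi> z
    using that by (simp_all add: Cc_minorants_def Cc_def del: split_paired_All)
  have dir: "\<exists>\<xi>\<in>?P. \<forall>z. \<phi> z \<le> \<xi> z \<and> \<psi> z \<le> \<xi> z" if "\<phi> \<in> ?P" "\<psi> \<in> ?P" for \<phi> \<psi>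
    using Cc_minorants_directed that by blast
  have eq: "k z = (SUP \<phi>\<in>?P. ennreal (\<phi> z))" for z
    by (rule lsc_eq_SUP_Cc_minorants[OF locally_compact_prod[OF lc] lsc])
  have sec: "(\<integral>\<^sup>+y. k (x, y) \<partial>\<nu>) = (SUP \<phi>\<in>?P. \<integral>\<^sup>+y. ennreal (\<phi> (x, y)) \<partial>\<nu>)" for x
  proof (rule trans[OF nn_integral_cong[OF eq]], rule radon_nn_integral_SUP_directed[OF \<nu> Cc_minorants_ne])
    show "open {y. c < ennreal (\<phi> (x, y))}" if "\<phi> \<in> ?P" for \<phi> c
      by (intro ennreal_continuous_lsc continuous_on_compose2[OF P(3)[OF that]] continuous_intros) auto
    show "\<exists>\<xi>\<in>?P. \<forall>y. ennreal (\<phi> (x, y)) \<le> ennreal (\<xi> (x, y)) \<and> ennreal (\<psi> (x, y)) \<le> ennreal (\<xi> (x, y))"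
      if "\<phi> \<in> ?P" "\<psi> \<in> ?P" for \<phi> \<psi>
      using dir[OF that] by (auto intro!: ennreal_leI)
  qed
  have sec': "(\<integral>\<^sup>+x. k (x, y) \<partial>\<mu>) = (SUP \<phi>\<in>?P. \<integral>\<^sup>+x. ennreal (\<phi> (x, y)) \<partial>\<mu>)" for y
  proof (rule trans[OF nn_integral_cong[OF eq]], rule radon_nn_integral_SUP_directed[OF \<mu> Cc_minorants_ne])
    show "open {x. c < ennreal (\<phi> (x, y))}" if "\<phi> \<in> ?P" for \<phi> c
      by (intro ennreal_continuous_lsc continuous_on_compose2[OF P(3)[OF that]] continuous_intros) auto
    show "\<exists>\<xi>\<in>?P. \<forall>x. ennreal (\<phi> (x, y)) \<le> ennreal (\<xi> (x, y)) \<and> ennreal (\<psi> (x, y)) \<le> ennreal (\<xi> (x, y))"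
      if "\<phi> \<in> ?P" "\<psi> \<in> ?P" for \<phi> \<psi>
      using dir[OF that] by (auto intro!: ennreal_leI)
  qed
  have "{x. c < (\<integral>\<^sup>+y. k (x, y) \<partial>\<nu>)} = (\<Union>\<phi>\<in>?P. {x. c < (\<integral>\<^sup>+y. ennreal (\<phi> (x, y)) \<partial>\<nu>)})"
    by (auto simp: sec less_SUP_iff)
  also have "open \<dots>"
    using P(1,2) by (intro open_UN ballI Cc_partial_integral_lsc[OF _ _ \<nu>]) blast+
  finally show "open {x. c < (\<integral>\<^sup>+y. k (x, y) \<partial>\<nu>)}" .
  \<comment> \<open>The map \<open>f\<close> stands for either order of the two variables, so that
    one statement serves both iterated integrals.\<close>
  have dir': "\<exists>\<xi>\<in>?P. \<forall>x. (\<integral>\<^sup>+y. ennreal (\<phi> (f x y)) \<partial>\<rho>) \<le> (\<integral>\<^sup>+y. ennreal (\<xi> (f x y)) \<partial>\<rho>)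
      \<and> (\<integral>\<^sup>+y. ennreal (\<psi> (f x y)) \<partial>\<rho>) \<le> (\<integral>\<^sup>+y. ennreal (\<xi> (f x y)) \<partial>\<rho>)"
    if \<phi>: "\<phi> \<in> ?P" "\<psi> \<in> ?P" for \<phi> \<psi> and \<rho> :: "'a measure" and f
  proof -
    obtain \<xi> where "\<xi> \<in> ?P" and \<xi>: "\<And>z. \<phi> z \<le> \<xi> z" "\<And>z. \<psi> z \<le> \<xi> z" using dir[OF \<phi>] by blast
    then show ?thesis by (intro bexI[of _ \<xi>] allI conjI nn_integral_mono ennreal_leI \<xi>)
  qed
  have "(\<integral>\<^sup>+x. (\<integral>\<^sup>+y. k (x, y) \<partial>\<nu>) \<partial>\<mu>) = (SUP \<phi>\<in>?P. \<integral>\<^sup>+x. (\<integral>\<^sup>+y. ennreal (\<phi> (x, y)) \<partial>\<nu>) \<partial>\<mu>)"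
    unfolding sec
  proof (rule radon_nn_integral_SUP_directed[OF \<mu> Cc_minorants_ne])
    show "open {x. c < (\<integral>\<^sup>+y. ennreal (\<phi> (x, y)) \<partial>\<nu>)}" if "\<phi> \<in> ?P" for \<phi> c
      using P(1,2)[OF that] by (rule Cc_partial_integral_lsc[OF _ _ \<nu>])
  qed (rule dir')
  also have "\<dots> = (SUP \<phi>\<in>?P. ennreal (integral\<^sup>L (\<mu> \<Otimes>\<^sub>M \<nu>) \<phi>))"
    using P(1,2) by (intro SUP_cong refl Cc_Fubini(1)[OF sc _ _ \<mu> \<nu>, symmetric])
  finally show 1: "(\<integral>\<^sup>+x. (\<integral>\<^sup>+y. k (x, y) \<partial>\<nu>) \<partial>\<mu>) = (SUP \<phi>\<in>?P. ennreal (integral\<^sup>L (\<mu> \<Otimes>\<^sub>M \<nu>) \<phi>))" .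
  have swap_lsc: "open {y. c < (\<integral>\<^sup>+x. ennreal (\<phi> (x, y)) \<partial>\<mu>)}" if "\<phi> \<in> ?P" for \<phi> c
  proof -
    have "0 \<le> (\<lambda>(x, y). \<phi> (y, x)) z" for z using P(2)[OF that] by (simp add: case_prod_beta')
    then show ?thesis
      using Cc_partial_integral_lsc[OF Cc_swap[OF P(1)[OF that]] _ \<mu>, of c] by simp
  qed
  have "(\<integral>\<^sup>+y. (\<integral>\<^sup>+x. k (x, y) \<partial>\<mu>) \<partial>\<nu>) = (SUP \<phi>\<in>?P. \<integral>\<^sup>+y. (\<integral>\<^sup>+x. ennreal (\<phi> (x, y)) \<partial>\<mu>) \<partial>\<nu>)"
    unfolding sec'
    by (rule radon_nn_integral_SUP_directed[OF \<nu> Cc_minorants_ne swap_lsc dir'])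
  also have "\<dots> = (SUP \<phi>\<in>?P. ennreal (integral\<^sup>L (\<mu> \<Otimes>\<^sub>M \<nu>) \<phi>))"
    using P(1,2) by (intro SUP_cong refl Cc_Fubini(2)[OF sc _ _ \<mu> \<nu>, symmetric])
  finally show "(\<integral>\<^sup>+x. (\<integral>\<^sup>+y. k (x, y) \<partial>\<nu>) \<partial>\<mu>) = (\<integral>\<^sup>+y. (\<integral>\<^sup>+x. k (x, y) \<partial>\<mu>) \<partial>\<nu>)"
    using 1 by simp
qed


section \<open>Potentials and energies\<close>

text \<open>On a compact space the open sets where \<kappa> exceeds -n cover the compact product,
  and finitely many suffice. If the space is not compact, neither is its square, which projects onto
  it, and then \<open>Phi\<close> makes the kernel nonnegative.\<close>

lemma kernel_bounded_below:
  fixes \<kappa> :: "'a::t2_space \<times> 'a \<Rightarrow> ereal"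
  assumes "kernel \<kappa>"
  obtains m :: real where "0 \<le> m" "m = 0 \<or> compact (UNIV :: 'a set)" "\<And>z. ereal (- m) \<le> \<kappa> z"
proof (cases "compact (UNIV :: 'a set)")
  case True
  have lsc: "\<And>c. open {z. c < \<kappa> z}" and ninf: "\<And>z. \<kappa> z \<noteq> -\<infinity>"
    using assms by (auto simp: kernel_def Phi_def)
  have cp: "compact (UNIV :: ('a \<times> 'a) set)"
    using compact_Times[OF True True] by simp
  have cov: "(UNIV :: ('a \<times> 'a) set) \<subseteq> (\<Union>n::nat. {z. ereal (- real n) < \<kappa> z})"
  proof
    fix z :: "'a \<times> 'a"
    show "z \<in> (\<Union>n::nat. {z. ereal (- real n) < \<kappa> z})"
    proof (cases "\<kappa> z")
      case (real r)
      obtain n :: nat where "- r < real n" using reals_Archimedean2 by blast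
      then have "ereal (- real n) < \<kappa> z" using real by simp
      then show ?thesis by blast
    qed (use ninf in auto)
  qed
  obtain N :: "nat set" where N: "N \<subseteq> UNIV" "finite N" "UNIV \<subseteq> (\<Union>n\<in>N. {z. ereal (- real n) < \<kappa> z})"
    by (rule compactE_image[OF cp lsc cov])
  obtain b :: nat where b: "\<And>n. n \<in> N \<Longrightarrow> n \<le> b" using N(2) by (auto simp: finite_nat_set_iff_bounded_le)
  have "ereal (- real b) \<le> \<kappa> z" for z
  proof -
    obtain n where n: "n \<in> N" "ereal (- real n) < \<kappa> z" using N(3) by blast
    have "ereal (- real b) \<le> ereal (- real n)" using b[OF n(1)] by simp
    then show ?thesis using n(2) by (rule order_trans[OF _ less_imp_le])
  qed
  then show thesis using True by (intro that[of "real b"]) auto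
next
  case False
  have "\<not> compact (UNIV :: ('a \<times> 'a) set)"
  proof
    assume "compact (UNIV :: ('a \<times> 'a) set)"
    then have "compact (fst ` (UNIV :: ('a \<times> 'a) set))"
      by (intro compact_continuous_image continuous_intros)
    then show False using False by simp
  qed
  then show thesis using assms by (intro that[of 0]) (auto simp: kernel_def Phi_def zero_ereal_def[symmetric])
qed

section \<open>The kernel shifted by a constant\<close>

locale bounded_below_kernel =
  fixes \<kappa> :: "'a::t2_space \<times> 'a \<Rightarrow> ereal" and m :: real
  assumes lc: "locally_compact_space (euclidean :: 'a topology)"
    and sc: "sigma_compact TYPE('a)"
    and ker: "kernel \<kappa>"
    and m_nonneg: "0 \<le> m"
    and m_compact: "m = 0 \<or> compact (UNIV :: 'a set)"
    and m_bound: "\<And>z. ereal (- m) \<le> \<kappa> z"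
begin

text \<open>The kernel is shifted by the constant \<open>m\<close> so that integrals can be taken in \<^typ>\<open>ennreal\<close>.
  If \<open>m > 0\<close>, then \<open>X\<close> is compact and all masses are finite, so the correction terms
  \<open>m \<mu>(X)\<close> are finite in every case; for \<open>m = 0\<close> the junk value of \<^const>\<open>measure\<close> on sets of
  infinite measure does no harm.\<close>
definition k :: "'a \<times> 'a \<Rightarrow> ennreal" where
  "k z = e2ennreal (\<kappa> z + ereal m)"

definition V :: "'a measure \<Rightarrow> 'a \<Rightarrow> ennreal" where
  "V \<mu> x = (\<integral>\<^sup>+y. k (x, y) \<partial>\<mu>)"

definition J :: "'a measure \<Rightarrow> 'a measure \<Rightarrow> ennreal" where
  "J \<mu> \<nu> = (\<integral>\<^sup>+x. V \<mu> x \<partial>\<nu>)"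

definition cm :: "'a measure \<Rightarrow> real" where
  "cm \<mu> = m * measure \<mu> UNIV"

lemma \<kappa>_lsc: "open {z. a < \<kappa> z}" and \<kappa>_sym: "\<kappa> (x, y) = \<kappa> (y, x)"
  using ker by (auto simp: kernel_def Phi_def)

lemma \<kappa>_shift_nonneg: "0 \<le> \<kappa> z + ereal m"
  using m_bound[of z] by (cases "\<kappa> z") auto

lemma enn2ereal_k: "enn2ereal (k z) = \<kappa> z + ereal m"
  unfolding k_def by (rule enn2ereal_e2ennreal[OF \<kappa>_shift_nonneg])

lemma k_lsc: "open {z. a < k z}"
proof -
  have "a < k z \<longleftrightarrow> enn2ereal a - ereal m < \<kappa> z" for z
  proof -
    have "a < k z \<longleftrightarrow> enn2ereal a < \<kappa> z + ereal m"
      by (simp add: less_ennreal.rep_eq enn2ereal_k)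
    also have "\<dots> \<longleftrightarrow> enn2ereal a - ereal m < \<kappa> z"
      by (cases "enn2ereal a"; cases "\<kappa> z") auto
    finally show ?thesis .
  qed
  then show ?thesis using \<kappa>_lsc by simp
qed

lemma k_sym: "k (x, y) = k (y, x)"
  by (simp add: k_def \<kappa>_sym)

lemma V_lsc: "\<mu> \<in> radon \<Longrightarrow> open {x. a < V \<mu> x}"
  unfolding V_def using lsc_kernel_integral[OF lc sc k_lsc] by blast

lemma V_borel: "\<mu> \<in> radon \<Longrightarrow> V \<mu> \<in> borel_measurable borel"
  by (intro lsc_borel V_lsc)

lemma V_measurable: "\<mu> \<in> radon \<Longrightarrow> \<nu> \<in> radon \<Longrightarrow> V \<mu> \<in> borel_measurable \<nu>"
  using V_borel[of \<mu>] radon_sets[of \<nu>] by (simp cong: measurable_cong_sets)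

lemma J_sym:
  assumes "\<mu> \<in> radon" "\<nu> \<in> radon"
  shows "J \<mu> \<nu> = J \<nu> \<mu>"
proof -
  have "J \<mu> \<nu> = (\<integral>\<^sup>+y. (\<integral>\<^sup>+x. k (x, y) \<partial>\<nu>) \<partial>\<mu>)"
    unfolding J_def V_def by (rule lsc_kernel_Fubini[OF lc sc k_lsc assms(2,1)])
  also have "\<dots> = J \<nu> \<mu>"
    unfolding J_def V_def by (subst k_sym) (rule refl)
  finally show ?thesis .
qed

lemma cm_emeasure:
  assumes "\<mu> \<in> radon"
  shows "ennreal m * emeasure \<mu> UNIV = ennreal (cm \<mu>)"
proof (cases "m = 0")
  case False
  then have "emeasure \<mu> UNIV < \<infinity>" using m_compact radon_compact[OF assms] by blast
  then show ?thesis
    using m_nonneg by (simp add: cm_def emeasure_eq_ennreal_measure less_top ennreal_mult)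
next
  case True
  then have "cm \<mu> = 0" by (subst cm_def) simp
  then show ?thesis using True by simp
qed

lemma cm_nonneg: "0 \<le> cm \<mu>"
  using m_nonneg by (simp add: cm_def)

text \<open>The pointwise identity \<open>k z + e2ennreal (- \<kappa> z) = e2ennreal (\<kappa> z) +
  ennreal m\<close> is integrated. The negative part \<open>N\<close> of the integral is at most
  \<open>cm \<mu>\<close>, hence finite, and can be moved to the other side.\<close>

lemma potential_eq:
  assumes \<mu>: "\<mu> \<in> radon"
  shows "potential \<kappa> \<mu> x = enn2ereal (V \<mu> x) - ereal (cm \<mu>)"
proof -
  define P N where "P = (\<integral>\<^sup>+y. e2ennreal (\<kappa> (x, y)) \<partial>\<mu>)" and "N = (\<integral>\<^sup>+y. e2ennreal (- \<kappa> (x, y)) \<partial>\<mu>)"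
  have "open {y. a < \<kappa> (x, y)}" for a
  proof -
    have "open ((\<lambda>y. (x, y)) -` {z. a < \<kappa> z})"
      by (intro open_vimage \<kappa>_lsc continuous_intros)
    then show ?thesis by (simp add: vimage_def)
  qed
  then have "(\<lambda>y. \<kappa> (x, y)) \<in> borel_measurable borel" by (rule lsc_borel)
  then have [measurable]: "(\<lambda>y. \<kappa> (x, y)) \<in> borel_measurable \<mu>"
    using radon_sets[OF \<mu>] by (simp cong: measurable_cong_sets)
  have [measurable]: "(\<lambda>y. k (x, y)) \<in> borel_measurable \<mu>" unfolding k_def by measurable
  have pt: "k z + e2ennreal (- \<kappa> z) = e2ennreal (\<kappa> z) + ennreal m" for z
  proof (cases "\<kappa> z")
    case (real r)
    have "ennreal (r + m) + ennreal (- r) = ennreal r + ennreal m"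
      using m_nonneg m_bound[of z] real by (cases "r \<ge> 0") (auto simp: ennreal_neg simp flip: ennreal_plus)
    then show ?thesis by (simp add: k_def real)
  qed (use m_bound[of z] in \<open>auto simp: k_def\<close>)
  have "V \<mu> x + N = (\<integral>\<^sup>+y. k (x, y) + e2ennreal (- \<kappa> (x, y)) \<partial>\<mu>)"
    unfolding V_def N_def by (rule nn_integral_add[symmetric]) measurable
  also have "\<dots> = P + ennreal m * emeasure \<mu> UNIV"
    unfolding pt P_def using radon_space[OF \<mu>] by (subst nn_integral_add) auto
  also have "\<dots> = P + ennreal (cm \<mu>)" using cm_emeasure[OF \<mu>] by simp
  finally have eq: "V \<mu> x + N = P + ennreal (cm \<mu>)" .
  have "N \<le> (\<integral>\<^sup>+y. ennreal m \<partial>\<mu>)"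
    unfolding N_def
  proof (intro nn_integral_mono)
    fix y
    have "- \<kappa> (x, y) \<le> ereal m" using m_bound[of "(x, y)"] by (cases "\<kappa> (x, y)") auto
    then show "e2ennreal (- \<kappa> (x, y)) \<le> ennreal m" using e2ennreal_mono by fastforce
  qed
  also have "\<dots> = ennreal (cm \<mu>)" using cm_emeasure[OF \<mu>] radon_space[OF \<mu>] by simp
  finally have "N \<le> ennreal (cm \<mu>)" .
  then obtain n where n: "N = ennreal n" "0 \<le> n" by (cases N) (auto simp: top_unique)
  have "enn2ereal P - enn2ereal N = enn2ereal (V \<mu> x) - ereal (cm \<mu>)"
    using eq cm_nonneg[of \<mu>] unfolding n(1) using n(2)
    by (cases P; cases "V \<mu> x") (auto simp flip: ennreal_plus simp: top_add)
  then show ?thesis by (simp add: potential_def ext_integral_def P_def N_def)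
qed

text \<open>Either the constant is 0 or the space is compact. With \<open>t = 1\<close> and
  \<open>t = -1\<close> this allows minorants in \<open>Cc\<close> to be shifted between \<kappa>
  and \<open>k\<close>.\<close>

lemma const_Cc: "(\<lambda>z::'a \<times> 'a. t * m) \<in> Cc"
proof (cases "m = 0")
  case True
  then show ?thesis by (intro CcI[of _ "{}"]) auto
next
  case False
  then have "compact (UNIV \<times> UNIV :: ('a \<times> 'a) set)" using m_compact by (intro compact_Times) auto
  then show ?thesis by (intro CcI[of _ UNIV]) auto
qed

lemma integral_const_pair:
  fixes \<mu> \<nu> :: "'a measure"
  assumes \<mu>: "\<mu> \<in> radon" and \<nu>: "\<nu> \<in> radon"
  shows "integral\<^sup>L (\<mu> \<Otimes>\<^sub>M \<nu>) (\<lambda>z. t * m) = t * (m * measure \<mu> UNIV * measure \<nu> UNIV)"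
proof (cases "m = 0")
  case False
  have "sigma_finite_measure \<nu>" by (rule radon_sigma_finite[OF sc \<nu>])
  then interpret N: sigma_finite_measure \<nu> .
  have fin: "emeasure \<mu> UNIV < \<infinity>" "emeasure \<nu> UNIV < \<infinity>"
    using False m_compact radon_compact[OF \<mu>] radon_compact[OF \<nu>] by blast+
  have "emeasure (\<mu> \<Otimes>\<^sub>M \<nu>) (UNIV \<times> UNIV) = emeasure \<mu> UNIV * emeasure \<nu> UNIV"
    using radon_sets[OF \<mu>] radon_sets[OF \<nu>] by (intro N.emeasure_pair_measure_Times) auto
  then have "measure (\<mu> \<Otimes>\<^sub>M \<nu>) UNIV = measure \<mu> UNIV * measure \<nu> UNIV"
    by (simp add: measure_def enn2real_mult)
  then show ?thesis
    using radon_space[OF \<mu>] radon_space[OF \<nu>] by (simp add: space_pair_measure)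
qed simp

text \<open>Subtracting \<open>m\<close> turns a nonnegative minorant of \<open>k\<close> into a
  minorant of \<kappa>. Conversely, a minorant of \<kappa> plus \<open>m\<close> may take negative
  values; it is cut off at 0, which can only increase its integral and keeps it below
  \<open>k\<close>, since \<open>k\<close> is nonnegative.\<close>

lemma mutual_energy_eq:
  assumes \<mu>: "\<mu> \<in> radon" and \<nu>: "\<nu> \<in> radon"
  shows "mutual_energy \<kappa> \<mu> \<nu> = enn2ereal (J \<mu> \<nu>) - ereal (m * measure \<mu> UNIV * measure \<nu> UNIV)"
proof -
  let ?C = "m * measure \<mu> UNIV * measure \<nu> UNIV"
  let ?I = "\<lambda>\<phi>. integral\<^sup>L (\<mu> \<Otimes>\<^sub>M \<nu>) \<phi>"
  have J: "J \<mu> \<nu> = (SUP \<phi>\<in>Cc_minorants k. ennreal (?I \<phi>))"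
    unfolding J_sym[OF \<mu> \<nu>] unfolding J_def V_def by (rule lsc_kernel_SUP[OF lc sc k_lsc \<mu> \<nu>])
  have shift: "?I (\<lambda>z. \<phi> z + t * m) = ?I \<phi> + t * ?C" if "\<phi> \<in> Cc" for \<phi> t
    using integral_const_pair[OF \<mu> \<nu>] Cc_integrable_pair[OF sc that \<mu> \<nu>]
      Cc_integrable_pair[OF sc const_Cc \<mu> \<nu>] by simp
  have lower: "ereal (?I \<phi> - ?C) \<le> mutual_energy \<kappa> \<mu> \<nu>" if \<phi>: "\<phi> \<in> Cc_minorants k" for \<phi>
  proof -
    have \<phi>C: "\<phi> \<in> Cc" and \<phi>k: "0 \<le> \<phi> z" "ennreal (\<phi> z) \<le> k z" for z
      using \<phi> by (simp_all add: Cc_minorants_def del: split_paired_All)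
    have "(\<lambda>z. \<phi> z + (-1) * m) \<in> Cc" by (intro Cc_add \<phi>C const_Cc)
    moreover have "ereal (\<phi> z + (-1) * m) \<le> \<kappa> z" for z
    proof -
      have "ereal (\<phi> z) \<le> \<kappa> z + ereal m"
        using \<phi>k[of z] by (simp add: less_eq_ennreal.rep_eq enn2ereal_k)
      then show ?thesis by (cases "\<kappa> z") auto
    qed
    ultimately have "ereal (?I (\<lambda>z. \<phi> z + (-1) * m)) \<le> mutual_energy \<kappa> \<mu> \<nu>"
      unfolding mutual_energy_def by (intro SUP_upper) simp
    then show ?thesis unfolding shift[OF \<phi>C] by simp
  qed
  have upper: "ereal (?I \<phi> + ?C) \<le> enn2ereal (J \<mu> \<nu>)" if \<phi>: "\<phi> \<in> Cc" "\<And>z. ereal (\<phi> z) \<le> \<kappa> z" for \<phi>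
  proof -
    let ?\<psi> = "\<lambda>z. max (\<phi> z + 1 * m) 0"
    have 0: "(\<lambda>z::'a \<times> 'a. 0::real) \<in> Cc" by (rule CcI[of _ "{}"]) auto
    have 1: "(\<lambda>z. \<phi> z + 1 * m) \<in> Cc" by (intro Cc_add \<phi>(1) const_Cc)
    have 2: "?\<psi> \<in> Cc" by (intro Cc_max 0 1)
    have "ennreal (?\<psi> z) \<le> k z" for z
    proof -
      have "ereal (\<phi> z + m) \<le> \<kappa> z + ereal m" using \<phi>(2)[of z] by (cases "\<kappa> z") auto
      then have "ereal (?\<psi> z) \<le> \<kappa> z + ereal m" using \<kappa>_shift_nonneg[of z] by (auto simp: max_def zero_ereal_def[symmetric])
      then show ?thesis by (simp add: less_eq_ennreal.rep_eq enn2ereal_k)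
    qed
    then have "?\<psi> \<in> Cc_minorants k" using 2 by (simp add: Cc_minorants_def)
    then have "ennreal (?I ?\<psi>) \<le> J \<mu> \<nu>" unfolding J by (rule SUP_upper)
    moreover have "?I ?\<psi> \<ge> 0" by (intro integral_nonneg_AE) simp
    ultimately have "ereal (?I ?\<psi>) \<le> enn2ereal (J \<mu> \<nu>)" by (simp add: less_eq_ennreal.rep_eq)
    moreover have "?I \<phi> + ?C \<le> ?I ?\<psi>"
      using integral_mono[OF Cc_integrable_pair[OF sc 1 \<mu> \<nu>] Cc_integrable_pair[OF sc 2 \<mu> \<nu>]]
        shift[OF \<phi>(1), of 1] by simp
    ultimately show ?thesis by (meson ereal_less_eq(3) order_trans)
  qed
  show ?thesis
  proof (rule antisym)
    show "mutual_energy \<kappa> \<mu> \<nu> \<le> enn2ereal (J \<mu> \<nu>) - ereal ?C"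
      unfolding mutual_energy_def
    proof (rule SUP_least)
      fix \<phi> :: "'a \<times> 'a \<Rightarrow> real" assume \<phi>: "\<phi> \<in> {\<phi> \<in> Cc. \<forall>z. ereal (\<phi> z) \<le> \<kappa> z}"
      then have "ereal (?I \<phi> + ?C) \<le> enn2ereal (J \<mu> \<nu>)"
        by (intro upper) (simp_all del: split_paired_All)
      then show "ereal (?I \<phi>) \<le> enn2ereal (J \<mu> \<nu>) - ereal ?C"
        by (cases "enn2ereal (J \<mu> \<nu>)") auto
    qed
    let ?S = "mutual_energy \<kappa> \<mu> \<nu> + ereal ?C"
    have le: "ereal (?I \<phi>) \<le> ?S" if "\<phi> \<in> Cc_minorants k" for \<phi>
      using lower[OF that] by (cases "mutual_energy \<kappa> \<mu> \<nu>") auto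
    have "(\<lambda>z. 0) \<in> Cc_minorants k"
      by (auto simp: Cc_minorants_def intro!: CcI[of _ "{}"])
    from le[OF this] have S0: "0 \<le> ?S" by (simp add: zero_ereal_def)
    have "J \<mu> \<nu> \<le> e2ennreal ?S"
      unfolding J
    proof (rule SUP_least)
      fix \<phi> assume "\<phi> \<in> Cc_minorants k"
      from e2ennreal_mono[OF le[OF this]] show "ennreal (?I \<phi>) \<le> e2ennreal ?S" by simp
    qed
    then have "enn2ereal (J \<mu> \<nu>) \<le> ?S"
      using S0 by (simp add: less_eq_ennreal.rep_eq enn2ereal_e2ennreal)
    then show "enn2ereal (J \<mu> \<nu>) - ereal ?C \<le> mutual_energy \<kappa> \<mu> \<nu>"
      by (cases "enn2ereal (J \<mu> \<nu>)"; cases "mutual_energy \<kappa> \<mu> \<nu>") auto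
  qed
qed

lemma J_add_right:
  assumes "\<mu> \<in> radon" "\<nu> \<in> radon" "\<rho> \<in> radon"
  shows "J \<mu> (measure_add \<nu> \<rho>) = J \<mu> \<nu> + J \<mu> \<rho>"
  unfolding J_def using assms by (intro nn_integral_measure_add V_measurable) (simp_all add: radon_sets)

lemma J_add_left:
  assumes "\<mu> \<in> radon" "\<nu> \<in> radon" "\<rho> \<in> radon"
  shows "J (measure_add \<nu> \<rho>) \<mu> = J \<nu> \<mu> + J \<rho> \<mu>"
  using J_add_right[OF assms] J_sym assms radon_add[OF sc] by metis

lemma J_scale_right:
  assumes "\<mu> \<in> radon" "\<nu> \<in> radon"
  shows "J \<mu> (scale_measure r \<nu>) = r * J \<mu> \<nu>"
  unfolding J_def using assms V_measurable by (intro nn_integral_scale_measure) auto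

lemma J_density_le:
  assumes "\<mu> \<in> radon" "\<nu> \<in> radon" "S \<in> sets borel"
  shows "J \<mu> (density \<nu> (indicator S)) \<le> J \<mu> \<nu>"
proof -
  have "J \<mu> (density \<nu> (indicator S)) = (\<integral>\<^sup>+x. indicator S x * V \<mu> x \<partial>\<nu>)"
    unfolding J_def using assms
    by (intro nn_integral_density V_measurable borel_measurable_indicator) (simp_all add: radon_sets)
  also have "\<dots> \<le> J \<mu> \<nu>"
    unfolding J_def by (intro nn_integral_mono) (auto split: split_indicator)
  finally show ?thesis .
qed

lemma Eplus_iff: "\<mu> \<in> Eplus \<kappa> \<longleftrightarrow> \<mu> \<in> radon \<and> J \<mu> \<mu> < \<infinity>"
proof (cases "\<mu> \<in> radon")
  case True
  then show ?thesis
    unfolding Eplus_def using mutual_energy_eq[OF True True]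
    by (cases "J \<mu> \<mu>") (auto simp: less_top)
qed (simp add: Eplus_def)

end

text \<open>The default value 0 of \<open>real_of_ereal\<close> at \<infinity> is harmless: mutual
  energies on \<open>Eplus\<close> turn out to be finite.\<close>

definition ip :: "('a::topological_space \<times> 'a \<Rightarrow> ereal) \<Rightarrow> 'a measure \<Rightarrow> 'a measure \<Rightarrow> real" where
  "ip \<kappa> \<mu> \<nu> = real_of_ereal (mutual_energy \<kappa> \<mu> \<nu>)"

section \<open>The energy inner product and the energy metric\<close>

locale perfect_potential_theory = bounded_below_kernel +
  assumes perfect: "perfect_kernel \<kappa>"
    and first_max: "first_maximum_principle \<kappa>"
    and second_max: "second_maximum_principle \<kappa>"
begin

lemma Eplus_radon: "\<mu> \<in> Eplus \<kappa> \<Longrightarrow> \<mu> \<in> radon"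
  by (simp add: Eplus_def)

lemma mutual_energy_ip:
  assumes "\<mu> \<in> radon" "\<nu> \<in> radon" "J \<mu> \<nu> < \<infinity>"
  shows "mutual_energy \<kappa> \<mu> \<nu> = ereal (ip \<kappa> \<mu> \<nu>)"
    and "ip \<kappa> \<mu> \<nu> = enn2real (J \<mu> \<nu>) - m * measure \<mu> UNIV * measure \<nu> UNIV"
  using mutual_energy_eq[OF assms(1,2)] assms(3) by (cases "J \<mu> \<nu>"; simp add: ip_def)+

text \<open>Finite self-energies make the energy of \<sigma> - \<tau> well defined. An infinite
  mutual energy would make it -\<infinity>, against the energy principle.\<close>

lemma J_finite_singular:
  assumes s: "(\<sigma>, \<tau>) \<in> signed_radon" and f: "J \<sigma> \<sigma> < \<infinity>" "J \<tau> \<tau> < \<infinity>"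
  shows "J \<sigma> \<tau> < \<infinity>"
    and "0 \<le> ip \<kappa> \<sigma> \<sigma> + ip \<kappa> \<tau> \<tau> - 2 * ip \<kappa> \<sigma> \<tau>"
    and "ip \<kappa> \<sigma> \<sigma> + ip \<kappa> \<tau> \<tau> - 2 * ip \<kappa> \<sigma> \<tau> = 0 \<Longrightarrow> emeasure \<sigma> UNIV = 0 \<and> emeasure \<tau> UNIV = 0"
proof -
  have r: "\<sigma> \<in> radon" "\<tau> \<in> radon" using s by (auto simp: signed_radon_def)
  have E: "energy \<kappa> \<sigma> = ereal (ip \<kappa> \<sigma> \<sigma>)" "energy \<kappa> \<tau> = ereal (ip \<kappa> \<tau> \<tau>)"
    using mutual_energy_ip r f by auto
  have ep: "energy_principle \<kappa>" using perfect by (simp add: perfect_kernel_def)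
  have "diff_energy_defined \<kappa> \<sigma> \<tau>" by (simp add: diff_energy_defined_def E)
  then have 1: "0 \<le> diff_energy \<kappa> \<sigma> \<tau>"
    "diff_energy \<kappa> \<sigma> \<tau> = 0 \<Longrightarrow> emeasure \<sigma> UNIV = 0 \<and> emeasure \<tau> UNIV = 0"
    using ep s unfolding energy_principle_def by auto
  have "mutual_energy \<kappa> \<sigma> \<tau> \<noteq> \<infinity>"
    using 1(1) by (auto simp: diff_energy_def E)
  then show fin: "J \<sigma> \<tau> < \<infinity>"
    using mutual_energy_eq[OF r] by (cases "J \<sigma> \<tau>") auto
  have "diff_energy \<kappa> \<sigma> \<tau> = ereal (ip \<kappa> \<sigma> \<sigma> + ip \<kappa> \<tau> \<tau> - 2 * ip \<kappa> \<sigma> \<tau>)"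
    unfolding diff_energy_def E mutual_energy_ip(1)[OF r fin] by simp
  then show "0 \<le> ip \<kappa> \<sigma> \<sigma> + ip \<kappa> \<tau> \<tau> - 2 * ip \<kappa> \<sigma> \<tau>"
    and "ip \<kappa> \<sigma> \<sigma> + ip \<kappa> \<tau> \<tau> - 2 * ip \<kappa> \<sigma> \<tau> = 0 \<Longrightarrow> emeasure \<sigma> UNIV = 0 \<and> emeasure \<tau> UNIV = 0"
    using 1 by (simp_all add: zero_ereal_def)
qed

text \<open>After splitting off the common part \<rho>, every term of \<open>J \<mu> \<nu>\<close>
  except \<open>J \<sigma> \<tau>\<close> already occurs in \<open>J \<mu> \<mu>\<close> or
  \<open>J \<nu> \<nu>\<close>, and \<open>J \<sigma> \<tau>\<close> is the case of a singular
  pair.\<close>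

lemma J_finite:
  assumes "\<mu> \<in> Eplus \<kappa>" "\<nu> \<in> Eplus \<kappa>"
  shows "J \<mu> \<nu> < \<infinity>"
proof -
  have r: "\<mu> \<in> radon" "\<nu> \<in> radon" and f: "J \<mu> \<mu> < \<infinity>" "J \<nu> \<nu> < \<infinity>"
    using assms by (auto simp: Eplus_iff)
  obtain \<sigma> \<tau> \<rho> where d: "\<sigma> \<in> radon" "\<tau> \<in> radon" "\<rho> \<in> radon" "(\<sigma>, \<tau>) \<in> signed_radon"
    "\<mu> = measure_add \<sigma> \<rho>" "\<nu> = measure_add \<tau> \<rho>"
    by (rule Jordan_decomposition[OF sc r])
  have \<mu>\<mu>: "J \<mu> \<mu> = (J \<sigma> \<sigma> + J \<rho> \<sigma>) + (J \<sigma> \<rho> + J \<rho> \<rho>)"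
    unfolding d(5) using d(1,3) radon_add[OF sc d(1,3)] by (simp add: J_add_left J_add_right)
  have \<nu>\<nu>: "J \<nu> \<nu> = (J \<tau> \<tau> + J \<rho> \<tau>) + (J \<tau> \<rho> + J \<rho> \<rho>)"
    unfolding d(6) using d(2,3) radon_add[OF sc d(2,3)] by (simp add: J_add_left J_add_right)
  have \<mu>\<nu>: "J \<mu> \<nu> = (J \<sigma> \<tau> + J \<rho> \<tau>) + (J \<sigma> \<rho> + J \<rho> \<rho>)"
    unfolding d(5,6) using d(1-3) radon_add[OF sc d(1,3)] radon_add[OF sc d(2,3)] by (simp add: J_add_left J_add_right)
  have "J \<sigma> \<tau> < \<infinity>"
    using J_finite_singular(1)[OF d(4)] \<mu>\<mu> \<nu>\<nu> f by simp
  then show ?thesis using \<mu>\<mu> \<nu>\<nu> f unfolding \<mu>\<nu> by simp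
qed

lemma mutual_energy_Eplus:
  assumes "\<mu> \<in> Eplus \<kappa>" "\<nu> \<in> Eplus \<kappa>"
  shows "mutual_energy \<kappa> \<mu> \<nu> = ereal (ip \<kappa> \<mu> \<nu>)"
    and "ip \<kappa> \<mu> \<nu> = enn2real (J \<mu> \<nu>) - m * measure \<mu> UNIV * measure \<nu> UNIV"
  using mutual_energy_ip[OF _ _ J_finite[OF assms]] assms Eplus_radon by auto

lemma ip_sym:
  assumes "\<mu> \<in> Eplus \<kappa>" "\<nu> \<in> Eplus \<kappa>"
  shows "ip \<kappa> \<mu> \<nu> = ip \<kappa> \<nu> \<mu>"
  using mutual_energy_Eplus(2) assms J_sym Eplus_radon by simp

lemma Eplus_add:
  assumes "\<mu> \<in> Eplus \<kappa>" "\<nu> \<in> Eplus \<kappa>"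
  shows "measure_add \<mu> \<nu> \<in> Eplus \<kappa>"
proof -
  have r: "\<mu> \<in> radon" "\<nu> \<in> radon" "measure_add \<mu> \<nu> \<in> radon"
    using assms radon_add[OF sc] Eplus_radon by auto
  have "J (measure_add \<mu> \<nu>) (measure_add \<mu> \<nu>) = (J \<mu> \<mu> + J \<nu> \<mu>) + (J \<mu> \<nu> + J \<nu> \<nu>)"
    using r by (simp add: J_add_left J_add_right)
  also have "\<dots> < \<infinity>"
    using J_finite assms by simp
  finally show ?thesis using r(3) by (simp add: Eplus_iff)
qed

lemma Eplus_scale:
  assumes "\<mu> \<in> Eplus \<kappa>" "0 \<le> a"
  shows "scale_measure (ennreal a) \<mu> \<in> Eplus \<kappa>"
proof -
  have r: "\<mu> \<in> radon" "scale_measure (ennreal a) \<mu> \<in> radon" using assms radon_scale[OF sc] Eplus_radon by auto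
  have "J (scale_measure (ennreal a) \<mu>) (scale_measure (ennreal a) \<mu>) = ennreal a * (ennreal a * J \<mu> \<mu>)"
    using J_scale_right[OF r(2,1)] J_sym[OF r(2,1)] J_scale_right[OF r(1,1)] by simp
  then show ?thesis using assms r by (auto simp: Eplus_iff ennreal_mult_less_top)
qed

lemma Eplus_restrict:
  assumes "\<mu> \<in> Eplus \<kappa>" "S \<in> sets borel"
  shows "density \<mu> (indicator S) \<in> Eplus \<kappa>"
proof -
  have r: "\<mu> \<in> radon" "density \<mu> (indicator S) \<in> radon"
    using assms radon_density_indicator[OF sc] Eplus_radon by auto
  have "J (density \<mu> (indicator S)) (density \<mu> (indicator S)) \<le> J (density \<mu> (indicator S)) \<mu>"
    by (rule J_density_le[OF r(2,1) assms(2)])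
  also have "\<dots> = J \<mu> (density \<mu> (indicator S))" by (rule J_sym[OF r(2,1)])
  also have "\<dots> \<le> J \<mu> \<mu>" by (rule J_density_le[OF r(1,1) assms(2)])
  finally show ?thesis using assms r by (auto simp: Eplus_iff intro: le_less_trans)
qed

lemma null_Eplus: "null_measure borel \<in> Eplus \<kappa>"
proof -
  have "J (null_measure borel) (null_measure borel) = 0"
    unfolding J_def by (rule nn_integral_null_measure)
  then show ?thesis unfolding Eplus_iff using radon_null by simp
qed

text \<open>The factor \<open>m\<close> makes this true even for infinite masses, where
  \<open>measure\<close> is not additive: such masses occur only for \<open>m = 0\<close>.\<close>

lemma m_measure_add:
  fixes \<mu> \<nu> :: "'a measure"
  assumes "\<mu> \<in> radon" "\<nu> \<in> radon"
  shows "m * measure (measure_add \<mu> \<nu>) UNIV = m * measure \<mu> UNIV + m * measure \<nu> UNIV"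
proof (cases "m = 0")
  case False
  then have fin: "emeasure \<mu> UNIV < \<infinity>" "emeasure \<nu> UNIV < \<infinity>"
    using m_compact radon_compact[OF assms(1), of UNIV] radon_compact[OF assms(2), of UNIV] by simp_all
  have s: "sets \<nu> = sets \<mu>" "UNIV \<in> sets \<mu>"
    using radon_sets[OF assms(1)] radon_sets[OF assms(2)] by auto
  have "emeasure (measure_add \<mu> \<nu>) UNIV = emeasure \<mu> UNIV + emeasure \<nu> UNIV"
    by (rule emeasure_measure_add[OF s])
  then have "measure (measure_add \<mu> \<nu>) UNIV = measure \<mu> UNIV + measure \<nu> UNIV"
    using enn2real_plus[of "emeasure \<mu> UNIV" "emeasure \<nu> UNIV"] fin
    unfolding Sigma_Algebra.measure_def by simp
  then show ?thesis by (simp add: distrib_left)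
qed simp

lemma ip_add_right:
  assumes "\<mu> \<in> Eplus \<kappa>" "\<nu> \<in> Eplus \<kappa>" "\<rho> \<in> Eplus \<kappa>"
  shows "ip \<kappa> \<mu> (measure_add \<nu> \<rho>) = ip \<kappa> \<mu> \<nu> + ip \<kappa> \<mu> \<rho>"
proof -
  have r: "\<mu> \<in> radon" "\<nu> \<in> radon" "\<rho> \<in> radon" using assms Eplus_radon by auto
  have "enn2real (J \<mu> (measure_add \<nu> \<rho>)) = enn2real (J \<mu> \<nu>) + enn2real (J \<mu> \<rho>)"
    unfolding J_add_right[OF r] using J_finite assms by (simp add: enn2real_plus)
  moreover have "m * measure \<mu> UNIV * measure (measure_add \<nu> \<rho>) UNIV =
      m * measure \<mu> UNIV * measure \<nu> UNIV + m * measure \<mu> UNIV * measure \<rho> UNIV"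
    using arg_cong[OF m_measure_add[OF r(2,3)], of "\<lambda>t. t * measure \<mu> UNIV"] by (simp add: algebra_simps)
  ultimately show ?thesis
    using mutual_energy_Eplus(2) assms Eplus_add by simp
qed

lemma ip_add_left:
  assumes "\<mu> \<in> Eplus \<kappa>" "\<nu> \<in> Eplus \<kappa>" "\<rho> \<in> Eplus \<kappa>"
  shows "ip \<kappa> (measure_add \<nu> \<rho>) \<mu> = ip \<kappa> \<nu> \<mu> + ip \<kappa> \<rho> \<mu>"
  using ip_add_right[OF assms] ip_sym[OF assms(1)] assms Eplus_add by simp

lemma ip_scale_right:
  assumes "\<mu> \<in> Eplus \<kappa>" "\<nu> \<in> Eplus \<kappa>" "0 \<le> a"
  shows "ip \<kappa> \<mu> (scale_measure (ennreal a) \<nu>) = a * ip \<kappa> \<mu> \<nu>"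
  unfolding mutual_energy_Eplus(2)[OF assms(1) Eplus_scale[OF assms(2,3)]]
    mutual_energy_Eplus(2)[OF assms(1,2)] J_scale_right[OF Eplus_radon[OF assms(1)] Eplus_radon[OF assms(2)]]
  using assms(3) by (simp add: enn2real_mult algebra_simps)

lemma ip_scale_left:
  assumes "\<mu> \<in> Eplus \<kappa>" "\<nu> \<in> Eplus \<kappa>" "0 \<le> a"
  shows "ip \<kappa> (scale_measure (ennreal a) \<nu>) \<mu> = a * ip \<kappa> \<nu> \<mu>"
  using ip_scale_right[OF assms] ip_sym[OF assms(1)] assms Eplus_scale by simp

lemma ip_null: "\<mu> \<in> Eplus \<kappa> \<Longrightarrow> ip \<kappa> \<mu> (null_measure borel) = 0"
  using mutual_energy_Eplus(2)[OF _ null_Eplus, of \<mu>]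
  by (simp add: J_def nn_integral_null_measure measure_def)

text \<open>The common part \<rho> cancels in the quadratic expression, which leaves the energy of
  the signed measure \<sigma> - \<tau>. If that is zero, then \<sigma> and \<tau> vanish and both
  measures equal \<rho>.\<close>

lemma
  assumes "\<mu> \<in> Eplus \<kappa>" "\<nu> \<in> Eplus \<kappa>"
  shows ip_diff_nonneg: "0 \<le> ip \<kappa> \<mu> \<mu> + ip \<kappa> \<nu> \<nu> - 2 * ip \<kappa> \<mu> \<nu>"
    and ip_diff_eq_0: "ip \<kappa> \<mu> \<mu> + ip \<kappa> \<nu> \<nu> - 2 * ip \<kappa> \<mu> \<nu> = 0 \<Longrightarrow> \<mu> = \<nu>"
proof -
  have r: "\<mu> \<in> radon" "\<nu> \<in> radon" and f: "J \<mu> \<mu> < \<infinity>" "J \<nu> \<nu> < \<infinity>"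
    using assms by (auto simp: Eplus_iff)
  obtain \<sigma> \<tau> \<rho> where d: "\<sigma> \<in> radon" "\<tau> \<in> radon" "\<rho> \<in> radon" "(\<sigma>, \<tau>) \<in> signed_radon"
    "\<mu> = measure_add \<sigma> \<rho>" "\<nu> = measure_add \<tau> \<rho>"
    by (rule Jordan_decomposition[OF sc r])
  have \<mu>\<mu>: "J \<mu> \<mu> = (J \<sigma> \<sigma> + J \<rho> \<sigma>) + (J \<sigma> \<rho> + J \<rho> \<rho>)"
    unfolding d(5) using d(1,3) radon_add[OF sc d(1,3)] by (simp add: J_add_left J_add_right)
  have \<nu>\<nu>: "J \<nu> \<nu> = (J \<tau> \<tau> + J \<rho> \<tau>) + (J \<tau> \<rho> + J \<rho> \<rho>)"
    unfolding d(6) using d(2,3) radon_add[OF sc d(2,3)] by (simp add: J_add_left J_add_right)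
  have E: "\<sigma> \<in> Eplus \<kappa>" "\<tau> \<in> Eplus \<kappa>" "\<rho> \<in> Eplus \<kappa>"
    using d(1-3) f \<mu>\<mu> \<nu>\<nu> by (auto simp: Eplus_iff)
  have eq: "ip \<kappa> \<mu> \<mu> + ip \<kappa> \<nu> \<nu> - 2 * ip \<kappa> \<mu> \<nu> = ip \<kappa> \<sigma> \<sigma> + ip \<kappa> \<tau> \<tau> - 2 * ip \<kappa> \<sigma> \<tau>"
    unfolding d(5,6) using E Eplus_add
    by (simp add: ip_add_left ip_add_right ip_sym[of \<rho> \<sigma>] ip_sym[of \<rho> \<tau>])
  have f': "J \<sigma> \<sigma> < \<infinity>" "J \<tau> \<tau> < \<infinity>" using E by (auto simp: Eplus_iff)
  show "0 \<le> ip \<kappa> \<mu> \<mu> + ip \<kappa> \<nu> \<nu> - 2 * ip \<kappa> \<mu> \<nu>"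
    unfolding eq by (rule J_finite_singular(2)[OF d(4) f'])
  assume "ip \<kappa> \<mu> \<mu> + ip \<kappa> \<nu> \<nu> - 2 * ip \<kappa> \<mu> \<nu> = 0"
  then have z: "emeasure \<sigma> UNIV = 0" "emeasure \<tau> UNIV = 0"
    unfolding eq using J_finite_singular(3)[OF d(4) f'] by auto
  have "measure_add \<theta> \<rho> = \<rho>" if "\<theta> \<in> radon" "emeasure \<theta> UNIV = 0" for \<theta>
  proof (rule measure_eqI)
    show "sets (measure_add \<theta> \<rho>) = sets \<rho>" using that d(3) by (simp add: radon_sets)
    fix B assume "B \<in> sets (measure_add \<theta> \<rho>)"
    then have B: "B \<in> sets \<theta>" by simp
    have "emeasure \<theta> B \<le> emeasure \<theta> UNIV" using that by (intro emeasure_mono) (simp_all add: radon_sets)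
    then have "emeasure \<theta> B = 0" using that by simp
    then show "emeasure (measure_add \<theta> \<rho>) B = emeasure \<rho> B"
      using B that d(3) by (subst emeasure_measure_add) (simp_all add: radon_sets)
  qed
  then show "\<mu> = \<nu>" unfolding d(5,6) using z d by simp
qed

lemma energy_dist_eq:
  assumes "\<mu> \<in> Eplus \<kappa>" "\<nu> \<in> Eplus \<kappa>"
  shows "energy_dist \<kappa> \<mu> \<nu> = sqrt (ip \<kappa> \<mu> \<mu> + ip \<kappa> \<nu> \<nu> - 2 * ip \<kappa> \<mu> \<nu>)"
proof -
  have "diff_energy \<kappa> \<mu> \<nu> = ereal (ip \<kappa> \<mu> \<mu> + ip \<kappa> \<nu> \<nu> - 2 * ip \<kappa> \<mu> \<nu>)"
    using assms by (simp add: diff_energy_def mutual_energy_Eplus)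
  then show ?thesis using assms by (simp add: energy_dist_def)
qed

lemma energy_dist_triangle:
  assumes x: "x \<in> Eplus \<kappa>" and y: "y \<in> Eplus \<kappa>" and z: "z \<in> Eplus \<kappa>"
  shows "energy_dist \<kappa> x z \<le> energy_dist \<kappa> x y + energy_dist \<kappa> y z"
proof -
  define a where "a = ip \<kappa> x x + ip \<kappa> y y - 2 * ip \<kappa> x y"
  define b where "b = ip \<kappa> y y + ip \<kappa> z z - 2 * ip \<kappa> y z"
  define B where "B = ip \<kappa> x y - ip \<kappa> x z - ip \<kappa> y y + ip \<kappa> y z"
  have ab: "0 \<le> a" "0 \<le> b" using ip_diff_nonneg x y z by (simp_all add: a_def b_def)
  have eq: "ip \<kappa> x x + ip \<kappa> z z - 2 * ip \<kappa> x z = a + b + 2 * B"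
    by (simp add: a_def b_def B_def)
  have d: "energy_dist \<kappa> x z = sqrt (a + b + 2 * B)" "energy_dist \<kappa> x y = sqrt a" "energy_dist \<kappa> y z = sqrt b"
    using x y z eq by (simp_all add: energy_dist_eq a_def b_def)
  show ?thesis
  proof (cases "a = 0 \<or> b = 0")
    case True
    then have "x = y \<or> y = z" using ip_diff_eq_0[OF x y] ip_diff_eq_0[OF y z] unfolding a_def b_def by blast
    then show ?thesis using d(2,3) ab by auto
  next
    case False
    then have ab': "0 < a" "0 < b" using ab by auto
    \<comment> \<open>This choice balances \<open>a\<close> against \<open>t\<^sup>2 * b\<close>, so
      that their sum becomes \<open>2 * t * (sqrt a * sqrt b)\<close>. It requires \<open>a\<close>
      and \<open>b\<close> nonzero; otherwise two of the points coincide.\<close>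
    define t where "t = sqrt a / sqrt b"
    have t: "t > 0" using ab' by (simp add: t_def)
    define p where "p = measure_add x (scale_measure (ennreal t) z)"
    define r where "r = 1 + t"
    have r: "0 \<le> r" using t by (simp add: r_def)
    define q where "q = scale_measure (ennreal r) y"
    have E: "p \<in> Eplus \<kappa>" "q \<in> Eplus \<kappa>" "scale_measure (ennreal t) z \<in> Eplus \<kappa>"
      unfolding p_def q_def using t r by (intro Eplus_add Eplus_scale x y z; simp)+
    have "0 \<le> ip \<kappa> p p + ip \<kappa> q q - 2 * ip \<kappa> p q" by (rule ip_diff_nonneg[OF E(1,2)])
    also have "ip \<kappa> p p = ip \<kappa> x x + 2 * t * ip \<kappa> x z + t * t * ip \<kappa> z z"
      unfolding p_def using x z E(3) t Eplus_add[OF x E(3)]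
      by (simp add: ip_add_left ip_add_right ip_scale_left ip_scale_right ip_sym[of z x] algebra_simps)
    also have "ip \<kappa> q q = r * r * ip \<kappa> y y"
      unfolding q_def using y r E(2)[unfolded q_def] by (simp add: ip_scale_left ip_scale_right)
    also have "ip \<kappa> p q = r * (ip \<kappa> x y + t * ip \<kappa> y z)"
      unfolding p_def q_def using x y z r t E(3) E(2)[unfolded q_def] Eplus_add[OF x E(3)]
      by (simp add: ip_add_left ip_scale_left ip_scale_right ip_sym[of z y])
    also have "ip \<kappa> x x + 2 * t * ip \<kappa> x z + t * t * ip \<kappa> z z + r * r * ip \<kappa> y y
        - 2 * (r * (ip \<kappa> x y + t * ip \<kappa> y z)) = a - 2 * t * B + t\<^sup>2 * b"
      by (simp add: a_def b_def B_def r_def algebra_simps power2_eq_square)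
    finally have "2 * t * B \<le> a + t\<^sup>2 * b" by simp
    also have "\<dots> = 2 * t * (sqrt a * sqrt b)"
      using ab' by (simp add: t_def power2_eq_square field_simps)
    finally have "B \<le> sqrt a * sqrt b" using t by simp
    then have "a + b + 2 * B \<le> (sqrt a + sqrt b)\<^sup>2"
      using ab by (simp add: power2_sum)
    then show ?thesis unfolding d using ab by (intro real_le_lsqrt) auto
  qed
qed

sublocale energy: Metric_space "Eplus \<kappa>" "energy_dist \<kappa>"
proof
  show "0 \<le> energy_dist \<kappa> x y" for x y
    using ip_diff_nonneg energy_dist_eq[of x y] by (cases "x \<in> Eplus \<kappa> \<and> y \<in> Eplus \<kappa>") (auto simp: energy_dist_def)
  show "energy_dist \<kappa> x y = energy_dist \<kappa> y x" for x y
    using energy_dist_eq[of x y] energy_dist_eq[of y x] ip_sym[of x y]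
    by (cases "x \<in> Eplus \<kappa> \<and> y \<in> Eplus \<kappa>") (auto simp: energy_dist_def add.commute)
  show "energy_dist \<kappa> x y = 0 \<longleftrightarrow> x = y" if "x \<in> Eplus \<kappa>" "y \<in> Eplus \<kappa>" for x y
    using that ip_diff_eq_0 by (auto simp: energy_dist_eq)
qed (rule energy_dist_triangle)

section \<open>Potentials as nonnegative functions\<close>

definition U :: "'a measure \<Rightarrow> 'a \<Rightarrow> ennreal" where
  "U \<mu> x = e2ennreal (potential \<kappa> \<mu> x)"

text \<open>The domination principle for \<open>\<mu> = 0\<close> shows that potentials are nonnegative, even if the kernel
  takes negative values.\<close>
lemma potential_nonneg:
  assumes "\<mu> \<in> Eplus \<kappa>"
  shows "0 \<le> potential \<kappa> \<mu> x"
proof -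
  have "potential \<kappa> (null_measure borel) x = 0"
    unfolding potential_eq[OF radon_null] V_def cm_def
    by (simp add: nn_integral_null_measure Sigma_Algebra.measure_def zero_ennreal.rep_eq zero_ereal_def)
  moreover have "AE y in null_measure borel. potential \<kappa> (null_measure borel) y \<le> potential \<kappa> \<mu> y"
    by (rule AE_I[of _ _ UNIV]) auto
  ultimately show ?thesis
    using second_max null_Eplus assms unfolding second_maximum_principle_def by metis
qed

lemma enn2ereal_U: "\<mu> \<in> Eplus \<kappa> \<Longrightarrow> enn2ereal (U \<mu> x) = potential \<kappa> \<mu> x"
  unfolding U_def by (intro enn2ereal_e2ennreal potential_nonneg)

lemma U_le_iff:
  assumes "\<mu> \<in> Eplus \<kappa>" "\<nu> \<in> Eplus \<kappa>"
  shows "U \<mu> x \<le> U \<nu> x \<longleftrightarrow> potential \<kappa> \<mu> x \<le> potential \<kappa> \<nu> x"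
  using assms by (simp add: less_eq_ennreal.rep_eq enn2ereal_U)

lemma U_plus_cm:
  assumes "\<mu> \<in> Eplus \<kappa>"
  shows "U \<mu> x + ennreal (cm \<mu>) = V \<mu> x"
  using potential_nonneg[OF assms, of x] potential_eq[OF Eplus_radon[OF assms], of x] cm_nonneg[of \<mu>]
  by (cases "V \<mu> x") (auto simp: U_def simp flip: ennreal_plus)

lemma U_lsc:
  assumes "\<mu> \<in> Eplus \<kappa>"
  shows "open {x. a < U \<mu> x}"
proof -
  have "a < U \<mu> x \<longleftrightarrow> a + ennreal (cm \<mu>) < V \<mu> x" for x
    unfolding U_plus_cm[OF assms, symmetric] by simp
  then show ?thesis using V_lsc[OF Eplus_radon[OF assms]] by simp
qed

lemma U_borel: "\<mu> \<in> Eplus \<kappa> \<Longrightarrow> U \<mu> \<in> borel_measurable borel"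
  by (intro lsc_borel U_lsc)

lemma U_measurable: "\<mu> \<in> Eplus \<kappa> \<Longrightarrow> \<nu> \<in> Eplus \<kappa> \<Longrightarrow> U \<mu> \<in> borel_measurable \<nu>"
  using U_borel[of \<mu>] radon_sets[OF Eplus_radon, of \<nu>] by (simp cong: measurable_cong_sets)

text \<open>\<open>U \<mu>\<close> and \<open>V \<mu>\<close> differ by the constant
  \<open>cm \<mu>\<close>, whose integral against \<nu> is exactly the finite correction term of the
  mutual energy. Nonnegativity of \<open>ip\<close> thus comes from nonnegativity of potentials,
  even if the kernel takes negative values.\<close>

lemma
  assumes \<mu>: "\<mu> \<in> Eplus \<kappa>" and \<nu>: "\<nu> \<in> Eplus \<kappa>"
  shows nn_integral_U: "(\<integral>\<^sup>+x. U \<mu> x \<partial>\<nu>) = ennreal (ip \<kappa> \<mu> \<nu>)"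
    and ip_nonneg: "0 \<le> ip \<kappa> \<mu> \<nu>"
proof -
  have r: "\<mu> \<in> radon" "\<nu> \<in> radon" using \<mu> \<nu> Eplus_radon by auto
  have "J \<mu> \<nu> = (\<integral>\<^sup>+x. U \<mu> x + ennreal (cm \<mu>) \<partial>\<nu>)"
    unfolding J_def U_plus_cm[OF \<mu>] ..
  also have "\<dots> = (\<integral>\<^sup>+x. U \<mu> x \<partial>\<nu>) + ennreal (cm \<mu>) * emeasure \<nu> UNIV"
    using U_measurable[OF \<mu> \<nu>] radon_space[OF r(2)] by (subst nn_integral_add) auto
  also have "ennreal (cm \<mu>) * emeasure \<nu> UNIV = ennreal (cm \<mu> * measure \<nu> UNIV)"
  proof (cases "m = 0")
    case True
    then have "cm \<mu> = 0" by (subst cm_def) simp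
    then show ?thesis by simp
  next
    case False
    then have "emeasure \<nu> UNIV < \<infinity>" using m_compact radon_compact[OF r(2)] by auto
    then show ?thesis using cm_nonneg by (simp add: emeasure_eq_ennreal_measure less_top ennreal_mult)
  qed
  finally have eq: "J \<mu> \<nu> = (\<integral>\<^sup>+x. U \<mu> x \<partial>\<nu>) + ennreal (cm \<mu> * measure \<nu> UNIV)" .
  then have "(\<integral>\<^sup>+x. U \<mu> x \<partial>\<nu>) < \<infinity>" using J_finite[OF \<mu> \<nu>] by simp
  then obtain r where r: "(\<integral>\<^sup>+x. U \<mu> x \<partial>\<nu>) = ennreal r" "0 \<le> r"
    by (cases "\<integral>\<^sup>+x. U \<mu> x \<partial>\<nu>") auto
  have n: "0 \<le> cm \<mu> * measure \<nu> UNIV" using cm_nonneg by simp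
  have "ip \<kappa> \<mu> \<nu> = enn2real (J \<mu> \<nu>) - cm \<mu> * measure \<nu> UNIV"
    using mutual_energy_Eplus(2)[OF \<mu> \<nu>] by (simp add: cm_def)
  also have "\<dots> = r"
    using r(2) n unfolding eq r(1) by (simp flip: ennreal_plus)
  finally show "(\<integral>\<^sup>+x. U \<mu> x \<partial>\<nu>) = ennreal (ip \<kappa> \<mu> \<nu>)" "0 \<le> ip \<kappa> \<mu> \<nu>"
    using r by simp_all
qed

section \<open>Unit test measures and exceptional sets\<close>

lemma Eplus_on_iff: "\<mu> \<in> Eplus_on \<kappa> A \<longleftrightarrow> \<mu> \<in> Eplus \<kappa> \<and> (AE x in \<mu>. x \<in> A)"
  using concentrated_on_iff_AE[OF sc Eplus_radon] by (auto simp: Eplus_on_def)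

lemma unit_on_iff:
  "\<mu> \<in> Eplus_unit_on \<kappa> A \<longleftrightarrow> \<mu> \<in> Eplus \<kappa> \<and> (AE x in \<mu>. x \<in> A) \<and> emeasure \<mu> UNIV = 1"
  by (auto simp: Eplus_unit_on_def Eplus_on_iff)

text \<open>A Borel set charged by \<nu> contains a compact set of positive finite measure; \<tau>
  is the normalized restriction of \<nu> to it. The clause about \<open>P\<close> is absolute
  continuity in the form in which it is used.\<close>

lemma unit_restriction:
  assumes \<nu>: "\<nu> \<in> Eplus \<kappa>" and N: "N \<in> sets borel" and pos: "\<not> (AE x in \<nu>. x \<notin> N)"
  shows "\<exists>\<tau>\<in>Eplus \<kappa>. emeasure \<tau> UNIV = 1 \<and> (AE x in \<tau>. x \<in> N) \<and>
    (\<forall>P. (AE x in \<nu>. P x) \<longrightarrow> (AE x in \<tau>. P x))"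
proof -
  have r: "\<nu> \<in> radon" and s: "sets \<nu> = sets borel" and sp: "space \<nu> = UNIV"
    using Eplus_radon[OF \<nu>] radon_sets[OF Eplus_radon[OF \<nu>]] radon_space[OF Eplus_radon[OF \<nu>]] by auto
  have "emeasure \<nu> N \<noteq> 0"
    using pos N s AE_I[of \<nu> "\<lambda>x. x \<notin> N" N] by auto
  then obtain K where K: "compact K" "K \<subseteq> N" "emeasure \<nu> K > 0"
    using radon_inner_pos[OF r N] by (auto simp: zero_less_iff_neq_zero)
  have Ks: "K \<in> sets \<nu>" using K(1) s by simp
  have mK: "emeasure \<nu> K = ennreal (measure \<nu> K)"
    using radon_compact[OF r K(1)] by (simp add: emeasure_eq_ennreal_measure less_top)
  then have mK0: "measure \<nu> K > 0" using K(3) by simp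
  define a where "a = 1 / measure \<nu> K"
  have a: "0 \<le> a" using mK0 by (simp add: a_def)
  define \<tau> where "\<tau> = scale_measure (ennreal a) (density \<nu> (indicator K))"
  have "\<tau> \<in> Eplus \<kappa>" unfolding \<tau>_def using K(1) by (intro Eplus_scale Eplus_restrict \<nu> a) simp
  moreover have "emeasure (density \<nu> (indicator K)) UNIV = emeasure \<nu> K"
    using Ks sp s by (subst emeasure_density) auto
  then have "emeasure \<tau> UNIV = 1"
    using mK0 by (simp add: \<tau>_def a_def mK flip: ennreal_mult)
  moreover have \<tau>: "\<tau> = density \<nu> (\<lambda>x. ennreal a * indicator K x)"
  proof (rule measure_eqI)
    show "sets \<tau> = sets (density \<nu> (\<lambda>x. ennreal a * indicator K x))" by (simp add: \<tau>_def)
    fix B assume "B \<in> sets \<tau>"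
    then have B: "B \<in> sets \<nu>" by (simp add: \<tau>_def)
    show "emeasure \<tau> B = emeasure (density \<nu> (\<lambda>x. ennreal a * indicator K x)) B"
      using B Ks by (simp add: \<tau>_def emeasure_density mult.assoc nn_integral_cmult)
  qed
  have "(\<lambda>x. ennreal a * indicator K x) \<in> borel_measurable \<nu>" using Ks by measurable
  from AE_density[OF this] have ae: "(AE x in \<tau>. P x) \<longleftrightarrow> (AE x in \<nu>. 0 < ennreal a * indicator K x \<longrightarrow> P x)" for P
    unfolding \<tau> .
  have "AE x in \<tau>. x \<in> N"
    unfolding ae using K(2) by (auto split: split_indicator)
  moreover have "AE x in \<tau>. P x" if "AE x in \<nu>. P x" for P
    unfolding ae using that by eventually_elim simp
  ultimately show ?thesis by blast
qed

lemma unit_not_AE_False: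
  assumes "emeasure \<tau> UNIV = 1" "\<tau> \<in> Eplus \<kappa>"
  shows "\<not> (AE x in \<tau>. False)"
proof
  assume "AE x in \<tau>. False"
  then obtain N where "{x\<in>space \<tau>. \<not> False} \<subseteq> N" "emeasure \<tau> N = 0" by (rule AE_E)
  then have "N = UNIV" "emeasure \<tau> N = 0" using radon_space[OF Eplus_radon[OF assms(2)]] by auto
  then show False using assms(1) by simp
qed

text \<open>Were \<nu> to charge the set where \<open>f\<close> is smaller than \<open>g\<close>, a
  unit measure concentrated on this set would reverse the integral inequality. This turns bounds on
  mutual energies into bounds on potentials.\<close>

lemma AE_le_by_units:
  fixes f g :: "'a \<Rightarrow> ennreal"
  assumes \<nu>: "\<nu> \<in> Eplus \<kappa>" and fm: "f \<in> borel_measurable borel" and gm: "g \<in> borel_measurable borel"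
    and le: "\<And>\<tau>. \<tau> \<in> Eplus \<kappa> \<Longrightarrow> emeasure \<tau> UNIV = 1 \<Longrightarrow> (\<And>P. AE x in \<nu>. P x \<Longrightarrow> AE x in \<tau>. P x) \<Longrightarrow>
      (\<integral>\<^sup>+x. f x \<partial>\<tau>) < \<infinity> \<and> (\<integral>\<^sup>+x. g x \<partial>\<tau>) \<le> (\<integral>\<^sup>+x. f x \<partial>\<tau>)"
  shows "AE x in \<nu>. g x \<le> f x"
proof (rule ccontr)
  assume n: "\<not> (AE x in \<nu>. g x \<le> f x)"
  define N where "N = {x\<in>space borel. f x < g x}"
  have N: "N \<in> sets borel" unfolding N_def using fm gm by measurable
  have nN: "\<not> (AE x in \<nu>. x \<notin> N)" using n by (simp add: N_def not_less)
  obtain \<tau> where \<tau>: "\<tau> \<in> Eplus \<kappa>" "emeasure \<tau> UNIV = 1" "AE x in \<tau>. x \<in> N"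
    and ac: "\<forall>P. (AE x in \<nu>. P x) \<longrightarrow> (AE x in \<tau>. P x)"
    by (rule bexE[OF unit_restriction[OF \<nu> N nN]]) blast
  have s: "sets \<tau> = sets borel" using radon_sets[OF Eplus_radon[OF \<tau>(1)]] .
  have lt: "AE x in \<tau>. f x < g x" using \<tau>(3) by (simp add: N_def)
  have "(\<integral>\<^sup>+x. f x \<partial>\<tau>) < (\<integral>\<^sup>+x. g x \<partial>\<tau>)"
  proof (rule nn_integral_less)
    show "f \<in> borel_measurable \<tau>" "g \<in> borel_measurable \<tau>"
      using fm gm s by (simp_all cong: measurable_cong_sets)
    show "(\<integral>\<^sup>+x. f x \<partial>\<tau>) \<noteq> \<infinity>" using le[OF \<tau>(1,2) ac[rule_format]] by auto
    show "AE x in \<tau>. f x \<le> g x" using lt by eventually_elim simp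
    show "\<not> (AE x in \<tau>. g x \<le> f x)"
    proof
      assume "AE x in \<tau>. g x \<le> f x"
      then have "AE x in \<tau>. False" using lt by eventually_elim simp
      then show False using unit_not_AE_False[OF \<tau>(2,1)] by simp
    qed
  qed
  then show False using le[OF \<tau>(1,2) ac[rule_format]] by auto
qed

lemma INF_energy_nonneg: "0 \<le> (INF \<mu>\<in>Eplus_unit_on \<kappa> N. energy \<kappa> \<mu>)"
  using ip_nonneg by (intro INF_greatest) (auto simp: unit_on_iff mutual_energy_Eplus(1))

text \<open>A single unit measure of finite energy on the exceptional set makes the infimum finite
  and the capacity positive. The arguments below about exceptional sets all rest on this form, which
  asks for neither measurability of the set nor subadditivity of the capacity.\<close>

lemma nearly_everywhere_iff:
  "nearly_everywhere \<kappa> A P \<longleftrightarrow> Eplus_unit_on \<kappa> {x\<in>A. \<not> P x} = {}"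
proof
  let ?N = "{x\<in>A. \<not> P x}"
  let ?w = "INF \<mu>\<in>Eplus_unit_on \<kappa> ?N. energy \<kappa> \<mu>"
  assume "nearly_everywhere \<kappa> A P"
  then have "1 / ?w = 0" by (simp add: nearly_everywhere_def inner_cap_def)
  then have "?w = \<infinity>" using INF_energy_nonneg[of ?N] by (cases ?w) (auto simp: one_ereal_def split: if_splits)
  moreover have "?w < \<infinity>" if "\<tau> \<in> Eplus_unit_on \<kappa> ?N" for \<tau>
  proof -
    have "?w \<le> energy \<kappa> \<tau>" using that by (rule INF_lower)
    then show ?thesis using that mutual_energy_Eplus(1)[of \<tau> \<tau>] by (auto simp: unit_on_iff intro: le_less_trans)
  qed
  ultimately show "Eplus_unit_on \<kappa> ?N = {}" by fastforce
next
  assume "Eplus_unit_on \<kappa> {x\<in>A. \<not> P x} = {}"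
  then show "nearly_everywhere \<kappa> A P" by (simp add: nearly_everywhere_def inner_cap_def top_ereal_def)
qed

text \<open>The exceptional set itself may fail to be measurable, hence the Borel set
  \<open>N\<close>. It need not lie in \<open>A\<close>, since \<nu> is concentrated there.\<close>

lemma nearly_everywhere_AE:
  assumes ne: "nearly_everywhere \<kappa> A P" and \<nu>: "\<nu> \<in> Eplus_on \<kappa> A"
    and N: "N \<in> sets borel" "\<And>x. x \<in> N \<Longrightarrow> \<not> P x"
  shows "AE x in \<nu>. x \<notin> N"
proof (rule ccontr)
  assume nN: "\<not> (AE x in \<nu>. x \<notin> N)"
  have \<nu>E: "\<nu> \<in> Eplus \<kappa>" "AE x in \<nu>. x \<in> A" using \<nu> by (simp_all add: Eplus_on_iff)
  obtain \<tau> where \<tau>: "\<tau> \<in> Eplus \<kappa>" "emeasure \<tau> UNIV = 1" "AE x in \<tau>. x \<in> N"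
    and ac: "\<forall>P. (AE x in \<nu>. P x) \<longrightarrow> (AE x in \<tau>. P x)"
    by (rule bexE[OF unit_restriction[OF \<nu>E(1) N(1) nN]]) blast
  have "AE x in \<tau>. x \<in> {x\<in>A. \<not> P x}"
    using \<tau>(3) ac[rule_format, OF \<nu>E(2)] by eventually_elim (use N(2) in auto)
  then have "\<tau> \<in> Eplus_unit_on \<kappa> {x\<in>A. \<not> P x}" using \<tau> by (simp add: unit_on_iff)
  then show False using ne nearly_everywhere_iff by blast
qed

section \<open>Strong limits of sequences of measures\<close>

lemma strong_limit_ip:
  assumes lim: "limitin (strong_topology \<kappa>) \<tau> \<gamma> sequentially" and \<tau>: "\<And>n. \<tau> n \<in> Eplus \<kappa>"
  shows "\<gamma> \<in> Eplus \<kappa>"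
    and "\<nu> \<in> Eplus \<kappa> \<Longrightarrow> (\<lambda>n. ip \<kappa> (\<tau> n) \<nu>) \<longlonglongrightarrow> ip \<kappa> \<gamma> \<nu>"
    and "(\<lambda>n. ip \<kappa> (\<tau> n) (\<tau> n)) \<longlonglongrightarrow> ip \<kappa> \<gamma> \<gamma>"
proof -
  have lim': "\<gamma> \<in> Eplus \<kappa>" "(\<lambda>n. energy_dist \<kappa> (\<tau> n) \<gamma>) \<longlonglongrightarrow> 0"
    using lim unfolding strong_topology_def energy.limitin_metric_dist_null by auto
  then show \<gamma>: "\<gamma> \<in> Eplus \<kappa>" by simp
  have d: "(\<lambda>n. (energy_dist \<kappa> (\<tau> n) \<nu>)\<^sup>2) \<longlonglongrightarrow> (energy_dist \<kappa> \<gamma> \<nu>)\<^sup>2" if \<nu>: "\<nu> \<in> Eplus \<kappa>" for \<nu>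
  proof (intro tendsto_power)
    have "\<bar>energy_dist \<kappa> (\<tau> n) \<nu> - energy_dist \<kappa> \<gamma> \<nu>\<bar> \<le> energy_dist \<kappa> (\<tau> n) \<gamma>" for n
      using energy_dist_triangle[OF \<tau> \<gamma> \<nu>, of n] energy_dist_triangle[OF \<gamma> \<tau> \<nu>, of n]
        energy.commute[of "\<tau> n" \<gamma>] by linarith
    then have "(\<lambda>n. energy_dist \<kappa> (\<tau> n) \<nu> - energy_dist \<kappa> \<gamma> \<nu>) \<longlonglongrightarrow> 0"
      by (intro Lim_null_comparison[OF _ lim'(2)]) simp
    then show "(\<lambda>n. energy_dist \<kappa> (\<tau> n) \<nu>) \<longlonglongrightarrow> energy_dist \<kappa> \<gamma> \<nu>"
      by (simp add: LIM_zero_iff)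
  qed
  \<comment> \<open>Polarization: the norm is the distance to the null measure, so convergence of
    distances carries over to inner products.\<close>
  have sq: "(energy_dist \<kappa> \<mu> \<nu>)\<^sup>2 = ip \<kappa> \<mu> \<mu> + ip \<kappa> \<nu> \<nu> - 2 * ip \<kappa> \<mu> \<nu>"
    if "\<mu> \<in> Eplus \<kappa>" "\<nu> \<in> Eplus \<kappa>" for \<mu> \<nu>
    using that ip_diff_nonneg by (simp add: energy_dist_eq)
  have sq0: "(energy_dist \<kappa> \<mu> (null_measure borel))\<^sup>2 = ip \<kappa> \<mu> \<mu>" if "\<mu> \<in> Eplus \<kappa>" for \<mu>
    using sq[OF that null_Eplus] ip_null[OF that] ip_null[OF null_Eplus] by simp
  show self: "(\<lambda>n. ip \<kappa> (\<tau> n) (\<tau> n)) \<longlonglongrightarrow> ip \<kappa> \<gamma> \<gamma>"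
    using d[OF null_Eplus] sq0[OF \<tau>] sq0[OF \<gamma>] by simp
  assume \<nu>: "\<nu> \<in> Eplus \<kappa>"
  have "(\<lambda>n. (ip \<kappa> (\<tau> n) (\<tau> n) + ip \<kappa> \<nu> \<nu> - (energy_dist \<kappa> (\<tau> n) \<nu>)\<^sup>2) / 2) \<longlonglongrightarrow>
      (ip \<kappa> \<gamma> \<gamma> + ip \<kappa> \<nu> \<nu> - (energy_dist \<kappa> \<gamma> \<nu>)\<^sup>2) / 2"
    by (intro tendsto_intros self d[OF \<nu>]) simp
  then show "(\<lambda>n. ip \<kappa> (\<tau> n) \<nu>) \<longlonglongrightarrow> ip \<kappa> \<gamma> \<nu>"
    unfolding sq[OF \<gamma> \<nu>] sq[OF \<tau> \<nu>] by simp
qed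

text \<open>This is where the strong topology being finer than the vague one enters: the measures
  whose integral of \<phi> lies in \<open>S\<close> form a strong neighbourhood of \<gamma>.\<close>

lemma strong_limit_vague:
  assumes lim: "limitin (strong_topology \<kappa>) \<tau> \<gamma> sequentially" and \<tau>: "\<And>n. \<tau> n \<in> Eplus \<kappa>"
    and \<phi>: "\<phi> \<in> Cc"
  shows "(\<lambda>n. integral\<^sup>L (\<tau> n) \<phi>) \<longlonglongrightarrow> integral\<^sup>L \<gamma> \<phi>"
proof (rule topological_tendstoI)
  fix S :: "real set" assume S: "open S" "integral\<^sup>L \<gamma> \<phi> \<in> S"
  let ?W = "{\<mu>\<in>radon. integral\<^sup>L \<mu> \<phi> \<in> S}"
  have "openin vague_topology ?W"
    unfolding vague_topology_def using S(1) \<phi> by (intro topology_generated_by_Basis) blast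
  then have "openin (subtopology vague_topology (Eplus \<kappa>)) (?W \<inter> Eplus \<kappa>)"
    by (auto simp: openin_subtopology)
  then have "openin (strong_topology \<kappa>) (?W \<inter> Eplus \<kappa>)"
    using perfect unfolding perfect_kernel_def by blast
  moreover have "\<gamma> \<in> ?W \<inter> Eplus \<kappa>" using strong_limit_ip(1)[OF lim \<tau>] S(2) Eplus_radon by auto
  ultimately have "eventually (\<lambda>n. \<tau> n \<in> ?W \<inter> Eplus \<kappa>) sequentially"
    using lim unfolding limitin_def by blast
  then show "eventually (\<lambda>n. integral\<^sup>L (\<tau> n) \<phi> \<in> S) sequentially"
    by eventually_elim simp
qed


section \<open>Equilibrium measures and positivity of mass\<close>

lemma null_Eplus_on: "null_measure borel \<in> Eplus_on \<kappa> A"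
  unfolding Eplus_on_iff using null_Eplus by (auto intro: AE_I[of _ _ UNIV])

text \<open>The parallelogram law makes a norm-minimizing sequence in a convex set Cauchy. Its
  strong limit \<gamma> may lie outside \<open>T\<close>, so the first-order condition at \<gamma>
  is obtained from segments that start at \<tau> n, by letting n tend to infinity.\<close>

lemma minimizing_sequence:
  assumes T: "T \<subseteq> Eplus \<kappa>" "T \<noteq> {}"
    and conv: "\<And>\<sigma> \<tau> t. \<sigma> \<in> T \<Longrightarrow> \<tau> \<in> T \<Longrightarrow> 0 \<le> t \<Longrightarrow> t \<le> 1 \<Longrightarrow>
      measure_add (scale_measure (ennreal (1 - t)) \<sigma>) (scale_measure (ennreal t) \<tau>) \<in> T"
  shows "\<exists>\<tau> \<gamma>. (\<forall>n. \<tau> n \<in> T) \<and> limitin (strong_topology \<kappa>) \<tau> \<gamma> sequentially \<and>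
    (\<forall>\<nu>\<in>T. ip \<kappa> \<gamma> \<gamma> \<le> ip \<kappa> \<nu> \<nu>) \<and> (\<forall>\<nu>\<in>T. ip \<kappa> \<gamma> \<gamma> \<le> ip \<kappa> \<gamma> \<nu>)"
proof -
  define w where "w = (INF \<nu>\<in>T. ip \<kappa> \<nu> \<nu>)"
  have E: "\<nu> \<in> Eplus \<kappa>" if "\<nu> \<in> T" for \<nu> using T(1) that by blast
  have bdd: "bdd_below ((\<lambda>\<nu>. ip \<kappa> \<nu> \<nu>) ` T)"
    using ip_nonneg E by (intro bdd_belowI[of _ 0]) auto
  have w: "w \<le> ip \<kappa> \<nu> \<nu>" if "\<nu> \<in> T" for \<nu>
    unfolding w_def by (rule cINF_lower[OF bdd that])
  have "\<exists>\<nu>\<in>T. ip \<kappa> \<nu> \<nu> < w + inverse (real (Suc n))" for n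
  proof -
    have "w < w + inverse (real (Suc n))" by simp
    then show ?thesis
      using cINF_less_iff[OF T(2) bdd, folded w_def, of "w + inverse (real (Suc n))"] by blast
  qed
  then have "\<exists>\<tau>. \<forall>n. \<tau> n \<in> T \<and> ip \<kappa> (\<tau> n) (\<tau> n) < w + inverse (real (Suc n))"
    by (intro choice) blast
  then obtain \<tau> where \<tau>: "\<And>n. \<tau> n \<in> T" "\<And>n. ip \<kappa> (\<tau> n) (\<tau> n) < w + inverse (real (Suc n))"
    by blast
  have comb: "ip \<kappa> (measure_add (scale_measure (ennreal (1 - t)) \<sigma>) (scale_measure (ennreal t) \<rho>))
        (measure_add (scale_measure (ennreal (1 - t)) \<sigma>) (scale_measure (ennreal t) \<rho>))
      = (1 - t)\<^sup>2 * ip \<kappa> \<sigma> \<sigma> + 2 * t * (1 - t) * ip \<kappa> \<sigma> \<rho> + t\<^sup>2 * ip \<kappa> \<rho> \<rho>"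
    if \<sigma>: "\<sigma> \<in> Eplus \<kappa>" and \<rho>: "\<rho> \<in> Eplus \<kappa>" and t: "0 \<le> t" "t \<le> 1" for \<sigma> \<rho> t
  proof -
    define s where "s = 1 - t"
    have s: "0 \<le> s" using t by (simp add: s_def)
    have S: "scale_measure (ennreal s) \<sigma> \<in> Eplus \<kappa>" "scale_measure (ennreal t) \<rho> \<in> Eplus \<kappa>"
      using Eplus_scale \<sigma> \<rho> s t by auto
    have "ip \<kappa> (measure_add (scale_measure (ennreal s) \<sigma>) (scale_measure (ennreal t) \<rho>))
        (measure_add (scale_measure (ennreal s) \<sigma>) (scale_measure (ennreal t) \<rho>))
      = s\<^sup>2 * ip \<kappa> \<sigma> \<sigma> + 2 * t * s * ip \<kappa> \<sigma> \<rho> + t\<^sup>2 * ip \<kappa> \<rho> \<rho>"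
      using S \<sigma> \<rho> s t(1) Eplus_add[OF S]
      by (simp add: ip_add_left ip_add_right ip_scale_left ip_scale_right ip_sym[of \<rho> \<sigma>]
          algebra_simps power2_eq_square)
    then show ?thesis unfolding s_def .
  qed
  have dist: "(energy_dist \<kappa> \<sigma> \<rho>)\<^sup>2 \<le> 2 * (ip \<kappa> \<sigma> \<sigma> - w) + 2 * (ip \<kappa> \<rho> \<rho> - w)"
    if \<sigma>: "\<sigma> \<in> T" and \<rho>: "\<rho> \<in> T" for \<sigma> \<rho>
  proof -
    \<comment> \<open>The midpoint of \<sigma> and \<rho> belongs to \<open>T\<close>, so its energy
      is at least \<open>w\<close>.\<close>
    have "w \<le> (1 - 1/2)\<^sup>2 * ip \<kappa> \<sigma> \<sigma> + 2 * (1/2) * (1 - 1/2) * ip \<kappa> \<sigma> \<rho> + (1/2)\<^sup>2 * ip \<kappa> \<rho> \<rho>"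
      using w[OF conv[OF \<sigma> \<rho>, of "1/2"]] comb[OF E[OF \<sigma>] E[OF \<rho>], of "1/2"] by simp
    then have "4 * w \<le> ip \<kappa> \<sigma> \<sigma> + 2 * ip \<kappa> \<sigma> \<rho> + ip \<kappa> \<rho> \<rho>" by (simp add: power2_eq_square)
    then show ?thesis
      using ip_diff_nonneg[OF E[OF \<sigma>] E[OF \<rho>]] by (simp add: energy_dist_eq E \<sigma> \<rho>)
  qed
  have "energy.MCauchy \<tau>"
    unfolding energy.MCauchy_def
  proof (intro conjI allI impI)
    show "range \<tau> \<subseteq> Eplus \<kappa>" using \<tau>(1) E by blast
    fix e :: real assume e: "e > 0"
    \<comment> \<open>The estimate \<open>dist\<close> adds two terms below
      \<open>2 * q\<close>.\<close>
    define q where "q = e\<^sup>2 / 4"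
    have "q > 0" using e by (simp add: q_def)
    then obtain N where N: "inverse (real (Suc N)) < q" using reals_Archimedean by blast
    have small: "ip \<kappa> (\<tau> n) (\<tau> n) - w < q" if "N \<le> n" for n
    proof -
      have "inverse (real (Suc n)) \<le> inverse (real (Suc N))" using that by (intro le_imp_inverse_le) auto
      then show ?thesis using \<tau>(2)[of n] N by linarith
    qed
    show "\<exists>N. \<forall>n n'. N \<le> n \<longrightarrow> N \<le> n' \<longrightarrow> energy_dist \<kappa> (\<tau> n) (\<tau> n') < e"
    proof (intro exI[of _ N] allI impI)
      fix n n' assume n: "N \<le> n" "N \<le> n'"
      have "(energy_dist \<kappa> (\<tau> n) (\<tau> n'))\<^sup>2
          \<le> 2 * (ip \<kappa> (\<tau> n) (\<tau> n) - w) + 2 * (ip \<kappa> (\<tau> n') (\<tau> n') - w)"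
        by (rule dist[OF \<tau>(1) \<tau>(1)])
      also have "\<dots> < 2 * q + 2 * q"
        by (intro add_strict_mono mult_strict_left_mono small n) simp_all
      also have "\<dots> = e\<^sup>2" by (simp add: q_def)
      finally have "(energy_dist \<kappa> (\<tau> n) (\<tau> n'))\<^sup>2 < e\<^sup>2" .
      then show "energy_dist \<kappa> (\<tau> n) (\<tau> n') < e" by (rule power2_less_imp_less[OF _ less_imp_le[OF e]])
    qed
  qed
  then obtain \<gamma> where lim: "limitin (strong_topology \<kappa>) \<tau> \<gamma> sequentially"
    using perfect unfolding perfect_kernel_def energy.mcomplete_def strong_topology_def by blast
  note L = strong_limit_ip[OF lim E[OF \<tau>(1)]]
  have "(\<lambda>n. ip \<kappa> (\<tau> n) (\<tau> n)) \<longlonglongrightarrow> w"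
  proof (rule tendsto_sandwich[where f = "\<lambda>_. w" and h = "\<lambda>n. w + inverse (real (Suc n))"])
    show "(\<lambda>n. w + inverse (real (Suc n))) \<longlonglongrightarrow> w"
      using tendsto_add[OF tendsto_const[of w] LIMSEQ_inverse_real_of_nat] by simp
    show "\<forall>\<^sub>F n in sequentially. w \<le> ip \<kappa> (\<tau> n) (\<tau> n)" using w \<tau>(1) by simp
    show "\<forall>\<^sub>F n in sequentially. ip \<kappa> (\<tau> n) (\<tau> n) \<le> w + inverse (real (Suc n))"
      using \<tau>(2) less_imp_le by (intro always_eventually allI) blast
  qed simp
  then have \<gamma>w: "ip \<kappa> \<gamma> \<gamma> = w" using L(3) LIMSEQ_unique by blast
  have var: "w \<le> ip \<kappa> \<gamma> \<nu>" if \<nu>: "\<nu> \<in> T" for \<nu>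
  proof (rule ccontr)
    define p q where "p = ip \<kappa> \<gamma> \<nu>" and "q = ip \<kappa> \<nu> \<nu>"
    assume "\<not> w \<le> ip \<kappa> \<gamma> \<nu>"
    then have pw: "p < w" by (simp add: p_def)
    have le: "w \<le> (1 - t)\<^sup>2 * w + 2 * t * (1 - t) * p + t\<^sup>2 * q" if t: "0 \<le> t" "t \<le> 1" for t
    proof (rule LIMSEQ_le_const)
      show "(\<lambda>n. (1 - t)\<^sup>2 * ip \<kappa> (\<tau> n) (\<tau> n) + 2 * t * (1 - t) * ip \<kappa> (\<tau> n) \<nu> + t\<^sup>2 * ip \<kappa> \<nu> \<nu>)
          \<longlonglongrightarrow> (1 - t)\<^sup>2 * w + 2 * t * (1 - t) * p + t\<^sup>2 * q"
        unfolding p_def q_def \<gamma>w[symmetric] by (intro tendsto_intros L(3) L(2)[OF E[OF \<nu>]])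
      show "\<exists>N. \<forall>n\<ge>N. w \<le> (1 - t)\<^sup>2 * ip \<kappa> (\<tau> n) (\<tau> n) + 2 * t * (1 - t) * ip \<kappa> (\<tau> n) \<nu> + t\<^sup>2 * ip \<kappa> \<nu> \<nu>"
        using w[OF conv[OF \<tau>(1) \<nu> t]] comb[OF E[OF \<tau>(1)] E[OF \<nu>] t] by simp
    qed
    \<comment> \<open>\<open>C\<close> is a positive bound for the coefficient of the quadratic term
      in \<open>t\<close>. A step with \<open>t * C \<le> w - p\<close> keeps that term too small to
      offset the linear gain \<open>2 * (w - p)\<close>.\<close>
    define C where "C = \<bar>w - 2 * p + q\<bar> + 1"
    have C: "C > 0" by (simp add: C_def)
    define t where "t = min 1 ((w - p) / C)"
    have t: "0 < t" "t \<le> 1" "t * C \<le> w - p"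
      using pw C by (auto simp: t_def min_def field_simps)
    have "w \<le> (1 - t)\<^sup>2 * w + 2 * t * (1 - t) * p + t\<^sup>2 * q" using le t by simp
    then have "0 \<le> t * (2 * (p - w) + t * (w - 2 * p + q))"
      by (simp add: algebra_simps power2_eq_square)
    then have "0 \<le> 2 * (p - w) + t * (w - 2 * p + q)" using t(1) by (simp add: zero_le_mult_iff)
    moreover have "t * (w - 2 * p + q) \<le> t * C" using t(1) by (intro mult_left_mono) (auto simp: C_def)
    ultimately have "0 \<le> 2 * (p - w) + (w - p)"
      using t(3) by (meson add_left_mono order_trans)
    then show False using pw by simp
  qed
  show ?thesis
    using \<tau>(1) lim w var \<gamma>w by (intro exI[of _ \<tau>] exI[of _ \<gamma>]) simp
qed

lemma unit_on_convex:
  assumes \<sigma>: "\<sigma> \<in> Eplus_unit_on \<kappa> A" and \<tau>: "\<tau> \<in> Eplus_unit_on \<kappa> A" and t: "0 \<le> t" "t \<le> (1::real)"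
  shows "measure_add (scale_measure (ennreal (1 - t)) \<sigma>) (scale_measure (ennreal t) \<tau>) \<in> Eplus_unit_on \<kappa> A"
proof -
  have E: "\<sigma> \<in> Eplus \<kappa>" "\<tau> \<in> Eplus \<kappa>" and m1: "emeasure \<sigma> UNIV = 1" "emeasure \<tau> UNIV = 1"
    using \<sigma> \<tau> by (auto simp: unit_on_iff)
  have s: "sets \<sigma> = sets borel" "sets \<tau> = sets borel" using E Eplus_radon radon_sets by auto
  have "ennreal (1 - t) + ennreal t = 1" using t by (simp flip: ennreal_plus)
  then have "emeasure (measure_add (scale_measure (ennreal (1 - t)) \<sigma>) (scale_measure (ennreal t) \<tau>)) UNIV = 1"
    using s m1 by (subst emeasure_measure_add) auto
  then show ?thesis
    using E \<sigma> \<tau> t s unfolding unit_on_iff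
    by (intro conjI Eplus_add Eplus_scale AE_measure_add AE_scale_measure) auto
qed

text \<open>Since \<open>U\<^sup>\<gamma>\<close> is lower semicontinuous, an upper bound valid \<open>\<gamma>\<close>-a.e. holds on the support of \<open>\<gamma>\<close>.\<close>
lemma Frostman_AE:
  assumes \<gamma>: "\<gamma> \<in> Eplus \<kappa>" and le: "AE x in \<gamma>. U \<gamma> x \<le> 1"
  shows "U \<gamma> x \<le> 1"
proof -
  have iff: "U \<gamma> y \<le> 1 \<longleftrightarrow> potential \<kappa> \<gamma> y \<le> 1" for y
    by (simp add: less_eq_ennreal.rep_eq enn2ereal_U[OF \<gamma>] one_ennreal.rep_eq)
  have "potential \<kappa> \<gamma> y \<le> 1" if y: "y \<in> support \<gamma>" for y
  proof (rule ccontr)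
    assume "\<not> potential \<kappa> \<gamma> y \<le> 1"
    then have "\<not> U \<gamma> y \<le> 1" using iff by simp
    then have "y \<in> {y. 1 < U \<gamma> y}" by simp
    then have "emeasure \<gamma> {y. 1 < U \<gamma> y} > 0"
      using y U_lsc[OF \<gamma>, of 1] unfolding support_def by blast
    moreover have "{y\<in>space \<gamma>. \<not> U \<gamma> y \<le> 1} = {y. 1 < U \<gamma> y}"
      using radon_space[OF Eplus_radon[OF \<gamma>]] by (auto simp: not_le)
    moreover have "{y. 1 < U \<gamma> y} \<in> sets \<gamma>"
      using U_lsc[OF \<gamma>, of 1] radon_sets[OF Eplus_radon[OF \<gamma>]] by simp
    ultimately show False using le AE_iff_measurable[of "{y. 1 < U \<gamma> y}" \<gamma> "\<lambda>y. U \<gamma> y \<le> 1"] by simp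
  qed
  then show ?thesis using first_max \<gamma> iff unfolding first_maximum_principle_def by blast
qed

text \<open>The mass is at most the integral of \<open>U \<gamma>\<close> against \<gamma>, which is
  the energy, and the energy is at most the mass. Equality throughout forces
  \<open>U \<gamma> = 1\<close> almost everywhere for \<gamma>, and Frostman's principle carries the
  upper bound to the whole space.\<close>

lemma equilibrium_le_1:
  assumes \<gamma>: "\<gamma> \<in> Eplus \<kappa>" and ge: "AE x in \<gamma>. 1 \<le> U \<gamma> x"
    and mass: "ennreal (ip \<kappa> \<gamma> \<gamma>) \<le> emeasure \<gamma> UNIV"
  shows "U \<gamma> x \<le> 1" and "emeasure \<gamma> UNIV = ennreal (ip \<kappa> \<gamma> \<gamma>)"
proof -
  have "emeasure \<gamma> UNIV = (\<integral>\<^sup>+x. 1 \<partial>\<gamma>)" using radon_space[OF Eplus_radon[OF \<gamma>]] by simp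
  also have "\<dots> \<le> (\<integral>\<^sup>+x. U \<gamma> x \<partial>\<gamma>)" using ge by (rule nn_integral_mono_AE)
  also have "\<dots> = ennreal (ip \<kappa> \<gamma> \<gamma>)" by (rule nn_integral_U[OF \<gamma> \<gamma>])
  finally show eq: "emeasure \<gamma> UNIV = ennreal (ip \<kappa> \<gamma> \<gamma>)" using mass by simp
  have "AE x in \<gamma>. U \<gamma> x \<le> 1"
  proof (rule ccontr)
    assume n: "\<not> (AE x in \<gamma>. U \<gamma> x \<le> 1)"
    have "(\<integral>\<^sup>+x. 1 \<partial>\<gamma>) < (\<integral>\<^sup>+x. U \<gamma> x \<partial>\<gamma>)"
      using U_measurable[OF \<gamma> \<gamma>] eq radon_space[OF Eplus_radon[OF \<gamma>]] ge n by (intro nn_integral_less) auto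
    then show False using eq nn_integral_U[OF \<gamma> \<gamma>] radon_space[OF Eplus_radon[OF \<gamma>]] by simp
  qed
  then show "U \<gamma> x \<le> 1" by (rule Frostman_AE[OF \<gamma>])
qed

text \<open>The first-order condition says that \<open>U \<gamma>\<close> has integral at least
  I(\<gamma>) against every unit measure on \<open>A\<close>. After division by I(\<gamma>), testing
  with unit measures gives the pointwise bound. \<gamma> itself need be neither a unit measure nor
  concentrated on \<open>A\<close>.\<close>

lemma normalized_minimizer_ge_1:
  assumes \<gamma>: "\<gamma> \<in> Eplus \<kappa>" and pos: "ip \<kappa> \<gamma> \<gamma> > 0"
    and var: "\<forall>\<nu>\<in>Eplus_unit_on \<kappa> A. ip \<kappa> \<gamma> \<gamma> \<le> ip \<kappa> \<gamma> \<nu>"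
    and \<nu>: "\<nu> \<in> Eplus_on \<kappa> A"
  defines "\<gamma>' \<equiv> scale_measure (ennreal (1 / ip \<kappa> \<gamma> \<gamma>)) \<gamma>"
  shows "\<gamma>' \<in> Eplus \<kappa>" and "ip \<kappa> \<gamma>' \<gamma>' = 1 / ip \<kappa> \<gamma> \<gamma>" and "AE x in \<nu>. 1 \<le> U \<gamma>' x"
proof -
  show \<gamma>': "\<gamma>' \<in> Eplus \<kappa>" unfolding \<gamma>'_def using pos by (intro Eplus_scale \<gamma>) simp
  show "ip \<kappa> \<gamma>' \<gamma>' = 1 / ip \<kappa> \<gamma> \<gamma>"
    unfolding \<gamma>'_def using pos \<gamma> \<gamma>'[unfolded \<gamma>'_def] by (simp add: ip_scale_left ip_scale_right)
  have \<nu>E: "\<nu> \<in> Eplus \<kappa>" "AE x in \<nu>. x \<in> A" using \<nu> by (simp_all add: Eplus_on_iff)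
  show "AE x in \<nu>. 1 \<le> U \<gamma>' x"
  proof (rule AE_le_by_units[OF \<nu>E(1) U_borel[OF \<gamma>']])
    fix \<tau> assume \<tau>: "\<tau> \<in> Eplus \<kappa>" "emeasure \<tau> UNIV = 1" "\<And>P. AE x in \<nu>. P x \<Longrightarrow> AE x in \<tau>. P x"
    have "\<tau> \<in> Eplus_unit_on \<kappa> A" using \<tau> \<nu>E(2) by (simp add: unit_on_iff)
    then have "1 \<le> ip \<kappa> \<gamma>' \<tau>"
      unfolding \<gamma>'_def using bspec[OF var, of \<tau>] pos \<gamma> \<tau>(1) by (simp add: ip_scale_left)
    then show "(\<integral>\<^sup>+x. U \<gamma>' x \<partial>\<tau>) < \<infinity> \<and> (\<integral>\<^sup>+x. 1 \<partial>\<tau>) \<le> (\<integral>\<^sup>+x. U \<gamma>' x \<partial>\<tau>)"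
      using \<tau>(2) radon_space[OF Eplus_radon[OF \<tau>(1)]] by (simp add: nn_integral_U[OF \<gamma>' \<tau>(1)])
  qed simp
qed

text \<open>Vague convergence suffices on a compact set: functions in \<open>Cc\<close> vanishing on
  \<open>K\<close> show that the limit has no mass off \<open>K\<close>, and one equal to 1 on
  \<open>K\<close> shows that no mass is lost.\<close>

lemma unit_strong_limit_compact:
  assumes K: "compact K" and \<tau>: "\<And>n. \<tau> n \<in> Eplus_unit_on \<kappa> K"
    and lim: "limitin (strong_topology \<kappa>) \<tau> \<gamma> sequentially"
  shows "\<gamma> \<in> Eplus_unit_on \<kappa> K"
proof -
  have E: "\<tau> n \<in> Eplus \<kappa>" and ae: "AE x in \<tau> n. x \<in> K" and m1: "emeasure (\<tau> n) UNIV = 1" for n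
    using \<tau> by (auto simp: unit_on_iff)
  have \<gamma>: "\<gamma> \<in> Eplus \<kappa>" by (rule strong_limit_ip(1)[OF lim E])
  have r: "\<gamma> \<in> radon" and s: "sets \<gamma> = sets borel" and sp: "space \<gamma> = UNIV"
    using Eplus_radon[OF \<gamma>] radon_sets[OF Eplus_radon[OF \<gamma>]] radon_space[OF Eplus_radon[OF \<gamma>]] by auto
  have cK: "closed K" using K by (rule compact_imp_closed)
  have "emeasure \<gamma> L = 0" if L: "compact L" "L \<subseteq> - K" for L
  proof -
    obtain \<phi> where \<phi>: "\<phi> \<in> Cc" "\<And>x. 0 \<le> \<phi> x" "\<And>x. \<phi> x \<le> 1"
      "\<And>x. x \<in> L \<Longrightarrow> \<phi> x = 1" "\<And>x. x \<notin> - K \<Longrightarrow> \<phi> x = 0"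
      using LCH_Urysohn[OF lc L(1) _ L(2)] cK by (metis open_Compl)
    have "integral\<^sup>L (\<tau> n) \<phi> = 0" for n
    proof (rule integral_eq_zero_AE)
      show "AE x in \<tau> n. \<phi> x = 0" using ae by eventually_elim (use \<phi>(5) in auto)
    qed
    then have "(\<lambda>n. 0) \<longlonglongrightarrow> integral\<^sup>L \<gamma> \<phi>" using strong_limit_vague[OF lim E \<phi>(1)] by simp
    then have 0: "integral\<^sup>L \<gamma> \<phi> = 0" by (simp add: LIMSEQ_const_iff)
    have fin: "emeasure \<gamma> L < \<infinity>" by (rule radon_compact[OF r L(1)])
    have "measure \<gamma> L = (\<integral>x. indicator L x \<partial>\<gamma>)" using sp by simp
    also have "\<dots> \<le> integral\<^sup>L \<gamma> \<phi>"
      using fin L(1) s \<phi> by (intro integral_mono Cc_integrable[OF \<phi>(1) r]) (auto split: split_indicator)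
    finally have "measure \<gamma> L = 0" using 0 measure_nonneg[of \<gamma> L] by linarith
    then show ?thesis using fin by (simp add: emeasure_eq_ennreal_measure less_top)
  qed
  then have "emeasure \<gamma> (- K) = 0"
    using cK by (subst radon_inner[OF r]) (auto intro!: SUP_eq_const)
  then have aeK: "AE x in \<gamma>. x \<in> K"
    using cK s by (intro AE_I[of _ _ "- K"]) auto
  have "emeasure \<gamma> UNIV = emeasure \<gamma> K"
    using aeK K s by (intro emeasure_eq_AE) auto
  then have fin: "emeasure \<gamma> UNIV < \<infinity>" using radon_compact[OF r K] by simp
  obtain \<phi> where \<phi>: "\<phi> \<in> Cc" "\<And>x. x \<in> K \<Longrightarrow> \<phi> x = 1"
    using LCH_Urysohn[OF lc K open_UNIV] by (metis subset_UNIV)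
  have one: "integral\<^sup>L \<rho> \<phi> = measure \<rho> UNIV" if "\<rho> \<in> radon" "AE x in \<rho>. x \<in> K" for \<rho>
  proof -
    have "integral\<^sup>L \<rho> \<phi> = integral\<^sup>L \<rho> (\<lambda>x. 1)"
    proof (rule integral_cong_AE)
      show "\<phi> \<in> borel_measurable \<rho>" using Cc_integrable[OF \<phi>(1) that(1)] by simp
      show "AE x in \<rho>. \<phi> x = 1" using that(2) by eventually_elim (use \<phi>(2) in auto)
    qed simp
    then show ?thesis using radon_space[OF that(1)] by simp
  qed
  have "integral\<^sup>L (\<tau> n) \<phi> = 1" for n
    using one[OF Eplus_radon[OF E] ae] m1[of n] by (simp add: Sigma_Algebra.measure_def)
  then have "(\<lambda>n. 1) \<longlonglongrightarrow> integral\<^sup>L \<gamma> \<phi>" using strong_limit_vague[OF lim E \<phi>(1)] by simp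
  then have "measure \<gamma> UNIV = 1" using one[OF r aeK] by (simp add: LIMSEQ_const_iff)
  then have "emeasure \<gamma> UNIV = 1" using fin by (simp add: emeasure_eq_ennreal_measure less_top)
  then show ?thesis using \<gamma> aeK by (simp add: unit_on_iff)
qed

lemma compact_equilibrium:
  assumes K: "compact K" and ne: "Eplus_unit_on \<kappa> K \<noteq> {}"
  obtains \<gamma> where "\<gamma> \<in> Eplus_on \<kappa> K" "\<And>x. U \<gamma> x \<le> 1" "emeasure \<gamma> UNIV = ennreal (ip \<kappa> \<gamma> \<gamma>)"
    "\<And>\<nu>. \<nu> \<in> Eplus_on \<kappa> K \<Longrightarrow> AE x in \<nu>. 1 \<le> U \<gamma> x"
proof -
  have sub: "Eplus_unit_on \<kappa> K \<subseteq> Eplus \<kappa>" by (auto simp: unit_on_iff)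
  obtain \<tau> \<gamma> where \<tau>: "\<And>n. \<tau> n \<in> Eplus_unit_on \<kappa> K"
    and lim: "limitin (strong_topology \<kappa>) \<tau> \<gamma> sequentially"
    and var: "\<forall>\<nu>\<in>Eplus_unit_on \<kappa> K. ip \<kappa> \<gamma> \<gamma> \<le> ip \<kappa> \<gamma> \<nu>"
    using minimizing_sequence[OF sub ne unit_on_convex] by blast
  have \<gamma>1: "\<gamma> \<in> Eplus_unit_on \<kappa> K" by (rule unit_strong_limit_compact[OF K \<tau> lim])
  then have \<gamma>: "\<gamma> \<in> Eplus \<kappa>" "AE x in \<gamma>. x \<in> K" "emeasure \<gamma> UNIV = 1" by (auto simp: unit_on_iff)
  \<comment> \<open>By the energy principle a measure of energy 0 is null, which unit mass excludes.
    Normalization then makes both mass and energy equal to 1 / I(\<gamma>).\<close>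
  have "ip \<kappa> \<gamma> \<gamma> \<noteq> 0"
  proof
    assume "ip \<kappa> \<gamma> \<gamma> = 0"
    then have "\<gamma> = null_measure borel"
      using ip_diff_eq_0[OF \<gamma>(1) null_Eplus] ip_null[OF \<gamma>(1)] ip_null[OF null_Eplus] by simp
    then show False using \<gamma>(3) by simp
  qed
  then have pos: "ip \<kappa> \<gamma> \<gamma> > 0" using ip_nonneg[OF \<gamma>(1) \<gamma>(1)] by simp
  define \<gamma>' where "\<gamma>' = scale_measure (ennreal (1 / ip \<kappa> \<gamma> \<gamma>)) \<gamma>"
  note N = normalized_minimizer_ge_1[OF \<gamma>(1) pos var, folded \<gamma>'_def]
  have on: "\<gamma>' \<in> Eplus_on \<kappa> K"
    using N(1)[OF null_Eplus_on] \<gamma>(2) unfolding \<gamma>'_def by (auto simp: Eplus_on_iff intro: AE_scale_measure)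
  have ge: "AE x in \<nu>. 1 \<le> U \<gamma>' x" if "\<nu> \<in> Eplus_on \<kappa> K" for \<nu> by (rule N(3)[OF that])
  have \<gamma>'E: "\<gamma>' \<in> Eplus \<kappa>" using on by (simp add: Eplus_on_iff)
  have "emeasure \<gamma>' UNIV = ennreal (1 / ip \<kappa> \<gamma> \<gamma>)" unfolding \<gamma>'_def using \<gamma>(3) by simp
  then have "ennreal (ip \<kappa> \<gamma>' \<gamma>') \<le> emeasure \<gamma>' UNIV" using N(2)[OF on] by simp
  note eq = equilibrium_le_1[OF \<gamma>'E ge[OF on] this]
  show thesis by (rule that[OF on eq ge])
qed

lemma nn_integral_restrict_le:
  fixes f :: "'a \<Rightarrow> ennreal"
  assumes \<mu>: "\<mu> \<in> Eplus \<kappa>" and S: "S \<in> sets borel" and f: "f \<in> borel_measurable borel"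
  shows "(\<integral>\<^sup>+x. f x \<partial>density \<mu> (indicator S)) \<le> (\<integral>\<^sup>+x. f x \<partial>\<mu>)"
proof -
  have s: "sets \<mu> = sets borel" using radon_sets[OF Eplus_radon[OF \<mu>]] .
  have "(\<integral>\<^sup>+x. f x \<partial>density \<mu> (indicator S)) = (\<integral>\<^sup>+x. indicator S x * f x \<partial>\<mu>)"
    using S f s by (intro nn_integral_density) (auto cong: measurable_cong_sets)
  also have "\<dots> \<le> (\<integral>\<^sup>+x. f x \<partial>\<mu>)"
    by (intro nn_integral_mono) (auto split: split_indicator)
  finally show ?thesis .
qed

lemma restrict_compact:
  assumes \<mu>: "\<mu> \<in> Eplus \<kappa>" and K: "compact K"
  shows "density \<mu> (indicator K) \<in> Eplus_on \<kappa> K"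
    and "emeasure (density \<mu> (indicator K)) UNIV = emeasure \<mu> K"
    and "emeasure \<mu> K > 0 \<Longrightarrow> Eplus_unit_on \<kappa> K \<noteq> {}"
proof -
  have Ks: "K \<in> sets borel" using K by simp
  have s: "sets \<mu> = sets borel" and sp: "space \<mu> = UNIV"
    using radon_sets[OF Eplus_radon[OF \<mu>]] radon_space[OF Eplus_radon[OF \<mu>]] .
  have "AE x in density \<mu> (indicator K). x \<in> K"
    using Ks s by (subst AE_density) (auto split: split_indicator)
  then show "density \<mu> (indicator K) \<in> Eplus_on \<kappa> K"
    using Eplus_restrict[OF \<mu> Ks] by (simp add: Eplus_on_iff)
  show "emeasure (density \<mu> (indicator K)) UNIV = emeasure \<mu> K"
    using Ks s sp by (subst emeasure_density) auto
  assume pos: "emeasure \<mu> K > 0"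
  have "\<not> (AE x in \<mu>. x \<notin> K)"
    using pos Ks s sp AE_iff_measurable[of K \<mu> "\<lambda>x. x \<notin> K"] by auto
  then have "\<exists>\<tau>\<in>Eplus \<kappa>. emeasure \<tau> UNIV = 1 \<and> (AE x in \<tau>. x \<in> K)"
    using unit_restriction[OF \<mu> Ks] by blast
  then show "Eplus_unit_on \<kappa> K \<noteq> {}" by (auto simp: unit_on_iff)
qed

lemma mass_le_nn_integral:
  assumes "\<mu> \<in> Eplus \<kappa>" "AE x in \<mu>. 1 \<le> f x"
  shows "emeasure \<mu> UNIV \<le> (\<integral>\<^sup>+x. f x \<partial>\<mu>)"
proof -
  have "emeasure \<mu> UNIV = (\<integral>\<^sup>+x. 1 \<partial>\<mu>)"
    using radon_space[OF Eplus_radon[OF assms(1)]] by simp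
  also have "\<dots> \<le> (\<integral>\<^sup>+x. f x \<partial>\<mu>)" by (rule nn_integral_mono_AE[OF assms(2)])
  finally show ?thesis .
qed

lemma nn_integral_le_mass:
  assumes "\<mu> \<in> Eplus \<kappa>" "\<And>x. f x \<le> 1"
  shows "(\<integral>\<^sup>+x. f x \<partial>\<mu>) \<le> emeasure \<mu> UNIV"
proof -
  have "(\<integral>\<^sup>+x. f x \<partial>\<mu>) \<le> (\<integral>\<^sup>+x. 1 \<partial>\<mu>)" by (intro nn_integral_mono assms(2))
  also have "\<dots> = emeasure \<mu> UNIV" using radon_space[OF Eplus_radon[OF assms(1)]] by simp
  finally show ?thesis .
qed

lemma nn_integral_U_sym:
  assumes "\<mu> \<in> Eplus \<kappa>" "\<nu> \<in> Eplus \<kappa>"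
  shows "(\<integral>\<^sup>+x. U \<mu> x \<partial>\<nu>) = (\<integral>\<^sup>+x. U \<nu> x \<partial>\<mu>)"
  using nn_integral_U[OF assms] nn_integral_U[OF assms(2,1)] ip_sym[OF assms] by simp

text \<open>The constant 1 need not be a potential. On a compact \<open>K\<close> it is replaced by
  the equilibrium potential, which is at least 1 almost everywhere for \<mu> restricted to
  \<open>K\<close> and at most 1 everywhere; symmetry of the energy then transfers the comparison of
  potentials to masses.\<close>

proposition positivity_of_mass:
  assumes \<mu>: "\<mu> \<in> Eplus \<kappa>" and \<nu>: "\<nu> \<in> Eplus \<kappa>" and le: "\<And>x. U \<mu> x \<le> U \<nu> x"
  shows "emeasure \<mu> UNIV \<le> emeasure \<nu> UNIV"
proof -
  have "emeasure \<mu> K \<le> emeasure \<nu> UNIV" if K: "compact K" for K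
  \<comment> \<open>A compact set that \<mu> does not charge may carry no unit measure of finite
    energy, and then has no equilibrium measure to test with.\<close>
  proof (cases "emeasure \<mu> K = 0")
    case False
    then have "Eplus_unit_on \<kappa> K \<noteq> {}"
      using restrict_compact(3)[OF \<mu> K] by (simp add: zero_less_iff_neq_zero)
    then obtain \<gamma> where \<gamma>: "\<gamma> \<in> Eplus_on \<kappa> K" "\<And>x. U \<gamma> x \<le> 1"
        "\<And>\<nu>. \<nu> \<in> Eplus_on \<kappa> K \<Longrightarrow> AE x in \<nu>. 1 \<le> U \<gamma> x"
      using compact_equilibrium[OF K] by metis
    have \<gamma>E: "\<gamma> \<in> Eplus \<kappa>" using \<gamma>(1) by (simp add: Eplus_on_iff)
    note R = restrict_compact(1)[OF \<mu> K]
    have RE: "density \<mu> (indicator K) \<in> Eplus \<kappa>" using R by (simp add: Eplus_on_iff)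
    have "emeasure \<mu> K \<le> (\<integral>\<^sup>+x. U \<gamma> x \<partial>density \<mu> (indicator K))"
      using mass_le_nn_integral[OF RE \<gamma>(3)[OF R]] restrict_compact(2)[OF \<mu> K] by simp
    also have "\<dots> \<le> (\<integral>\<^sup>+x. U \<gamma> x \<partial>\<mu>)"
      using K by (intro nn_integral_restrict_le[OF \<mu>] U_borel[OF \<gamma>E]) simp
    also have "\<dots> = (\<integral>\<^sup>+x. U \<mu> x \<partial>\<gamma>)" by (rule nn_integral_U_sym[OF \<gamma>E \<mu>])
    also have "\<dots> \<le> (\<integral>\<^sup>+x. U \<nu> x \<partial>\<gamma>)" by (intro nn_integral_mono le)
    also have "\<dots> = (\<integral>\<^sup>+x. U \<gamma> x \<partial>\<nu>)" by (rule nn_integral_U_sym[OF \<nu> \<gamma>E])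
    also have "\<dots> \<le> emeasure \<nu> UNIV" by (rule nn_integral_le_mass[OF \<nu> \<gamma>(2)])
    finally show ?thesis .
  qed simp
  then show ?thesis
    by (subst radon_inner[OF Eplus_radon[OF \<mu>]]) (auto intro!: SUP_least)
qed

lemma domination:
  assumes \<mu>: "\<mu> \<in> Eplus \<kappa>" and \<nu>: "\<nu> \<in> Eplus \<kappa>" and le: "AE x in \<mu>. U \<mu> x \<le> U \<nu> x"
  shows "U \<mu> x \<le> U \<nu> x"
  using second_max \<mu> \<nu> le unfolding second_maximum_principle_def U_le_iff[OF \<mu> \<nu>] by blast

lemma Eplus_on_mono: "K \<subseteq> A \<Longrightarrow> \<mu> \<in> Eplus_on \<kappa> K \<Longrightarrow> \<mu> \<in> Eplus_on \<kappa> A"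
  unfolding Eplus_on_iff by (auto elim: eventually_mono)

text \<open>\<open>A\<close> need not be measurable, so inner regularity is applied to the
  complement of a null set that covers the complement of \<open>A\<close>.\<close>

lemma unit_compact_approx:
  assumes \<tau>: "\<tau> \<in> Eplus_unit_on \<kappa> A" and a: "a < 1"
  obtains K where "compact K" "K \<subseteq> A" "a < emeasure \<tau> K"
proof -
  have E: "\<tau> \<in> Eplus \<kappa>" "AE x in \<tau>. x \<in> A" "emeasure \<tau> UNIV = 1" using \<tau> by (auto simp: unit_on_iff)
  have s: "sets \<tau> = sets borel" and sp: "space \<tau> = UNIV"
    using radon_sets[OF Eplus_radon[OF E(1)]] radon_space[OF Eplus_radon[OF E(1)]] .
  obtain N where N: "{x\<in>space \<tau>. x \<notin> A} \<subseteq> N" "emeasure \<tau> N = 0" "N \<in> sets \<tau>"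
    using E(2) by (rule AE_E)
  have "emeasure \<tau> (space \<tau> - N) = emeasure \<tau> (space \<tau>) - emeasure \<tau> N"
    using N by (intro emeasure_compl) auto
  then have 1: "emeasure \<tau> (- N) = 1" using N(2) E(3) sp by (simp add: Compl_eq_Diff_UNIV)
  have Nb: "- N \<in> sets borel" using N(3) s by auto
  have "a < (SUP K\<in>{K. compact K \<and> K \<subseteq> - N}. emeasure \<tau> K)"
    using a 1 radon_inner[OF Eplus_radon[OF E(1)] Nb] by simp
  then obtain K where "compact K" "K \<subseteq> - N" "a < emeasure \<tau> K" by (auto simp: less_SUP_iff)
  moreover have "- N \<subseteq> A" using N(1) sp by auto
  ultimately show thesis by (intro that[of K]) auto
qed

text \<open>A minimizing sequence of unit measures could a priori lose mass in the limit. Testing the limit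
  against the equilibrium measures of compact subsets of \<open>A\<close> shows that this does not happen.\<close>
proposition equilibrium_measure:
  assumes closed: "closedin (strong_topology \<kappa>) (Eplus_on \<kappa> A)"
    and ne: "Eplus_unit_on \<kappa> A \<noteq> {}" and cap: "inner_cap \<kappa> A < \<infinity>"
  obtains \<gamma> w where "0 < w" "inner_cap \<kappa> A = ereal (1 / w)" "\<gamma> \<in> Eplus_on \<kappa> A"
    "emeasure \<gamma> UNIV = ennreal (1 / w)" "\<And>x. U \<gamma> x \<le> 1"
    "\<And>\<nu>. \<nu> \<in> Eplus_on \<kappa> A \<Longrightarrow> AE x in \<nu>. 1 \<le> U \<gamma> x"
proof -
  have sub: "Eplus_unit_on \<kappa> A \<subseteq> Eplus \<kappa>" by (auto simp: unit_on_iff)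
  obtain \<tau> \<gamma>0 where \<tau>: "\<And>n. \<tau> n \<in> Eplus_unit_on \<kappa> A"
    and lim: "limitin (strong_topology \<kappa>) \<tau> \<gamma>0 sequentially"
    and min: "\<And>\<nu>. \<nu> \<in> Eplus_unit_on \<kappa> A \<Longrightarrow> ip \<kappa> \<gamma>0 \<gamma>0 \<le> ip \<kappa> \<nu> \<nu>"
    and var: "\<forall>\<nu>\<in>Eplus_unit_on \<kappa> A. ip \<kappa> \<gamma>0 \<gamma>0 \<le> ip \<kappa> \<gamma>0 \<nu>"
    using minimizing_sequence[OF sub ne unit_on_convex] by blast
  have \<tau>E: "\<tau> n \<in> Eplus \<kappa>" for n using \<tau> sub by blast
  define w where "w = ip \<kappa> \<gamma>0 \<gamma>0"
  have lim_w: "(\<lambda>n. ip \<kappa> (\<tau> n) (\<tau> n)) \<longlonglongrightarrow> w"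
    unfolding w_def by (rule strong_limit_ip(3)[OF lim \<tau>E])
  have "\<gamma>0 \<in> Eplus_on \<kappa> A"
    using lim closed \<tau> by (intro limitin_closedin[OF lim closed]) (auto simp: unit_on_iff Eplus_on_iff)
  then have \<gamma>0: "\<gamma>0 \<in> Eplus \<kappa>" "AE x in \<gamma>0. x \<in> A" by (simp_all add: Eplus_on_iff)
  have INF: "(INF \<mu>\<in>Eplus_unit_on \<kappa> A. energy \<kappa> \<mu>) = ereal w"
  proof (rule antisym)
    show "ereal w \<le> (INF \<mu>\<in>Eplus_unit_on \<kappa> A. energy \<kappa> \<mu>)"
      using min by (intro INF_greatest) (auto simp: w_def unit_on_iff mutual_energy_Eplus(1))
    have "(INF \<mu>\<in>Eplus_unit_on \<kappa> A. energy \<kappa> \<mu>) \<le> ereal (ip \<kappa> (\<tau> n) (\<tau> n))" for n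
      using INF_lower[OF \<tau>[of n], of "energy \<kappa>"] mutual_energy_Eplus(1)[OF \<tau>E \<tau>E] by simp
    moreover have "(\<lambda>n. ereal (ip \<kappa> (\<tau> n) (\<tau> n))) \<longlonglongrightarrow> ereal w" using lim_w by simp
    ultimately show "(INF \<mu>\<in>Eplus_unit_on \<kappa> A. energy \<kappa> \<mu>) \<le> ereal w"
      by (meson LIMSEQ_le_const)
  qed
  have w0: "0 \<le> w" unfolding w_def by (rule ip_nonneg[OF \<gamma>0(1) \<gamma>0(1)])
  have w: "0 < w"
  proof (rule ccontr)
    assume "\<not> 0 < w"
    then have "w = 0" using w0 by simp
    then have "inner_cap \<kappa> A = \<infinity>" unfolding inner_cap_def INF by (simp add: one_ereal_def)
    then show False using cap by simp
  qed
  have cap_eq: "inner_cap \<kappa> A = ereal (1 / w)"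
    unfolding inner_cap_def INF using w by (simp add: one_ereal_def)
  define \<gamma> where "\<gamma> = scale_measure (ennreal (1 / w)) \<gamma>0"
  note N = normalized_minimizer_ge_1[OF \<gamma>0(1) w[unfolded w_def] var, folded w_def, folded \<gamma>_def]
  have on: "\<gamma> \<in> Eplus_on \<kappa> A"
    using N(1)[OF null_Eplus_on] \<gamma>0(2) unfolding \<gamma>_def by (auto simp: Eplus_on_iff intro: AE_scale_measure)
  have \<gamma>: "\<gamma> \<in> Eplus \<kappa>" and ipg: "ip \<kappa> \<gamma> \<gamma> = 1 / w" using N(1,2)[OF on] .
  have ge: "AE x in \<nu>. 1 \<le> U \<gamma> x" if "\<nu> \<in> Eplus_on \<kappa> A" for \<nu> by (rule N(3)[OF that])
  \<comment> \<open>Let \<open>g\<close> be the equilibrium measure of a compact \<open>K\<close> in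
    \<open>A\<close> with \<tau> n(K) > r. Nonnegativity of the squared distance of \<open>g\<close>
    to (1 / w) \<tau>K bounds the energy of \<open>g\<close> from below, which is also its mass, and
    the mass of \<open>g\<close> is at most that of \<gamma>. The factor 1 / w is the one that turns
    \<gamma>0 into \<gamma>.\<close>
  have test: "ennreal (2 * r / w - ip \<kappa> (\<tau> n) (\<tau> n) / w\<^sup>2) \<le> emeasure \<gamma> UNIV"
    if r: "0 \<le> r" "r < 1" for r n
  proof -
    obtain K where K: "compact K" "K \<subseteq> A" "ennreal r < emeasure (\<tau> n) K"
      using unit_compact_approx[OF \<tau>[of n], of "ennreal r"] r by (auto simp: ennreal_less_one_iff)
    define \<tau>K where "\<tau>K = density (\<tau> n) (indicator K)"
    have \<tau>K: "\<tau>K \<in> Eplus_on \<kappa> K" "emeasure \<tau>K UNIV = emeasure (\<tau> n) K"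
      unfolding \<tau>K_def by (rule restrict_compact[OF \<tau>E K(1)])+
    have "emeasure (\<tau> n) K > 0" using K(3) by (meson le_less_trans zero_le)
    then have "Eplus_unit_on \<kappa> K \<noteq> {}" by (rule restrict_compact(3)[OF \<tau>E K(1)])
    then obtain g where g: "g \<in> Eplus_on \<kappa> K" "\<And>x. U g x \<le> 1" "emeasure g UNIV = ennreal (ip \<kappa> g g)"
        "\<And>\<nu>. \<nu> \<in> Eplus_on \<kappa> K \<Longrightarrow> AE x in \<nu>. 1 \<le> U g x"
      using compact_equilibrium[OF K(1)] by metis
    have E: "g \<in> Eplus \<kappa>" "\<tau>K \<in> Eplus \<kappa>" using g(1) \<tau>K(1) by (simp_all add: Eplus_on_iff)
    have "ennreal r \<le> (\<integral>\<^sup>+x. U g x \<partial>\<tau>K)"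
      using mass_le_nn_integral[OF E(2) g(4)[OF \<tau>K(1)]] \<tau>K(2) K(3) by simp
    then have 1: "r \<le> ip \<kappa> g \<tau>K"
      using nn_integral_U[OF E] ip_nonneg[OF E] by simp
    have "(\<integral>\<^sup>+x. U \<tau>K x \<partial>\<tau>K) \<le> (\<integral>\<^sup>+x. U \<tau>K x \<partial>\<tau> n)"
      unfolding \<tau>K_def[symmetric] using nn_integral_restrict_le[OF \<tau>E _ U_borel[OF E(2)], of K n] K(1)
      by (simp add: \<tau>K_def[symmetric])
    also have "\<dots> = (\<integral>\<^sup>+x. U (\<tau> n) x \<partial>\<tau>K)" by (rule nn_integral_U_sym[OF E(2) \<tau>E])
    also have "\<dots> \<le> (\<integral>\<^sup>+x. U (\<tau> n) x \<partial>\<tau> n)"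
      using nn_integral_restrict_le[OF \<tau>E _ U_borel[OF \<tau>E], of K n n] K(1) by (simp add: \<tau>K_def)
    finally have 2: "ip \<kappa> \<tau>K \<tau>K \<le> ip \<kappa> (\<tau> n) (\<tau> n)"
      using ip_nonneg \<tau>E E by (simp add: nn_integral_U)
    have sE: "scale_measure (ennreal (1 / w)) \<tau>K \<in> Eplus \<kappa>" using w by (intro Eplus_scale E) simp
    have "0 \<le> ip \<kappa> g g + ip \<kappa> \<tau>K \<tau>K / w\<^sup>2 - 2 * (ip \<kappa> g \<tau>K / w)"
      using ip_diff_nonneg[OF E(1) sE] w E sE
      by (simp add: ip_scale_left ip_scale_right power2_eq_square)
    moreover have "ip \<kappa> \<tau>K \<tau>K / w\<^sup>2 \<le> ip \<kappa> (\<tau> n) (\<tau> n) / w\<^sup>2" using 2 by (simp add: divide_right_mono)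
    moreover have "r / w \<le> ip \<kappa> g \<tau>K / w" using 1 w by (simp add: divide_right_mono)
    ultimately have "2 * r / w - ip \<kappa> (\<tau> n) (\<tau> n) / w\<^sup>2 \<le> ip \<kappa> g g" by simp
    then have "ennreal (2 * r / w - ip \<kappa> (\<tau> n) (\<tau> n) / w\<^sup>2) \<le> emeasure g UNIV"
      unfolding g(3) by (rule ennreal_leI)
    also have "\<dots> \<le> (\<integral>\<^sup>+x. U \<gamma> x \<partial>g)"
      by (rule mass_le_nn_integral[OF E(1) ge[OF Eplus_on_mono[OF K(2) g(1)]]])
    also have "\<dots> = (\<integral>\<^sup>+x. U g x \<partial>\<gamma>)" by (rule nn_integral_U_sym[OF \<gamma> E(1)])
    also have "\<dots> \<le> emeasure \<gamma> UNIV" by (rule nn_integral_le_mass[OF \<gamma> g(2)])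
    finally show ?thesis .
  qed
  \<comment> \<open>Taking r = 1 - 1 / (n + 1) lets \<open>r\<close> tend to 1 together with n. The
    bound tends to 2 / w - 1 / w, the energy of \<gamma>.\<close>
  have "(\<lambda>n. ennreal (2 * (1 - inverse (real (Suc n))) / w - ip \<kappa> (\<tau> n) (\<tau> n) / w\<^sup>2)) \<longlonglongrightarrow>
      ennreal (2 * (1 - 0) / w - w / w\<^sup>2)"
    using w by (intro tendsto_ennrealI tendsto_intros lim_w LIMSEQ_inverse_real_of_nat) auto
  moreover have "ennreal (2 * (1 - inverse (real (Suc n))) / w - ip \<kappa> (\<tau> n) (\<tau> n) / w\<^sup>2) \<le> emeasure \<gamma> UNIV" for n
    by (rule test) (simp_all add: inverse_le_1_iff)
  ultimately have "ennreal (2 * (1 - 0) / w - w / w\<^sup>2) \<le> emeasure \<gamma> UNIV"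
    by (intro LIMSEQ_le_const2) auto
  also have "2 * (1 - 0) / w - w / w\<^sup>2 = ip \<kappa> \<gamma> \<gamma>"
    using w ipg by (simp add: power2_eq_square field_simps)
  finally have mass: "ennreal (ip \<kappa> \<gamma> \<gamma>) \<le> emeasure \<gamma> UNIV" .
  note eq = equilibrium_le_1[OF \<gamma> ge[OF on] mass]
  show thesis
    by (rule that[OF w cap_eq on _ eq(1) ge]) (use eq(2) ipg in simp_all)
qed

section \<open>The Gauss variational problem\<close>

lemma Eprime_closed:
  assumes "closedin (strong_topology \<kappa>) (Eplus_on \<kappa> A)"
  shows "Eprime \<kappa> A = Eplus_on \<kappa> A"
  unfolding Eprime_def using assms by (rule closure_of_closedin)

text \<open>\<zeta> belongs to its own class \<Gamma>, with empty exceptional set, and the balayage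
  has the least potential in that class.\<close>

lemma inner_balayage_U_le:
  assumes \<zeta>: "\<zeta> \<in> Eplus \<kappa>" and b: "is_inner_balayage \<kappa> A \<zeta> \<zeta>A" and E: "\<zeta>A \<in> Eplus \<kappa>"
  shows "U \<zeta>A x \<le> U \<zeta> x"
proof -
  have "Eplus_unit_on \<kappa> {} = {}"
    using unit_not_AE_False by (auto simp: unit_on_iff)
  then have "\<zeta> \<in> Gamma_class \<kappa> A \<zeta>"
    using \<zeta> by (simp add: Gamma_class_def nearly_everywhere_iff)
  then show ?thesis
    using b unfolding U_le_iff[OF E \<zeta>] is_inner_balayage_def by blast
qed

text \<open>The two potentials agree n.e. on \<open>A\<close>: one inequality is membership in
  \<Gamma>, the other holds everywhere. A measure of finite energy on \<open>A\<close> does not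
  charge the Borel set where they differ.\<close>

lemma inner_balayage_ip:
  assumes \<zeta>: "\<zeta> \<in> Eplus \<kappa>" and b: "is_inner_balayage \<kappa> A \<zeta> \<zeta>A" and E: "\<zeta>A \<in> Eplus \<kappa>"
    and \<nu>: "\<nu> \<in> Eplus_on \<kappa> A"
  shows "ip \<kappa> \<zeta>A \<nu> = ip \<kappa> \<zeta> \<nu>"
proof -
  have \<nu>E: "\<nu> \<in> Eplus \<kappa>" using \<nu> by (simp add: Eplus_on_iff)
  have ne: "nearly_everywhere \<kappa> A (\<lambda>x. potential \<kappa> \<zeta> x \<le> potential \<kappa> \<zeta>A x)"
    using b by (simp add: is_inner_balayage_def Gamma_class_def)
  have "AE x in \<nu>. x \<notin> {x\<in>space borel. U \<zeta>A x < U \<zeta> x}"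
  proof (rule nearly_everywhere_AE[OF ne \<nu>])
    show "{x\<in>space borel. U \<zeta>A x < U \<zeta> x} \<in> sets borel"
      using U_borel[OF E] U_borel[OF \<zeta>] by measurable
  qed (simp add: U_le_iff[OF \<zeta> E, symmetric])
  then have "AE x in \<nu>. U \<zeta>A x = U \<zeta> x"
    by eventually_elim (use inner_balayage_U_le[OF \<zeta> b E] in \<open>auto simp: not_less intro: antisym\<close>)
  then have "(\<integral>\<^sup>+x. U \<zeta>A x \<partial>\<nu>) = (\<integral>\<^sup>+x. U \<zeta> x \<partial>\<nu>)" by (rule nn_integral_cong_AE)
  then show ?thesis
    using nn_integral_U[OF E \<nu>E] nn_integral_U[OF \<zeta> \<nu>E] ip_nonneg[OF E \<nu>E] ip_nonneg[OF \<zeta> \<nu>E] by simp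
qed

lemma
  assumes \<zeta>: "\<zeta> \<in> Eplus \<kappa>" and \<nu>: "\<nu> \<in> Eplus \<kappa>"
  shows ext_integral_potential: "ext_integral \<nu> (\<lambda>x. - potential \<kappa> \<zeta> x) = ereal (- ip \<kappa> \<zeta> \<nu>)"
    and ext_integrable_potential: "ext_integrable \<nu> (\<lambda>x. - potential \<kappa> \<zeta> x)"
proof -
  have neg: "e2ennreal (- potential \<kappa> \<zeta> x) = 0" for x
    using potential_nonneg[OF \<zeta>, of x] by (intro e2ennreal_neg) simp
  show "ext_integral \<nu> (\<lambda>x. - potential \<kappa> \<zeta> x) = ereal (- ip \<kappa> \<zeta> \<nu>)"
    using nn_integral_U[OF \<zeta> \<nu>] ip_nonneg[OF \<zeta> \<nu>]
    by (simp add: ext_integral_def neg U_def zero_ennreal.rep_eq)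
  have "(\<lambda>x. enn2ereal (U \<zeta> x)) \<in> borel_measurable \<nu>"
    using U_measurable[OF \<zeta> \<nu>] by measurable
  then have "(\<lambda>x. - potential \<kappa> \<zeta> x) \<in> borel_measurable \<nu>"
    by (simp add: enn2ereal_U[OF \<zeta>])
  moreover have "(\<integral>\<^sup>+x. e2ennreal \<bar>- potential \<kappa> \<zeta> x\<bar> \<partial>\<nu>) < \<infinity>"
    using nn_integral_U[OF \<zeta> \<nu>] potential_nonneg[OF \<zeta>] by (simp add: U_def abs_ereal_pos)
  ultimately show "ext_integrable \<nu> (\<lambda>x. - potential \<kappa> \<zeta> x)" by (simp add: ext_integrable_def)
qed

lemma field_energy_potential:
  assumes "\<zeta> \<in> Eplus \<kappa>" "\<nu> \<in> Eplus \<kappa>"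
  shows "field_energy \<kappa> (\<lambda>x. - potential \<kappa> \<zeta> x) \<nu> = ereal (ip \<kappa> \<nu> \<nu> - 2 * ip \<kappa> \<zeta> \<nu>)"
  unfolding field_energy_def ext_integral_potential[OF assms] mutual_energy_Eplus(1)[OF assms(2,2)] by simp

text \<open>If \<open>I(\<lambda>, \<nu>) = I(\<zeta>, \<nu>) + h\<close> for all competitors \<open>\<nu>\<close>, then
  \<open>I\<^sub>f(\<nu>) - I\<^sub>f(\<lambda>) = \<parallel>\<nu> - \<lambda>\<parallel>\<^sup>2\<close>, so that \<open>\<lambda>\<close> is the only minimizer.\<close>
lemma field_minimizer_unique:
  assumes \<zeta>: "\<zeta> \<in> Eplus \<kappa>" and l: "l \<in> Eplus_unit_on \<kappa> A"
    and ip: "\<And>\<nu>. \<nu> \<in> Eplus_unit_on \<kappa> A \<Longrightarrow> ip \<kappa> l \<nu> = ip \<kappa> \<zeta> \<nu> + h"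
    and min: "is_field_minimizer \<kappa> (\<lambda>x. - potential \<kappa> \<zeta> x) A \<nu>"
  shows "\<nu> = l"
proof -
  let ?f = "\<lambda>x. - potential \<kappa> \<zeta> x"
  have lE: "l \<in> Eplus \<kappa>" using l by (simp add: unit_on_iff)
  have \<nu>: "\<nu> \<in> Eplus_unit_on \<kappa> A" using min by (simp add: is_field_minimizer_def Eplus_field_on_def)
  then have \<nu>E: "\<nu> \<in> Eplus \<kappa>" by (simp add: unit_on_iff)
  have "l \<in> Eplus_field_on \<kappa> ?f A"
    using l ext_integrable_potential[OF \<zeta> lE] by (simp add: Eplus_field_on_def)
  then have "field_energy \<kappa> ?f \<nu> \<le> field_energy \<kappa> ?f l"
    using min unfolding is_field_minimizer_def w_field_def by (auto intro: INF_lower)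
  then have "ip \<kappa> \<nu> \<nu> - 2 * ip \<kappa> \<zeta> \<nu> \<le> ip \<kappa> l l - 2 * ip \<kappa> \<zeta> l"
    by (simp add: field_energy_potential[OF \<zeta>] \<nu>E lE)
  then have "ip \<kappa> \<nu> \<nu> + ip \<kappa> l l - 2 * ip \<kappa> \<nu> l \<le> 0"
    using ip[OF \<nu>] ip[OF l] ip_sym[OF \<nu>E lE] by simp
  then have "ip \<kappa> \<nu> \<nu> + ip \<kappa> l l - 2 * ip \<kappa> \<nu> l = 0"
    using ip_diff_nonneg[OF \<nu>E lE] by simp
  then show ?thesis by (rule ip_diff_eq_0[OF \<nu>E lE])
qed

lemma Lambda_class_minimal:
  assumes \<zeta>: "\<zeta> \<in> Eplus \<kappa>" and l: "l \<in> Eplus_unit_on \<kappa> A" and h: "0 \<le> h"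
    and ip: "\<And>\<nu>. \<nu> \<in> Eplus_unit_on \<kappa> A \<Longrightarrow> ip \<kappa> l \<nu> = ip \<kappa> \<zeta> \<nu> + h"
  shows "l \<in> Lambda_class \<kappa> (\<lambda>x. - potential \<kappa> \<zeta> x) A (ereal h)"
    and "\<mu> \<in> Lambda_class \<kappa> (\<lambda>x. - potential \<kappa> \<zeta> x) A (ereal h) \<Longrightarrow> emeasure l UNIV \<le> emeasure \<mu> UNIV"
proof -
  let ?f = "\<lambda>x. - potential \<kappa> \<zeta> x"
  let ?P = "\<lambda>\<mu> x. weighted_potential_defined \<kappa> ?f \<mu> x \<and> weighted_potential \<kappa> ?f \<mu> x \<ge> ereal h"
  have lE: "l \<in> Eplus \<kappa>" and lA: "AE x in l. x \<in> A" using l by (simp_all add: unit_on_iff)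
  \<comment> \<open>Where the potential of \<zeta> is finite, the field can be moved to the other
    side; the exceptional values are treated separately.\<close>
  have P_iff: "?P \<mu> x \<longleftrightarrow> U \<zeta> x + ennreal h \<le> U \<mu> x" if \<mu>: "\<mu> \<in> Eplus \<kappa>" and fin: "U \<zeta> x < \<infinity>" for \<mu> x
    using fin h unfolding weighted_potential_defined_def weighted_potential_def
      enn2ereal_U[OF \<mu>, symmetric] enn2ereal_U[OF \<zeta>, symmetric]
    by (cases "U \<zeta> x"; cases "U \<mu> x") (auto simp: add.commute simp flip: ennreal_plus)
  have int: "(\<integral>\<^sup>+x. U \<zeta> x + ennreal h \<partial>\<tau>) = ennreal (ip \<kappa> \<zeta> \<tau> + h)"
    if \<tau>: "\<tau> \<in> Eplus \<kappa>" "emeasure \<tau> UNIV = 1" for \<tau>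
    using \<tau>(2) h radon_space[OF Eplus_radon[OF \<tau>(1)]] U_measurable[OF \<zeta> \<tau>(1)] ip_nonneg[OF \<zeta> \<tau>(1)]
    by (simp add: nn_integral_add nn_integral_U[OF \<zeta> \<tau>(1)])
  have "\<not> \<tau> \<in> Eplus_unit_on \<kappa> {x\<in>A. \<not> ?P l x}" for \<tau>
  proof
    assume "\<tau> \<in> Eplus_unit_on \<kappa> {x\<in>A. \<not> ?P l x}"
    then have \<tau>: "\<tau> \<in> Eplus \<kappa>" "emeasure \<tau> UNIV = 1" and ae: "AE x in \<tau>. x \<in> {x\<in>A. \<not> ?P l x}"
      by (simp_all only: unit_on_iff)
    have "AE x in \<tau>. x \<in> A" using ae by eventually_elim simp
    then have "\<tau> \<in> Eplus_unit_on \<kappa> A" using \<tau> by (simp add: unit_on_iff)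
    from ip[OF this] have eq: "(\<integral>\<^sup>+x. U l x \<partial>\<tau>) = (\<integral>\<^sup>+x. U \<zeta> x + ennreal h \<partial>\<tau>)"
      by (simp add: int[OF \<tau>] nn_integral_U[OF lE \<tau>(1)])
    \<comment> \<open>The integral of \<open>U \<zeta>\<close> against \<tau> is the finite mutual
      energy.\<close>
    have "AE x in \<tau>. U \<zeta> x \<noteq> \<infinity>"
      using nn_integral_U[OF \<zeta> \<tau>(1)] U_measurable[OF \<zeta> \<tau>(1)] by (intro nn_integral_noteq_infinite) auto
    then have lt: "AE x in \<tau>. U l x < U \<zeta> x + ennreal h"
      using ae
    proof eventually_elim
      case (elim x)
      then have "U \<zeta> x < \<infinity>" by (simp add: less_top)
      from P_iff[OF lE this] elim have "\<not> U \<zeta> x + ennreal h \<le> U l x" by blast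
      then show ?case by simp
    qed
    have "(\<integral>\<^sup>+x. U l x \<partial>\<tau>) < (\<integral>\<^sup>+x. U \<zeta> x + ennreal h \<partial>\<tau>)"
    proof (rule nn_integral_less)
      show "U l \<in> borel_measurable \<tau>" by (rule U_measurable[OF lE \<tau>(1)])
      show "(\<lambda>x. U \<zeta> x + ennreal h) \<in> borel_measurable \<tau>"
        using U_measurable[OF \<zeta> \<tau>(1)] by measurable
      show "(\<integral>\<^sup>+x. U l x \<partial>\<tau>) \<noteq> \<infinity>" using nn_integral_U[OF lE \<tau>(1)] by simp
      show "AE x in \<tau>. U l x \<le> U \<zeta> x + ennreal h" using lt by eventually_elim simp
      show "\<not> (AE x in \<tau>. U \<zeta> x + ennreal h \<le> U l x)"
      proof
        assume "AE x in \<tau>. U \<zeta> x + ennreal h \<le> U l x"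
        then have "AE x in \<tau>. False" using lt by eventually_elim simp
        then show False using unit_not_AE_False[OF \<tau>(2,1)] by simp
      qed
    qed
    then show False using eq by simp
  qed
  then have "nearly_everywhere \<kappa> A (?P l)" unfolding nearly_everywhere_iff by blast
  then show "l \<in> Lambda_class \<kappa> ?f A (ereal h)" using lE by (simp add: Lambda_class_def)

  assume "\<mu> \<in> Lambda_class \<kappa> ?f A (ereal h)"
  then have \<mu>: "\<mu> \<in> Eplus \<kappa>" and ne: "nearly_everywhere \<kappa> A (?P \<mu>)" by (simp_all add: Lambda_class_def)
  have lon: "l \<in> Eplus_on \<kappa> A" using lE lA by (simp add: Eplus_on_iff)
  have "AE x in l. x \<notin> {x\<in>space borel. U \<mu> x < U \<zeta> x + ennreal h}"
  proof (rule nearly_everywhere_AE[OF ne lon])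
    show "{x\<in>space borel. U \<mu> x < U \<zeta> x + ennreal h} \<in> sets borel"
      using U_borel[OF \<mu>] U_borel[OF \<zeta>] by measurable
    fix x assume "x \<in> {x\<in>space borel. U \<mu> x < U \<zeta> x + ennreal h}"
    then have x: "U \<mu> x < U \<zeta> x + ennreal h" by simp
    show "\<not> ?P \<mu> x"
    proof (cases "U \<zeta> x < \<infinity>")
      case True
      then show ?thesis unfolding P_iff[OF \<mu> True] using x by simp
    next
      case False
      \<comment> \<open>Here the weighted potential is undefined if the potential of \<mu> is
        infinite as well, and equals -\<infinity> otherwise, so \<open>?P\<close> fails in both
        cases.\<close>
      then have "potential \<kappa> \<zeta> x = \<infinity>" using enn2ereal_U[OF \<zeta>, of x] by (simp add: less_top[symmetric])
      then show ?thesis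
        unfolding weighted_potential_defined_def weighted_potential_def
        by (cases "potential \<kappa> \<mu> x") auto
    qed
  qed
  moreover have "AE x in l. U l x \<le> U \<zeta> x + ennreal h"
  proof (rule AE_le_by_units[OF lE _ U_borel[OF lE]])
    show "(\<lambda>x. U \<zeta> x + ennreal h) \<in> borel_measurable borel" using U_borel[OF \<zeta>] by measurable
    fix \<tau> assume \<tau>: "\<tau> \<in> Eplus \<kappa>" "emeasure \<tau> UNIV = 1" "\<And>P. AE x in l. P x \<Longrightarrow> AE x in \<tau>. P x"
    have "\<tau> \<in> Eplus_unit_on \<kappa> A" using \<tau> lA by (simp add: unit_on_iff)
    from ip[OF this] show "(\<integral>\<^sup>+x. U \<zeta> x + ennreal h \<partial>\<tau>) < \<infinity> \<and>
        (\<integral>\<^sup>+x. U l x \<partial>\<tau>) \<le> (\<integral>\<^sup>+x. U \<zeta> x + ennreal h \<partial>\<tau>)"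
      by (simp add: int[OF \<tau>(1,2)] nn_integral_U[OF lE \<tau>(1)])
  qed
  ultimately have "AE x in l. U l x \<le> U \<mu> x"
    by eventually_elim (auto simp: not_less intro: order_trans)
  then have "\<And>x. U l x \<le> U \<mu> x" by (rule domination[OF lE \<mu>])
  then show "emeasure l UNIV \<le> emeasure \<mu> UNIV" by (rule positivity_of_mass[OF lE \<mu>])
qed

end

theorem corollary1p6:
  fixes \<kappa> :: "'a::t2_space \<times> 'a \<Rightarrow> ereal"
    and A :: "'a set"
    and \<zeta> \<zeta>A lAf :: "'a measure"
    and f :: "'a \<Rightarrow> ereal"
    and \<eta>Af :: ereal
  assumes "locally_compact_space (euclidean :: 'a topology)"
    and "sigma_compact TYPE('a)"
    and "perfect_kernel \<kappa>"
    and "first_maximum_principle \<kappa>"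
    and "second_maximum_principle \<kappa>"
    and "closedin (strong_topology \<kappa>) (Eplus_on \<kappa> A)"
    and "\<zeta> \<in> Eplus \<kappa>" and "emeasure \<zeta> UNIV \<le> 1"
    and "f = (\<lambda>x. - potential \<kappa> \<zeta> x)"
    and "-\<infinity> < w_field \<kappa> f A" and "w_field \<kappa> f A < \<infinity>"
    and "is_inner_balayage \<kappa> A \<zeta> \<zeta>A"
    and "inner_cap \<kappa> A < \<infinity> \<or> emeasure \<zeta>A UNIV = 1"
    and "is_field_minimizer \<kappa> f A lAf"
    and "\<eta>Af = (1 - enn2ereal (emeasure \<zeta>A UNIV)) / inner_cap \<kappa> A"
  shows "lAf \<in> Lambda_class \<kappa> f A \<eta>Af \<and>
    (\<forall>\<mu>\<in>Lambda_class \<kappa> f A \<eta>Af. emeasure lAf UNIV \<le> emeasure \<mu> UNIV) \<and>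
    emeasure lAf UNIV = 1"
proof -
  note closed = assms(6) and \<zeta> = assms(7) and f = assms(9) and bal = assms(12) and min = assms(14)
  have ker: "kernel \<kappa>" using assms(3) by (simp add: perfect_kernel_def)
  obtain m :: real where m: "0 \<le> m" "m = 0 \<or> compact (UNIV :: 'a set)" "\<And>z. ereal (- m) \<le> \<kappa> z"
    by (rule kernel_bounded_below[OF ker], rule that) blast+
  interpret perfect_potential_theory \<kappa> m
    by unfold_locales (fact assms ker m)+
  have "\<zeta>A \<in> Eplus_on \<kappa> A"
    using bal Eprime_closed[OF closed] by (simp add: is_inner_balayage_def)
  then have \<zeta>A: "\<zeta>A \<in> Eplus \<kappa>" "AE x in \<zeta>A. x \<in> A" by (simp_all add: Eplus_on_iff)
  have ipA: "ip \<kappa> \<zeta>A \<nu> = ip \<kappa> \<zeta> \<nu>" if "\<nu> \<in> Eplus_unit_on \<kappa> A" for \<nu>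
    using that by (intro inner_balayage_ip[OF \<zeta> bal \<zeta>A(1)]) (simp add: Eplus_unit_on_def)
  have lA: "lAf \<in> Eplus_unit_on \<kappa> A"
    using min by (simp add: is_field_minimizer_def Eplus_field_on_def)
  \<comment> \<open>Balayage does not increase the potential, hence not the mass. This is what makes
    \<eta> nonnegative.\<close>
  have mass: "emeasure \<zeta>A UNIV \<le> 1"
    using positivity_of_mass[OF \<zeta>A(1) \<zeta> inner_balayage_U_le[OF \<zeta> bal \<zeta>A(1)]] assms(8) by (rule order_trans)
  have "\<exists>l h. l \<in> Eplus_unit_on \<kappa> A \<and> 0 \<le> h \<and> \<eta>Af = ereal h \<and>
      (\<forall>\<nu>\<in>Eplus_unit_on \<kappa> A. ip \<kappa> l \<nu> = ip \<kappa> \<zeta> \<nu> + h)"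
  proof (cases "emeasure \<zeta>A UNIV = 1")
    case True
    have "\<zeta>A \<in> Eplus_unit_on \<kappa> A" using \<zeta>A True by (simp add: unit_on_iff)
    \<comment> \<open>The numerator vanishes, and in \<open>ereal\<close> the quotient is then 0 for
      every capacity, finite or not.\<close>
    moreover have "\<eta>Af = ereal 0"
      using True by (simp add: assms(15) one_ennreal.rep_eq zero_ereal_def[symmetric])
    ultimately show ?thesis using ipA by (intro exI[of _ \<zeta>A] exI[of _ 0]) simp
  next
    case False
    then have cap: "inner_cap \<kappa> A < \<infinity>" using assms(13) by blast
    have ne: "Eplus_unit_on \<kappa> A \<noteq> {}" using lA by blast
    obtain \<gamma> w where w: "0 < w" "inner_cap \<kappa> A = ereal (1 / w)" and \<gamma>: "\<gamma> \<in> Eplus_on \<kappa> A"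
      "emeasure \<gamma> UNIV = ennreal (1 / w)" "\<And>x. U \<gamma> x \<le> 1"
      "\<And>\<nu>. \<nu> \<in> Eplus_on \<kappa> A \<Longrightarrow> AE x in \<nu>. 1 \<le> U \<gamma> x"
      using equilibrium_measure[OF closed ne cap] by metis
    have \<gamma>E: "\<gamma> \<in> Eplus \<kappa>" "AE x in \<gamma>. x \<in> A" using \<gamma>(1) by (simp_all add: Eplus_on_iff)
    obtain z where z: "emeasure \<zeta>A UNIV = ennreal z" "0 \<le> z" "z \<le> 1"
      using mass by (cases "emeasure \<zeta>A UNIV") (auto simp: top_unique)
    \<comment> \<open>This is \<eta>, because the capacity is 1 / w. As \<gamma> has mass 1 / w, the
      multiple \<open>h\<close> adds exactly the missing mass 1 - z.\<close>
    define h where "h = (1 - z) * w"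
    have h: "0 \<le> h" using z w by (simp add: h_def)
    have hE: "scale_measure (ennreal h) \<gamma> \<in> Eplus \<kappa>" by (rule Eplus_scale[OF \<gamma>E(1) h])
    define l where "l = measure_add \<zeta>A (scale_measure (ennreal h) \<gamma>)"
    have s: "sets (scale_measure (ennreal h) \<gamma>) = sets \<zeta>A" "UNIV \<in> sets \<zeta>A"
      using radon_sets[OF Eplus_radon[OF \<gamma>E(1)]] radon_sets[OF Eplus_radon[OF \<zeta>A(1)]] by simp_all
    have "emeasure l UNIV = ennreal z + ennreal h * ennreal (1 / w)"
      unfolding l_def by (subst emeasure_measure_add[OF s]) (simp add: z(1) \<gamma>(2))
    also have "\<dots> = ennreal (z + h * (1 / w))"
      using h z w by (simp add: ennreal_mult[symmetric])
    also have "z + h * (1 / w) = 1" using w by (simp add: h_def)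
    finally have "l \<in> Eplus_unit_on \<kappa> A"
      unfolding unit_on_iff l_def using s \<zeta>A \<gamma>E hE
      by (simp add: Eplus_add AE_measure_add AE_scale_measure)
    moreover have "\<eta>Af = ereal h"
      using z w by (simp add: assms(15) h_def one_ereal_def)
    moreover have "ip \<kappa> l \<nu> = ip \<kappa> \<zeta> \<nu> + h" if \<nu>: "\<nu> \<in> Eplus_unit_on \<kappa> A" for \<nu>
    proof -
      have \<nu>E: "\<nu> \<in> Eplus \<kappa>" "\<nu> \<in> Eplus_on \<kappa> A" "emeasure \<nu> UNIV = 1"
        using \<nu> by (simp_all add: unit_on_iff Eplus_on_iff)
      \<comment> \<open>\<open>U \<gamma>\<close> is at least 1 almost everywhere for \<nu> and at
        most 1 everywhere, and \<nu> has mass 1.\<close>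
      have "(\<integral>\<^sup>+x. U \<gamma> x \<partial>\<nu>) = 1"
        using mass_le_nn_integral[OF \<nu>E(1) \<gamma>(4)[OF \<nu>E(2)]] nn_integral_le_mass[of \<nu> "U \<gamma>", OF \<nu>E(1) \<gamma>(3)] \<nu>E(3)
        by simp
      then have "ip \<kappa> \<gamma> \<nu> = 1" using nn_integral_U[OF \<gamma>E(1) \<nu>E(1)] by simp
      then show ?thesis
        unfolding l_def ip_add_left[OF \<nu>E(1) \<zeta>A(1) hE] ip_scale_left[OF \<nu>E(1) \<gamma>E(1) h] ipA[OF \<nu>] by simp
    qed
    ultimately show ?thesis using h by blast
  qed
  then obtain l h where l: "l \<in> Eplus_unit_on \<kappa> A" and h: "0 \<le> h" "\<eta>Af = ereal h"
    and ip: "\<And>\<nu>. \<nu> \<in> Eplus_unit_on \<kappa> A \<Longrightarrow> ip \<kappa> l \<nu> = ip \<kappa> \<zeta> \<nu> + h"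
    by blast
  have "lAf = l"
    by (rule field_minimizer_unique[OF \<zeta> l ip min[unfolded f]])
  then show ?thesis
    using Lambda_class_minimal[OF \<zeta> l h(1) ip] l unfolding f h(2) by (simp add: unit_on_iff)
qed

end
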